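(* Let $\Gamma$ be a small category. For each $\Gamma$-category $\mathcal{X}$ (functor from $\Gamma$ to the category of small categories), the objectwise cubical nerve $\mathrm{ner}\,\mathcal{X}$ is a $\Gamma$-cubcat.
   Context: Cubical sets. For a natural number $k$, $[k]$ is the ordinal $\{0<1<\cdots<k\}$; posets are regarded as categories and $[k]^n$ is the product poset. $\square$ is the subcategory of the category $\mathbf{Cat}$ of small categories with objects $[1]^n$ ($n\geq 0$) and morphisms all composites of cofaces $[1]^{n-1}\to[1]^n$ (inserting a constant $0$ or $1$ in one coordinate), codegeneracies $[1]^{n+1}\to[1]^n$ (projections omitting one coordinate) and coordinate permutations. Cubical sets are presheaves of sets on $\square$, forming the category $\hat\square$; $\square[1]^n$ is the presheaf represented by $[1]^n$. The cubical nerve of a small category $\mathcal{X}$ is the cubical set with $(\mathrm{ner}\,\mathcal{X})_n=\mathbf{Cat}([1]^n,\mathcal{X})$. Streams. A circulation on a space $X$ assigns to each open $U\subset X$ a preorder $\leqslant_U$ on $U$ such that, for each collection $\mathcal{O}$ of open subsets, the preorder on $\bigcup\mathcal{O}$ is the one with smallest graph containing the graphs of all $\leqslant_U$, $U\in\mathcal{O}$. A stream is a space with a circulation; a stream map $f:X\to Y$ is a continuous function with $f(x)\leqslant_U f(y)$ whenever $U\subset Y$ is open and $x\leqslant_{f^{-1}U}y$. $\mathbf{DiTop}$ is the category of weak Hausdorff k-streams (k-stream: colimit of compact Hausdorff streams in all streams; weak Hausdorff: the underlying space is). $\vec{\mathbb{I}}^n$ is $[0,1]^n$ with the unique circulation whose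 value on the whole cube is the coordinatewise order. Directed realization $\|-\|:\hat\square\to\mathbf{DiTop}$ is the cocontinuous functor with $\|\square[1]^n\|=\vec{\mathbb{I}}^n$ (with the evident action on cofaces, codegeneracies, permutations); its right adjoint is $\mathrm{sing}$, $(\mathrm{sing}\,X)_n=\mathbf{DiTop}(\|\square[1]^n\|,X)$; $\mathbf{S}=\mathrm{sing}\,\|-\|$ is the resulting monad. $\Gamma$-cubical sets are functors $\Gamma\to\hat\square$ and $\Gamma$-cubical functions are natural transformations; functors on $\hat\square$ are applied objectwise. Subdivision. A Boolean interval in a finite lattice is an interval (order-convex subset with a minimum and a maximum) isomorphic to some $[1]^m$. For a finite distributive lattice $L$, $\square[L]$ is the cubical set with $\square[L]_m$ the set of lattice homomorphisms $[1]^m\to L$ mapping Boolean intervals onto Boolean intervals. $\mathrm{sd}_2:\hat\square\to\hat\square$ is the cocontinuous functor with $\mathrm{sd}_2\square[1]^n=\square[[2]^n]$, where $[2]^n$ is identified with the poset $([1]^n)^{[1]}$ of monotone functions $[1]\to[1]^n$ (for $n=1$, $\zeta\mapsto\zeta(0)+\zeta(1)$) and $\square$-morphisms act by postcomposition. Its right adjoint is $\mathrm{ex}_2$, $(\mathrm{ex}_2C)_n=\hat\square(\mathrm{sd}_2\square[1]^n,C)$. There is a natural isomorphism $\varphi_{C;2}:\|\mathrm{sd}_2C\|\cong\|C\|$ that for $C=\square[1]^n$ is linear on cells and sends the vertex $v\in[2]^n$ to $v/2\in[0,1]^n$. Cubcats. $(-)^\sharp:\hat\square\to\hat\square$ is the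 cocontinuous functor with $(\square[1]^n)^\sharp=\mathbf{S}\square[1]^n$, and $\eta_C:C\to C^\sharp$ is the natural map given on representables by the unit of $\mathbf{S}$. $\varphi^\sharp_{C;2}:C^\sharp\to\mathrm{ex}_2C^\sharp$ is the natural map given for $C=\square[1]^n$ by sending an $m$-cube $\theta:\|\square[1]^m\|\to\|\square[1]^n\|$ to the $m$-cube of $\mathrm{ex}_2\mathbf{S}\square[1]^n$ adjoint to $\theta\varphi_{\square[1]^m;2}:\|\mathrm{sd}_2\square[1]^m\|\to\|\square[1]^n\|$. A $\Gamma$-cubcat is a $\Gamma$-cubical set $C$ for which there exist $\Gamma$-cubical functions $\rho:C^\sharp\to C$ and $\mu:\mathrm{ex}_2C\to C$ with $\rho\eta_C=\mathrm{id}_C$ and $\rho=\mu\circ(\mathrm{ex}_2\rho)\circ\varphi^\sharp_{C;2}$. *)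

theory Defs
  imports "HOL-Analysis.Analysis"
begin

section \<open>Categories\<close>

text \<open>Hom-sets are compared by equality, so functors (and later cubical functions and stream maps)
  are extensional functions.  A category whose objects and arrows form sets is small.\<close>

record ('o, 'm) cat =
  Ob :: "'o set"
  Ar :: "'m set"
  src :: "'m \<Rightarrow> 'o"
  tgt :: "'m \<Rightarrow> 'o"
  idn :: "'o \<Rightarrow> 'm"
  cmp :: "'m \<Rightarrow> 'm \<Rightarrow> 'm"  \<comment> \<open>\<open>cmp C g f\<close> is \<open>g\<close> after \<open>f\<close>\<close>

definition category :: "('o, 'm) cat \<Rightarrow> bool" where
  "category C \<longleftrightarrow>
     src C \<in> Ar C \<rightarrow> Ob C \<and> tgt C \<in> Ar C \<rightarrow> Ob C \<and>
     (\<forall>a\<in>Ob C. idn C a \<in> Ar C \<and> src C (idn C a) = a \<and> tgt C (idn C a) = a) \<and>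
     (\<forall>f\<in>Ar C. \<forall>g\<in>Ar C. src C g = tgt C f \<longrightarrow>
        cmp C g f \<in> Ar C \<and> src C (cmp C g f) = src C f \<and> tgt C (cmp C g f) = tgt C g) \<and>
     (\<forall>f\<in>Ar C. cmp C f (idn C (src C f)) = f \<and> cmp C (idn C (tgt C f)) f = f) \<and>
     (\<forall>f\<in>Ar C. \<forall>g\<in>Ar C. \<forall>h\<in>Ar C. src C g = tgt C f \<longrightarrow> src C h = tgt C g \<longrightarrow>
        cmp C h (cmp C g f) = cmp C (cmp C h g) f)"

type_synonym ('o, 'm, 'p, 'q) func = "('o \<Rightarrow> 'p) \<times> ('m \<Rightarrow> 'q)"

definition is_functor :: "('o, 'm) cat \<Rightarrow> ('p, 'q) cat \<Rightarrow> ('o, 'm, 'p, 'q) func \<Rightarrow> bool" where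
  "is_functor C D F \<longleftrightarrow>
     fst F \<in> Ob C \<rightarrow>\<^sub>E Ob D \<and> snd F \<in> Ar C \<rightarrow>\<^sub>E Ar D \<and>
     (\<forall>f\<in>Ar C. src D (snd F f) = fst F (src C f) \<and> tgt D (snd F f) = fst F (tgt C f)) \<and>
     (\<forall>a\<in>Ob C. snd F (idn C a) = idn D (fst F a)) \<and>
     (\<forall>f\<in>Ar C. \<forall>g\<in>Ar C. src C g = tgt C f \<longrightarrow>
        snd F (cmp C g f) = cmp D (snd F g) (snd F f))"

definition functor_id :: "('o, 'm) cat \<Rightarrow> ('o, 'm, 'o, 'm) func" where
  "functor_id C = (restrict id (Ob C), restrict id (Ar C))"

text \<open>\<open>functor_comp C G F\<close> is \<open>G\<close> after \<open>F\<close>, where \<open>C\<close> is the domain of \<open>F\<close>.\<close>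

definition functor_comp ::
  "('o, 'm) cat \<Rightarrow> ('p, 'q, 'r, 's) func \<Rightarrow> ('o, 'm, 'p, 'q) func \<Rightarrow> ('o, 'm, 'r, 's) func" where
  "functor_comp C G F = (restrict (fst G \<circ> fst F) (Ob C), restrict (snd G \<circ> snd F) (Ar C))"

definition poset_cat :: "'p::order set \<Rightarrow> ('p, 'p \<times> 'p) cat" where
  "poset_cat P =
     \<lparr> Ob = P, Ar = {(x, y). x \<in> P \<and> y \<in> P \<and> x \<le> y}, src = fst, tgt = snd,
       idn = (\<lambda>x. (x, x)), cmp = (\<lambda>g f. (fst f, snd g)) \<rparr>"

definition poset_functor ::
  "'p::order set \<Rightarrow> ('p \<Rightarrow> 'q::order) \<Rightarrow> ('p, 'p \<times> 'p, 'q, 'q \<times> 'q) func" where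
  "poset_functor P f = (restrict f P, restrict (map_prod f f) (Ar (poset_cat P)))"


section \<open>The cube category\<close>

type_synonym pt = "nat \<Rightarrow> nat"
type_synonym rpt = "nat \<Rightarrow> real"

text \<open>\<open>grid k n\<close> is $[k]^n$, with coordinates numbered from 0.  On extensional functions the library
  order and lattice operations of the function type are the coordinatewise ones.\<close>

definition grid :: "nat \<Rightarrow> nat \<Rightarrow> pt set" where
  "grid k n = {..<n} \<rightarrow>\<^sub>E {..k}"

definition coface :: "nat \<Rightarrow> nat \<Rightarrow> nat \<Rightarrow> pt \<Rightarrow> pt" where
  "coface n i e = (\<lambda>x\<in>grid 1 n. \<lambda>j\<in>{..<Suc n}. if j < i then x j else if j = i then e else x (j - 1))"

definition codegeneracy :: "nat \<Rightarrow> nat \<Rightarrow> pt \<Rightarrow> pt" where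
  "codegeneracy n i = (\<lambda>x\<in>grid 1 (Suc n). \<lambda>j\<in>{..<n}. if j < i then x j else x (Suc j))"

definition coord_perm :: "nat \<Rightarrow> (nat \<Rightarrow> nat) \<Rightarrow> pt \<Rightarrow> pt" where
  "coord_perm n \<pi> = (\<lambda>x\<in>grid 1 n. \<lambda>j\<in>{..<n}. x (\<pi> j))"

text \<open>\<open>box m n f\<close>: \<open>f\<close> is a morphism $[1]^m \to [1]^n$ of the cube category.\<close>

inductive box :: "nat \<Rightarrow> nat \<Rightarrow> (pt \<Rightarrow> pt) \<Rightarrow> bool" where
  box_id: "box n n (restrict id (grid 1 n))"
| box_coface: "i \<le> n \<Longrightarrow> e \<le> 1 \<Longrightarrow> box n (Suc n) (coface n i e)"
| box_codegeneracy: "i \<le> n \<Longrightarrow> box (Suc n) n (codegeneracy n i)"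
| box_perm: "\<pi> permutes {..<n} \<Longrightarrow> box n n (coord_perm n \<pi>)"
| box_comp: "box l m f \<Longrightarrow> box m n g \<Longrightarrow> box l n (restrict (g \<circ> f) (grid 1 l))"


section \<open>Cubical sets\<close>

text \<open>\<open>act C m n f\<close> is the action $C_n \to C_m$ of a morphism $f : [1]^m \to [1]^n$.\<close>

record 'a cset =
  cells :: "nat \<Rightarrow> 'a set"
  act :: "nat \<Rightarrow> nat \<Rightarrow> (pt \<Rightarrow> pt) \<Rightarrow> 'a \<Rightarrow> 'a"

definition cubical_set :: "'a cset \<Rightarrow> bool" where
  "cubical_set C \<longleftrightarrow>
     (\<forall>m n f. box m n f \<longrightarrow> act C m n f \<in> cells C n \<rightarrow> cells C m) \<and>
     (\<forall>n. \<forall>x\<in>cells C n. act C n n (restrict id (grid 1 n)) x = x) \<and>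
     (\<forall>l m n f g. box l m f \<longrightarrow> box m n g \<longrightarrow>
        (\<forall>x\<in>cells C n. act C l n (restrict (g \<circ> f) (grid 1 l)) x = act C l m f (act C m n g x)))"

definition cubical_fun :: "'a cset \<Rightarrow> 'b cset \<Rightarrow> (nat \<Rightarrow> 'a \<Rightarrow> 'b) \<Rightarrow> bool" where
  "cubical_fun C D \<alpha> \<longleftrightarrow>
     (\<forall>n. \<alpha> n \<in> cells C n \<rightarrow>\<^sub>E cells D n) \<and>
     (\<forall>m n f. box m n f \<longrightarrow> (\<forall>x\<in>cells C n. \<alpha> m (act C m n f x) = act D m n f (\<alpha> n x)))"

definition nerve :: "('o, 'm) cat \<Rightarrow> (pt, pt \<times> pt, 'o, 'm) func cset" where
  "nerve X =
     \<lparr> cells = (\<lambda>n. {F. is_functor (poset_cat (grid 1 n)) X F}),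
       act = (\<lambda>m n f F. functor_comp (poset_cat (grid 1 m)) F (poset_functor (grid 1 m) f)) \<rparr>"

definition nerve_map ::
  "('o, 'm) cat \<Rightarrow> ('o, 'm, 'p, 'q) func \<Rightarrow>
   nat \<Rightarrow> (pt, pt \<times> pt, 'o, 'm) func \<Rightarrow> (pt, pt \<times> pt, 'p, 'q) func" where
  "nerve_map X K n = (\<lambda>F\<in>cells (nerve X) n. functor_comp (poset_cat (grid 1 n)) K F)"

text \<open>For a functor \<open>F\<close> from the cube category to sets, with values \<open>F n\<close> and action
  \<open>A m n f : F m \<rightarrow> F n\<close> of a morphism $f : [1]^m \to [1]^n$, \<open>coend C F A\<close> is the coend $\int^n C_n \times F(n)$.  It is the value at \<open>C\<close> of the
  cocontinuous extension of \<open>F\<close> along the Yoneda embedding.  Functions on a coend are given on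
  representatives by \<open>coend_lift\<close>.\<close>

definition coend_pairs :: "'a cset \<Rightarrow> (nat \<Rightarrow> 'x set) \<Rightarrow> (nat \<times> 'a \<times> 'x) set" where
  "coend_pairs C F = {(n, c, x). c \<in> cells C n \<and> x \<in> F n}"

definition coend_step ::
  "'a cset \<Rightarrow> (nat \<Rightarrow> 'x set) \<Rightarrow> (nat \<Rightarrow> nat \<Rightarrow> (pt \<Rightarrow> pt) \<Rightarrow> 'x \<Rightarrow> 'x) \<Rightarrow>
   (nat \<times> 'a \<times> 'x) rel" where
  "coend_step C F A =
     {((m, act C m n f c, x), (n, c, A m n f x)) | m n f c x.
        box m n f \<and> c \<in> cells C n \<and> x \<in> F m}"

definition coend_rel ::
  "'a cset \<Rightarrow> (nat \<Rightarrow> 'x set) \<Rightarrow> (nat \<Rightarrow> nat \<Rightarrow> (pt \<Rightarrow> pt) \<Rightarrow> 'x \<Rightarrow> 'x) \<Rightarrow>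
   (nat \<times> 'a \<times> 'x) rel" where
  "coend_rel C F A =
     (coend_step C F A \<union> (coend_step C F A)\<inverse>)\<^sup>* \<inter> coend_pairs C F \<times> coend_pairs C F"

definition coend ::
  "'a cset \<Rightarrow> (nat \<Rightarrow> 'x set) \<Rightarrow> (nat \<Rightarrow> nat \<Rightarrow> (pt \<Rightarrow> pt) \<Rightarrow> 'x \<Rightarrow> 'x) \<Rightarrow>
   (nat \<times> 'a \<times> 'x) set set" where
  "coend C F A = coend_pairs C F // coend_rel C F A"

definition coend_class ::
  "'a cset \<Rightarrow> (nat \<Rightarrow> 'x set) \<Rightarrow> (nat \<Rightarrow> nat \<Rightarrow> (pt \<Rightarrow> pt) \<Rightarrow> 'x \<Rightarrow> 'x) \<Rightarrow>
   nat \<times> 'a \<times> 'x \<Rightarrow> (nat \<times> 'a \<times> 'x) set" where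
  "coend_class C F A z = coend_rel C F A `` {z}"

definition coend_lift :: "(nat \<Rightarrow> 'a \<Rightarrow> 'x \<Rightarrow> 'y) \<Rightarrow> (nat \<times> 'a \<times> 'x) set \<Rightarrow> 'y" where
  "coend_lift g p = the_elem ((\<lambda>(n, c, x). g n c x) ` p)"


section \<open>Streams\<close>

text \<open>The smallest preorder on $\bigcup\mathcal O$ containing the given (reflexive) preorders is the
  transitive closure of their union.  Values on non-open sets carry no information and are fixed to
  be empty, so that circulations are compared by equality.\<close>

definition circulation :: "'p topology \<Rightarrow> ('p set \<Rightarrow> 'p rel) \<Rightarrow> bool" where
  "circulation T c \<longleftrightarrow>
     (\<forall>U. openin T U \<longrightarrow> preorder_on U (c U)) \<and>
     (\<forall>\<O>. (\<forall>U\<in>\<O>. openin T U) \<longrightarrow> c (\<Union>\<O>) = (\<Union>U\<in>\<O>. c U)\<^sup>+) \<and>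
     (\<forall>U. \<not> openin T U \<longrightarrow> c U = {})"

record 'p stream =
  top_of :: "'p topology"
  circ :: "'p set \<Rightarrow> 'p rel"

abbreviation points :: "'p stream \<Rightarrow> 'p set" where
  "points X \<equiv> topspace (top_of X)"

definition stream_maps :: "'p stream \<Rightarrow> 'q stream \<Rightarrow> ('p \<Rightarrow> 'q) set" where
  "stream_maps X Y =
     {f \<in> extensional (points X).
        continuous_map (top_of X) (top_of Y) f \<and>
        (\<forall>U. openin (top_of Y) U \<longrightarrow>
           (\<forall>(x, y) \<in> circ X {z \<in> points X. f z \<in> U}. (f x, f y) \<in> circ Y U))}"

definition cube_top :: "nat \<Rightarrow> rpt topology" where
  "cube_top n = product_topology (\<lambda>_. top_of_set {0..1}) {..<n}"

definition cube_stream :: "nat \<Rightarrow> rpt stream" where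
  "cube_stream n =
     \<lparr> top_of = cube_top n,
       circ = (THE c. circulation (cube_top n) c \<and>
                c (topspace (cube_top n)) =
                  {(x, y). x \<in> topspace (cube_top n) \<and> y \<in> topspace (cube_top n) \<and>
                           (\<forall>i<n. x i \<le> y i)}) \<rparr>"


section \<open>Directed realization and its right adjoint\<close>

text \<open>\<open>lin m n f\<close> is the affine map on $[0,1]^m$ which agrees with \<open>f\<close>, a function on $[1]^m$, at the
  origin and at the unit vectors.  On morphisms of the cube category it is the usual action on
  topological cubes, as the lemmas on generators below show.\<close>

definition origin :: "nat \<Rightarrow> pt" where
  "origin m = (\<lambda>i\<in>{..<m}. 0)"

definition unit_vec :: "nat \<Rightarrow> nat \<Rightarrow> pt" where
  "unit_vec m i = (\<lambda>j\<in>{..<m}. if j = i then 1 else 0)"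

definition lin :: "nat \<Rightarrow> nat \<Rightarrow> (pt \<Rightarrow> pt) \<Rightarrow> rpt \<Rightarrow> rpt" where
  "lin m n f = (\<lambda>t\<in>topspace (cube_top m). \<lambda>j\<in>{..<n}.
     real (f (origin m) j) +
     (\<Sum>i<m. t i * (real (f (unit_vec m i) j) - real (f (origin m) j))))"

lemma origin_in_grid: "origin m \<in> grid k m"
  by (auto simp: origin_def grid_def)

lemma unit_vec_in_grid: "unit_vec m i \<in> grid 1 m"
  by (auto simp: unit_vec_def grid_def)

lemma sum_unit_vec: "l < m \<Longrightarrow> (\<Sum>k<m. t k * real (unit_vec m k l)) = t l"
proof -
  assume "l < m"
  then have "(\<Sum>k<m. t k * real (unit_vec m k l)) = (\<Sum>k<m. if k = l then t k else 0)"
    by (intro sum.cong) (auto simp: unit_vec_def)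
  also have "\<dots> = t l"
    using \<open>l < m\<close> by (subst sum.delta) auto
  finally show ?thesis .
qed

lemmas lin_generator_simps =
  origin_in_grid [where k = 1, unfolded One_nat_def] unit_vec_in_grid [unfolded One_nat_def]
  sum_unit_vec lin_def origin_def [THEN fun_cong]

lemma lin_coface:
  assumes "t \<in> topspace (cube_top n)" "i \<le> n"
  shows "lin n (Suc n) (coface n i e) t =
           (\<lambda>j\<in>{..<Suc n}. if j < i then t j else if j = i then real e else t (j - 1))"
proof
  fix j
  consider "j \<ge> Suc n" | "j < i" | "j = i" | "i < j" "j < Suc n" by linarith
  then show "lin n (Suc n) (coface n i e) t j =
           (\<lambda>j\<in>{..<Suc n}. if j < i then t j else if j = i then real e else t (j - 1)) j"
    by cases (use assms in \<open>auto simp: coface_def lin_generator_simps\<close>)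
qed

lemma lin_codegeneracy:
  assumes "t \<in> topspace (cube_top (Suc n))" "i \<le> n"
  shows "lin (Suc n) n (codegeneracy n i) t = (\<lambda>j\<in>{..<n}. if j < i then t j else t (Suc j))"
proof
  fix j
  consider "j \<ge> n" | "j < i" "j < n" | "i \<le> j" "j < n" by linarith
  then show "lin (Suc n) n (codegeneracy n i) t j = (\<lambda>j\<in>{..<n}. if j < i then t j else t (Suc j)) j"
    by cases
      (use assms in \<open>auto simp: codegeneracy_def lin_generator_simps simp del: sum.lessThan_Suc\<close>)
qed

lemma lin_coord_perm:
  assumes "t \<in> topspace (cube_top n)" "\<pi> permutes {..<n}"
  shows "lin n n (coord_perm n \<pi>) t = (\<lambda>j\<in>{..<n}. t (\<pi> j))"
proof
  fix j
  have "\<pi> j < n" if "j < n"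
    using permutes_in_image[OF assms(2), of j] that by simp
  then show "lin n n (coord_perm n \<pi>) t j = (\<lambda>j\<in>{..<n}. t (\<pi> j)) j"
    using assms(1) by (auto simp: coord_perm_def lin_generator_simps)
qed

text \<open>\<open>realization C\<close> is the colimit, taken in all streams, of one directed cube for each cube of \<open>C\<close>:
  the point set is a coend, and topology and circulation are the final ones.  This is the colimit
  in weak Hausdorff k-streams, because it is a colimit of compact Hausdorff streams whose underlying
  space is already Hausdorff.  The realization of a representable is identified with
  \<open>cube_stream n\<close>.\<close>

definition realization_point :: "'a cset \<Rightarrow> nat \<Rightarrow> 'a \<Rightarrow> rpt \<Rightarrow> (nat \<times> 'a \<times> rpt) set" where
  "realization_point C n c t = coend_class C (\<lambda>n. points (cube_stream n)) lin (n, c, t)"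

definition realization_open :: "'a cset \<Rightarrow> (nat \<times> 'a \<times> rpt) set set \<Rightarrow> bool" where
  "realization_open C U \<longleftrightarrow>
     U \<subseteq> coend C (\<lambda>n. points (cube_stream n)) lin \<and>
     (\<forall>n. \<forall>c\<in>cells C n.
        openin (top_of (cube_stream n)) {t \<in> points (cube_stream n). realization_point C n c t \<in> U})"

lemma istopology_realization_open: "istopology (realization_open C)"
  unfolding istopology_def
proof (intro conjI allI impI)
  fix S T assume ST: "realization_open C S" "realization_open C T"
  have "{t \<in> points (cube_stream n). realization_point C n c t \<in> S \<inter> T} =
        {t \<in> points (cube_stream n). realization_point C n c t \<in> S} \<inter>
        {t \<in> points (cube_stream n). realization_point C n c t \<in> T}" for n c
    by auto
  moreover have "openin (top_of (cube_stream n))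
      ({t \<in> points (cube_stream n). realization_point C n c t \<in> S} \<inter>
       {t \<in> points (cube_stream n). realization_point C n c t \<in> T})"
    if "c \<in> cells C n" for n c
    using ST that by (intro openin_Int) (simp_all add: realization_open_def)
  ultimately show "realization_open C (S \<inter> T)"
    using ST by (auto simp only: realization_open_def)
next
  fix \<K> assume K: "\<forall>K\<in>\<K>. realization_open C K"
  have "{t \<in> points (cube_stream n). realization_point C n c t \<in> \<Union>\<K>} =
        (\<Union>K\<in>\<K>. {t \<in> points (cube_stream n). realization_point C n c t \<in> K})" for n c
    by auto
  moreover have "openin (top_of (cube_stream n))
      (\<Union>K\<in>\<K>. {t \<in> points (cube_stream n). realization_point C n c t \<in> K})"
    if "c \<in> cells C n" for n c
    using K that by (intro openin_Union) (auto simp: realization_open_def)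
  ultimately show "realization_open C (\<Union>\<K>)"
    using K by (simp add: realization_open_def Sup_le_iff)
qed

definition realization :: "'a cset \<Rightarrow> (nat \<times> 'a \<times> rpt) set stream" where
  "realization C =
     \<lparr> top_of = topology (realization_open C),
       circ = (\<lambda>U. if realization_open C U
          then {(realization_point C n c s, realization_point C n c t) | n c s t.
                  c \<in> cells C n \<and>
                  (s, t) \<in> circ (cube_stream n)
                     {r \<in> points (cube_stream n). realization_point C n c r \<in> U}}\<^sup>+
          else {}) \<rparr>"

definition sing :: "'p stream \<Rightarrow> (rpt \<Rightarrow> 'p) cset" where
  "sing X =
     \<lparr> cells = (\<lambda>n. stream_maps (cube_stream n) X),
       act = (\<lambda>m n f \<theta>. restrict (\<theta> \<circ> lin m n f) (points (cube_stream m))) \<rparr>"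

text \<open>The cubical function \<open>C \<rightarrow> sing X\<close> adjoint to a stream map \<open>g\<close> from \<open>realization C\<close> to \<open>X\<close>.\<close>

definition adjunct :: "'a cset \<Rightarrow> ((nat \<times> 'a \<times> rpt) set \<Rightarrow> 'p) \<Rightarrow> nat \<Rightarrow> 'a \<Rightarrow> rpt \<Rightarrow> 'p" where
  "adjunct C g n = (\<lambda>c\<in>cells C n. \<lambda>t\<in>points (cube_stream n). g (realization_point C n c t))"


section \<open>Subdivision\<close>

definition boolean_interval :: "'l::lattice set \<Rightarrow> 'l set \<Rightarrow> bool" where
  "boolean_interval L I \<longleftrightarrow>
     I \<subseteq> L \<and>
     (\<forall>x\<in>I. \<forall>z\<in>I. \<forall>y\<in>L. x \<le> y \<longrightarrow> y \<le> z \<longrightarrow> y \<in> I) \<and>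
     (\<exists>a\<in>I. \<forall>x\<in>I. a \<le> x) \<and> (\<exists>b\<in>I. \<forall>x\<in>I. x \<le> b) \<and>
     (\<exists>m g. bij_betw g (grid 1 m) I \<and>
        (\<forall>x\<in>grid 1 m. \<forall>y\<in>grid 1 m. x \<le> y \<longleftrightarrow> g x \<le> g y))"

text \<open>\<open>lattice_cset L\<close> is $\square[L]$, for a sublattice \<open>L\<close> of a lattice type.\<close>

definition lattice_cset :: "'l::lattice set \<Rightarrow> (pt \<Rightarrow> 'l) cset" where
  "lattice_cset L =
     \<lparr> cells = (\<lambda>m. {\<sigma> \<in> grid 1 m \<rightarrow>\<^sub>E L.
          (\<forall>x\<in>grid 1 m. \<forall>y\<in>grid 1 m.
             \<sigma> (inf x y) = inf (\<sigma> x) (\<sigma> y) \<and> \<sigma> (sup x y) = sup (\<sigma> x) (\<sigma> y)) \<and>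
          (\<forall>I. boolean_interval (grid 1 m) I \<longrightarrow> boolean_interval L (\<sigma> ` I))}),
       act = (\<lambda>m n f \<sigma>. restrict (\<sigma> \<circ> f) (grid 1 m)) \<rparr>"

definition sd2_cube :: "nat \<Rightarrow> (pt \<Rightarrow> pt) cset" where
  "sd2_cube n = lattice_cset (grid 2 n)"

text \<open>The identification of $[2]^n$ with the monotone functions $\zeta : [1] \to [1]^n$: \<open>chain_pt\<close> is
  $\zeta \mapsto \zeta(0) + \zeta(1)$ and \<open>pt_chain\<close> its inverse.\<close>

definition chain_pt :: "nat \<Rightarrow> (nat \<Rightarrow> pt) \<Rightarrow> pt" where
  "chain_pt n \<zeta> = (\<lambda>j\<in>{..<n}. \<zeta> 0 j + \<zeta> 1 j)"

definition pt_chain :: "nat \<Rightarrow> pt \<Rightarrow> nat \<Rightarrow> pt" where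
  "pt_chain n v = (\<lambda>e\<in>{..1}. \<lambda>j\<in>{..<n}. if v j + e \<ge> 2 then 1 else 0)"

lemma grid_iff: "x \<in> grid k n \<longleftrightarrow> (\<forall>j. if j < n then x j \<le> k else x j = undefined)"
  by (auto simp: grid_def PiE_iff extensional_def)

lemma bij_betw_pt_chain:
  "bij_betw (pt_chain n) (grid 2 n) {\<zeta> \<in> {..1} \<rightarrow>\<^sub>E grid 1 n. \<zeta> 0 \<le> \<zeta> 1}" (is "bij_betw _ _ ?M")
proof (rule bij_betwI[where g = "chain_pt n"])
  have M: "\<zeta> \<in> ?M \<longleftrightarrow> \<zeta> 0 \<in> grid 1 n \<and> \<zeta> 1 \<in> grid 1 n \<and> (\<forall>j. \<zeta> 0 j \<le> \<zeta> 1 j) \<and>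
      (\<forall>e>1. \<zeta> e = undefined)" for \<zeta> :: "nat \<Rightarrow> pt"
  proof -
    have "(\<forall>e\<in>{..1}. P e) \<longleftrightarrow> P 0 \<and> P 1" for P :: "nat \<Rightarrow> bool"
      by (metis One_nat_def atMost_iff le_0_eq le_Suc_eq zero_le_one)
    moreover have "\<zeta> \<in> extensional {..1} \<longleftrightarrow> (\<forall>e>1. \<zeta> e = undefined)"
      by (simp only: extensional_def mem_Collect_eq atMost_iff not_le)
    ultimately show ?thesis
      by (simp only: mem_Collect_eq PiE_iff le_fun_def conj_ac)
  qed
  show "pt_chain n \<in> grid 2 n \<rightarrow> ?M"
  proof
    fix v
    show "pt_chain n v \<in> ?M"
      unfolding M grid_iff by (simp add: pt_chain_def)
  qed
  show "chain_pt n \<in> ?M \<rightarrow> grid 2 n"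
  proof
    fix \<zeta> assume "\<zeta> \<in> ?M"
    then have "\<zeta> 0 j \<le> 1 \<and> \<zeta> 1 j \<le> 1" if "j < n" for j
      using that unfolding M grid_iff by metis
    then show "chain_pt n \<zeta> \<in> grid 2 n"
      unfolding grid_iff by (fastforce simp: chain_pt_def)
  qed
  show "chain_pt n (pt_chain n v) = v" if "v \<in> grid 2 n" for v
  proof
    fix j
    from that have "if j < n then v j \<le> 2 else v j = undefined"
      unfolding grid_iff by blast
    then show "chain_pt n (pt_chain n v) j = v j"
      by (auto simp: chain_pt_def pt_chain_def split: if_splits)
  qed
  show "pt_chain n (chain_pt n \<zeta>) = \<zeta>" if "\<zeta> \<in> ?M" for \<zeta>
  proof (intro ext)
    fix e j
    from that have z: "if j < n then \<zeta> 0 j \<le> 1 else \<zeta> 0 j = undefined"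
      "if j < n then \<zeta> 1 j \<le> 1 else \<zeta> 1 j = undefined" "\<zeta> 0 j \<le> \<zeta> 1 j" "e > 1 \<longrightarrow> \<zeta> e = undefined"
      unfolding M grid_iff by blast+
    consider "e = 0" | "e = 1" | "e > 1" by linarith
    then show "pt_chain n (chain_pt n \<zeta>) e j = \<zeta> e j"
      by cases (use z in \<open>auto simp: chain_pt_def pt_chain_def split: if_splits\<close>)
  qed
qed

text \<open>The effect of \<open>f\<close> on $[2]^m$ by postcomposition, and on the subdivided representables.\<close>

definition sd2_pt :: "nat \<Rightarrow> nat \<Rightarrow> (pt \<Rightarrow> pt) \<Rightarrow> pt \<Rightarrow> pt" where
  "sd2_pt m n f v = chain_pt n (f \<circ> pt_chain m v)"

definition sd2_cube_map :: "nat \<Rightarrow> nat \<Rightarrow> (pt \<Rightarrow> pt) \<Rightarrow> nat \<Rightarrow> (pt \<Rightarrow> pt) \<Rightarrow> (pt \<Rightarrow> pt)" where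
  "sd2_cube_map m n f k = (\<lambda>\<sigma>\<in>cells (sd2_cube m) k. restrict (sd2_pt m n f \<circ> \<sigma>) (grid 1 k))"

definition ex2 :: "'a cset \<Rightarrow> (nat \<Rightarrow> (pt \<Rightarrow> pt) \<Rightarrow> 'a) cset" where
  "ex2 C =
     \<lparr> cells = (\<lambda>n. {\<psi>. cubical_fun (sd2_cube n) C \<psi>}),
       act = (\<lambda>m n f \<psi> k. restrict (\<psi> k \<circ> sd2_cube_map m n f k) (cells (sd2_cube m) k)) \<rparr>"

definition ex2_map ::
  "'a cset \<Rightarrow> (nat \<Rightarrow> 'a \<Rightarrow> 'b) \<Rightarrow>
   nat \<Rightarrow> (nat \<Rightarrow> (pt \<Rightarrow> pt) \<Rightarrow> 'a) \<Rightarrow> (nat \<Rightarrow> (pt \<Rightarrow> pt) \<Rightarrow> 'b)" where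
  "ex2_map C \<alpha> n =
     (\<lambda>\<psi>\<in>cells (ex2 C) n. \<lambda>k. restrict (\<alpha> k \<circ> \<psi> k) (cells (sd2_cube n) k))"

text \<open>The homeomorphism $\varphi_{\square[1]^n;2}$: on the cell of a cube $\sigma : [1]^k \to [2]^n$ it is affine
  with value $\sigma(v)/2$ at each vertex $v$.\<close>

definition phi2 :: "nat \<Rightarrow> (nat \<times> (pt \<Rightarrow> pt) \<times> rpt) set \<Rightarrow> rpt" where
  "phi2 n = (\<lambda>p\<in>points (realization (sd2_cube n)).
     coend_lift (\<lambda>k \<sigma> t. \<lambda>j\<in>{..<n}. lin k n \<sigma> t j / 2) p)"


section \<open>Cubcats\<close>

text \<open>As the realization of a representable is a directed cube, \<open>sing (cube_stream n)\<close> is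
  $\mathbf{S}\square[1]^n$, and \<open>S_rep_map m n f\<close> is $\mathbf{S}\square[f]$ in dimension \<open>k\<close>.\<close>

definition S_rep_map :: "nat \<Rightarrow> nat \<Rightarrow> nat \<Rightarrow> (pt \<Rightarrow> pt) \<Rightarrow> (rpt \<Rightarrow> rpt) \<Rightarrow> (rpt \<Rightarrow> rpt)" where
  "S_rep_map k m n f \<theta> = restrict (lin m n f \<circ> \<theta>) (points (cube_stream k))"

definition sharp_class ::
  "'a cset \<Rightarrow> nat \<Rightarrow> nat \<Rightarrow> 'a \<Rightarrow> (rpt \<Rightarrow> rpt) \<Rightarrow> (nat \<times> 'a \<times> (rpt \<Rightarrow> rpt)) set" where
  "sharp_class C k n c \<theta> =
     coend_class C (\<lambda>n. cells (sing (cube_stream n)) k) (S_rep_map k) (n, c, \<theta>)"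

definition sharp :: "'a cset \<Rightarrow> (nat \<times> 'a \<times> (rpt \<Rightarrow> rpt)) set cset" where
  "sharp C =
     \<lparr> cells = (\<lambda>k. coend C (\<lambda>n. cells (sing (cube_stream n)) k) (S_rep_map k)),
       act = (\<lambda>k l f. coend_lift (\<lambda>n c \<theta>.
                sharp_class C k n c (act (sing (cube_stream n)) k l f \<theta>))) \<rparr>"

definition sharp_map ::
  "'a cset \<Rightarrow> 'b cset \<Rightarrow> (nat \<Rightarrow> 'a \<Rightarrow> 'b) \<Rightarrow>
   nat \<Rightarrow> (nat \<times> 'a \<times> (rpt \<Rightarrow> rpt)) set \<Rightarrow> (nat \<times> 'b \<times> (rpt \<Rightarrow> rpt)) set" where
  "sharp_map C D \<alpha> k =
     (\<lambda>p\<in>cells (sharp C) k. coend_lift (\<lambda>n c \<theta>. sharp_class D k n (\<alpha> n c) \<theta>) p)"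

text \<open>The unit of $\mathbf{S}$ at $\square[1]^n$ sends a \<open>k\<close>-cube $f$ to its realization.  The map $\eta_C$
  it induces sends $c \in C_n$ to the class of $c$ and of the unit at the identity of $[1]^n$.\<close>

definition S_unit_rep :: "nat \<Rightarrow> nat \<Rightarrow> (pt \<Rightarrow> pt) \<Rightarrow> (rpt \<Rightarrow> rpt)" where
  "S_unit_rep n k f = lin k n f"

definition sharp_unit :: "'a cset \<Rightarrow> nat \<Rightarrow> 'a \<Rightarrow> (nat \<times> 'a \<times> (rpt \<Rightarrow> rpt)) set" where
  "sharp_unit C n =
     (\<lambda>c\<in>cells C n. sharp_class C n n c (S_unit_rep n n (restrict id (grid 1 n))))"

text \<open>\<open>phi_sharp_rep m \<theta>\<close> is the \<open>m\<close>-cube of $\mathrm{ex}_2\mathbf{S}\square[1]^n$ adjoint to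
  $\theta\varphi_{\square[1]^m;2}$.  For general \<open>C\<close>, a class of $c \in C_n$ and $\theta$ is the image of $\theta$
  under the map $\mathbf{S}\square[1]^n \to C^\sharp$ determined by $c$, which sends a \<open>k\<close>-cube $\theta'$ to
  \<open>sharp_class C k n c \<theta>'\<close>; naturality then determines its image in $\mathrm{ex}_2 C^\sharp$.\<close>

definition phi_sharp_rep :: "nat \<Rightarrow> (rpt \<Rightarrow> rpt) \<Rightarrow> nat \<Rightarrow> (pt \<Rightarrow> pt) \<Rightarrow> (rpt \<Rightarrow> rpt)" where
  "phi_sharp_rep m \<theta> = adjunct (sd2_cube m) (\<theta> \<circ> phi2 m)"

definition phi_sharp ::
  "'a cset \<Rightarrow> nat \<Rightarrow> (nat \<times> 'a \<times> (rpt \<Rightarrow> rpt)) set \<Rightarrow>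
   nat \<Rightarrow> (pt \<Rightarrow> pt) \<Rightarrow> (nat \<times> 'a \<times> (rpt \<Rightarrow> rpt)) set" where
  "phi_sharp C m =
     (\<lambda>p\<in>cells (sharp C) m. coend_lift (\<lambda>n c \<theta>.
        ex2_map (sing (cube_stream n)) (\<lambda>k. sharp_class C k n c) m (phi_sharp_rep m \<theta>)) p)"


section \<open>Diagrams over a category\<close>

record ('g, 'h, 'x, 'y) diagram =
  at_ob :: "'g \<Rightarrow> 'x"
  at_ar :: "'h \<Rightarrow> 'y"

definition gamma_category ::
  "('g, 'h) cat \<Rightarrow> ('g, 'h, ('o, 'm) cat, ('o, 'm, 'o, 'm) func) diagram \<Rightarrow> bool" where
  "gamma_category \<Gamma> X \<longleftrightarrow>
     (\<forall>a\<in>Ob \<Gamma>. category (at_ob X a)) \<and>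
     (\<forall>h\<in>Ar \<Gamma>. is_functor (at_ob X (src \<Gamma> h)) (at_ob X (tgt \<Gamma> h)) (at_ar X h)) \<and>
     (\<forall>a\<in>Ob \<Gamma>. at_ar X (idn \<Gamma> a) = functor_id (at_ob X a)) \<and>
     (\<forall>h\<in>Ar \<Gamma>. \<forall>k\<in>Ar \<Gamma>. src \<Gamma> k = tgt \<Gamma> h \<longrightarrow>
        at_ar X (cmp \<Gamma> k h) = functor_comp (at_ob X (src \<Gamma> h)) (at_ar X k) (at_ar X h))"

type_synonym ('g, 'h, 'a) cset_diagram = "('g, 'h, 'a cset, nat \<Rightarrow> 'a \<Rightarrow> 'a) diagram"

definition gamma_cubical_set :: "('g, 'h) cat \<Rightarrow> ('g, 'h, 'a) cset_diagram \<Rightarrow> bool" where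
  "gamma_cubical_set \<Gamma> C \<longleftrightarrow>
     (\<forall>a\<in>Ob \<Gamma>. cubical_set (at_ob C a)) \<and>
     (\<forall>h\<in>Ar \<Gamma>. cubical_fun (at_ob C (src \<Gamma> h)) (at_ob C (tgt \<Gamma> h)) (at_ar C h)) \<and>
     (\<forall>a\<in>Ob \<Gamma>. \<forall>n. \<forall>x\<in>cells (at_ob C a) n. at_ar C (idn \<Gamma> a) n x = x) \<and>
     (\<forall>h\<in>Ar \<Gamma>. \<forall>k\<in>Ar \<Gamma>. src \<Gamma> k = tgt \<Gamma> h \<longrightarrow>
        (\<forall>n. \<forall>x\<in>cells (at_ob C (src \<Gamma> h)) n.
           at_ar C (cmp \<Gamma> k h) n x = at_ar C k n (at_ar C h n x)))"

definition gamma_cubical_fun ::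
  "('g, 'h) cat \<Rightarrow> ('g, 'h, 'a) cset_diagram \<Rightarrow> ('g, 'h, 'b) cset_diagram \<Rightarrow>
   ('g \<Rightarrow> nat \<Rightarrow> 'a \<Rightarrow> 'b) \<Rightarrow> bool" where
  "gamma_cubical_fun \<Gamma> C D \<alpha> \<longleftrightarrow>
     (\<forall>a\<in>Ob \<Gamma>. cubical_fun (at_ob C a) (at_ob D a) (\<alpha> a)) \<and>
     (\<forall>h\<in>Ar \<Gamma>. \<forall>n. \<forall>x\<in>cells (at_ob C (src \<Gamma> h)) n.
        \<alpha> (tgt \<Gamma> h) n (at_ar C h n x) = at_ar D h n (\<alpha> (src \<Gamma> h) n x))"

definition gamma_nerve ::
  "('g, 'h) cat \<Rightarrow> ('g, 'h, ('o, 'm) cat, ('o, 'm, 'o, 'm) func) diagram \<Rightarrow>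
   ('g, 'h, (pt, pt \<times> pt, 'o, 'm) func) cset_diagram" where
  "gamma_nerve \<Gamma> X =
     \<lparr> at_ob = (\<lambda>a. nerve (at_ob X a)),
       at_ar = (\<lambda>h. nerve_map (at_ob X (src \<Gamma> h)) (at_ar X h)) \<rparr>"

definition gamma_sharp ::
  "('g, 'h) cat \<Rightarrow> ('g, 'h, 'a) cset_diagram \<Rightarrow>
   ('g, 'h, (nat \<times> 'a \<times> (rpt \<Rightarrow> rpt)) set) cset_diagram" where
  "gamma_sharp \<Gamma> C =
     \<lparr> at_ob = (\<lambda>a. sharp (at_ob C a)),
       at_ar = (\<lambda>h. sharp_map (at_ob C (src \<Gamma> h)) (at_ob C (tgt \<Gamma> h)) (at_ar C h)) \<rparr>"

definition gamma_ex2 ::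
  "('g, 'h) cat \<Rightarrow> ('g, 'h, 'a) cset_diagram \<Rightarrow>
   ('g, 'h, nat \<Rightarrow> (pt \<Rightarrow> pt) \<Rightarrow> 'a) cset_diagram" where
  "gamma_ex2 \<Gamma> C =
     \<lparr> at_ob = (\<lambda>a. ex2 (at_ob C a)),
       at_ar = (\<lambda>h. ex2_map (at_ob C (src \<Gamma> h)) (at_ar C h)) \<rparr>"

definition gamma_cubcat :: "('g, 'h) cat \<Rightarrow> ('g, 'h, 'a) cset_diagram \<Rightarrow> bool" where
  "gamma_cubcat \<Gamma> C \<longleftrightarrow>
     gamma_cubical_set \<Gamma> C \<and>
     (\<exists>\<rho> \<mu>. gamma_cubical_fun \<Gamma> (gamma_sharp \<Gamma> C) C \<rho> \<and>
            gamma_cubical_fun \<Gamma> (gamma_ex2 \<Gamma> C) C \<mu> \<and>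
            (\<forall>a\<in>Ob \<Gamma>. \<forall>n. \<forall>c\<in>cells (at_ob C a) n.
               \<rho> a n (sharp_unit (at_ob C a) n c) = c) \<and>
            (\<forall>a\<in>Ob \<Gamma>. \<forall>n. \<forall>p\<in>cells (sharp (at_ob C a)) n.
               \<rho> a n p =
               \<mu> a n (ex2_map (sharp (at_ob C a)) (\<rho> a) n (phi_sharp (at_ob C a) n p))))"

end

theory Submission
  imports Defs
begin

text \<open>The retraction \<open>\<rho>\<close> sends the class of a functor $c : [1]^n \to \mathcal X$ and a stream map
  $\theta : \vec{\mathbb I}^k \to \vec{\mathbb I}^n$ to the composite of \<open>c\<close> with the monotone map
  $[1]^k \to [1]^n$ that restricts \<open>\<theta>\<close> to the vertices and rounds the coordinates of its values.  A cubical
  function from the subdivided cube to a nerve amounts to a functor on the poset $[2]^n$, and \<open>\<mu>\<close>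
  restricts it along the doubling map $[1]^n \to [2]^n$: the arrow at $x \le y$ is the composite along
  $2x \le x + y \le 2y$, whose two steps lie in Boolean intervals.  Both \<open>\<rho>\<close> and
  \<open>\<mu> \<circ> ex\<^sub>2 \<rho> \<circ> \<phi>\<^sup>\<sharp>\<close> then evaluate a rounded \<open>\<theta>\<close>, the latter through the value at the midpoint of
  \<open>x\<close> and \<open>y\<close>.  That stream maps between directed cubes are the monotone continuous maps rests on the
  uniqueness of the circulation of the cube.  For $[x, y] \subseteq U$ the cosheaf condition for the
  cover of the cube by \<open>U\<close> and the complement of $[x, y]$ joins \<open>x\<close> to \<open>y\<close> by a monotone chain; the chain
  stays in $[x, y]$, so all its steps are steps of the preorder on \<open>U\<close>.\<close>

section \<open>The directed cubes\<close>

text \<open>The obstacle is that cubes of the subdivision exist only inside Boolean intervals, so a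
  cubical function \<open>\<psi>\<close> out of it assigns an arrow to a pair
  \<open>v \<le> w\<close> of [2]^n directly only when no coordinate grows by more than 1. The arrow
  from 2x to 2y is therefore a composite, and functoriality of \<open>\<mu>\<close> becomes a
  comparison for x \<le> y \<le> z: the routes from x + y to y + z through x + z and through 2y
  agree, because z exceeds x by at most 1 in each coordinate, which puts all four points in one
  Boolean interval. For an arrow to depend on its ends alone, every cube used is normalised to
  dimension n, degenerate where the ends agree. Morphisms of the cube category and cubes of the
  subdivision share one form: each output coordinate is a constant plus at most one input
  coordinate, and no input is read twice. Naturality of \<open>\<mu>\<close> then says that such
  maps preserve midpoints. Rounding is possible because a nerve accepts all monotone maps between
  the posets [1]^n, also those outside the cube category.\<close>

abbreviation cube :: "nat \<Rightarrow> rpt set" where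
  "cube n \<equiv> topspace (cube_top n)"

lemma cube_eq: "cube n = {..<n} \<rightarrow>\<^sub>E {0..1}"
  by (simp add: cube_top_def)

lemma cube_iff: "x \<in> cube n \<longleftrightarrow> (\<forall>i. if i < n then 0 \<le> x i \<and> x i \<le> 1 else x i = undefined)"
  by (auto simp: cube_eq PiE_iff extensional_def)

lemma cube_le_iff: "x \<in> cube n \<Longrightarrow> y \<in> cube n \<Longrightarrow> x \<le> y \<longleftrightarrow> (\<forall>i<n. x i \<le> y i)"
  unfolding cube_iff le_fun_def by (metis order_refl)

lemma cube_interval:
  assumes "x \<in> cube n" "y \<in> cube n"
  shows "{x..y} \<subseteq> cube n"
proof
  fix z assume z: "z \<in> {x..y}"
  show "z \<in> cube n"
    unfolding cube_iff
  proof
    fix i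
    have "x i \<le> z i" "z i \<le> y i"
      using z by (auto simp: le_fun_def)
    then show "if i < n then 0 \<le> z i \<and> z i \<le> 1 else z i = undefined"
      using assms[unfolded cube_iff, THEN spec[of _ i]] by (auto split: if_splits)
  qed
qed

section \<open>Order-convex balls as a base of the topology\<close>

definition near :: "nat \<Rightarrow> real \<Rightarrow> rpt \<Rightarrow> rpt set" where
  "near n \<epsilon> x = {y \<in> cube n. \<forall>i<n. \<bar>y i - x i\<bar> < \<epsilon>}"

text \<open>Balls of the sup metric are boxes, hence order convex. This is what lets a comparison
  inside a ball count as a step of \<open>cube_step\<close>.\<close>

lemma near_interval:
  assumes "x \<in> near n \<epsilon> z" "y \<in> near n \<epsilon> z"
  shows "{x..y} \<subseteq> near n \<epsilon> z"
proof
  fix w assume w: "w \<in> {x..y}"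
  have "\<bar>w i - z i\<bar> < \<epsilon>" if "i < n" for i
  proof -
    have "x i \<le> w i" "w i \<le> y i"
      using w by (auto simp: le_fun_def)
    moreover have "\<bar>x i - z i\<bar> < \<epsilon>" "\<bar>y i - z i\<bar> < \<epsilon>"
      using assms that by (auto simp: near_def)
    ultimately show ?thesis by linarith
  qed
  moreover have "w \<in> cube n"
    using w cube_interval[of x n y] assms by (auto simp: near_def)
  ultimately show "w \<in> near n \<epsilon> z"
    by (simp add: near_def)
qed

lemma openin_near: "openin (cube_top n) (near n \<epsilon> x)"
proof -
  have "near n \<epsilon> x = (\<Pi>\<^sub>E i\<in>{..<n}. {0..1} \<inter> {x i - \<epsilon><..<x i + \<epsilon>})"
  proof (rule set_eqI)
    fix y
    show "y \<in> near n \<epsilon> x \<longleftrightarrow> y \<in> (\<Pi>\<^sub>E i\<in>{..<n}. {0..1} \<inter> {x i - \<epsilon><..<x i + \<epsilon>})"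
      unfolding near_def cube_eq PiE_iff mem_Collect_eq abs_diff_less_iff Int_iff
        atLeastAtMost_iff greaterThanLessThan_iff lessThan_iff Ball_def
      by blast
  qed
  moreover have "openin (top_of_set {0..1::real}) ({0..1} \<inter> {x i - \<epsilon><..<x i + \<epsilon>})" for i
    by (simp add: openin_open_Int)
  ultimately show ?thesis
    by (simp add: cube_top_def openin_PiE)
qed

lemma openin_cube_iff:
  "openin (cube_top n) U \<longleftrightarrow> U \<subseteq> cube n \<and> (\<forall>x\<in>U. \<exists>\<epsilon>>0. near n \<epsilon> x \<subseteq> U)"
proof (intro iffI conjI ballI)
  assume U: "openin (cube_top n) U"
  show "U \<subseteq> cube n"
    using U by (rule openin_subset)
  fix x assume x: "x \<in> U"
  obtain V where V: "\<And>i. i < n \<Longrightarrow> openin (top_of_set {0..1::real}) (V i)"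
    and xV: "x \<in> Pi\<^sub>E {..<n} V" and VU: "Pi\<^sub>E {..<n} V \<subseteq> U"
    using U x unfolding cube_top_def openin_product_topology_alt Ball_def lessThan_iff by blast
  have "\<exists>\<epsilon>>0. \<forall>y\<in>{0..1}. \<bar>y - x i\<bar> < \<epsilon> \<longrightarrow> y \<in> V i" if i: "i < n" for i
  proof -
    have "x i \<in> V i"
      using xV i by auto
    then show ?thesis
      using V[OF i] unfolding openin_euclidean_subtopology_iff by (simp add: dist_real_def)
  qed
  then obtain \<epsilon> where \<epsilon>: "\<And>i. i < n \<Longrightarrow> \<epsilon> i > 0"
    "\<And>i y. i < n \<Longrightarrow> y \<in> {0..1} \<Longrightarrow> \<bar>y - x i\<bar> < \<epsilon> i \<Longrightarrow> y \<in> V i"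
    by metis
  \<comment> \<open>The inserted 1 keeps the minimum defined when \<open>n = 0\<close>.\<close>
  define d where "d = Min (insert 1 (\<epsilon> ` {..<n}))"
  have "d > 0"
    using \<epsilon>(1) by (simp add: d_def)
  moreover have "d \<le> \<epsilon> i" if "i < n" for i
    using that by (simp add: d_def)
  have "y \<in> Pi\<^sub>E {..<n} V" if y: "y \<in> near n d x" for y
  proof (rule PiE_I)
    fix i assume i: "i \<in> {..<n}"
    have "y i \<in> {0..1}" "\<bar>y i - x i\<bar> < d"
      using y i by (auto simp: near_def cube_eq)
    then show "y i \<in> V i"
      using i \<epsilon>(2)[of i "y i"] \<open>\<And>i. i < n \<Longrightarrow> d \<le> \<epsilon> i\<close>[of i] by auto
  next
    fix i assume "i \<notin> {..<n}"
    then show "y i = undefined"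
      using y by (auto simp: near_def cube_iff)
  qed
  ultimately show "\<exists>\<epsilon>>0. near n \<epsilon> x \<subseteq> U"
    using VU by (meson subset_iff)
next
  assume U: "U \<subseteq> cube n \<and> (\<forall>x\<in>U. \<exists>\<epsilon>>0. near n \<epsilon> x \<subseteq> U)"
  show "openin (cube_top n) U"
  proof (subst openin_subopen, intro ballI)
    fix x assume x: "x \<in> U"
    then obtain \<epsilon> where "\<epsilon> > 0" "near n \<epsilon> x \<subseteq> U"
      using U by blast
    moreover have "x \<in> near n \<epsilon> x"
      using U x \<open>\<epsilon> > 0\<close> by (auto simp: near_def)
    ultimately show "\<exists>T. openin (cube_top n) T \<and> x \<in> T \<and> T \<subseteq> U"
      using openin_near by blast
  qed
qed

lemma openin_near_cover:
  assumes "openin (cube_top n) U" "z \<in> U"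
  obtains \<epsilon> where "z \<in> near n \<epsilon> z" "near n \<epsilon> z \<subseteq> U"
proof -
  obtain \<epsilon> where "\<epsilon> > 0" "near n \<epsilon> z \<subseteq> U"
    using assms unfolding openin_cube_iff by blast
  moreover have "z \<in> near n \<epsilon> z"
    using assms(2) openin_subset[OF assms(1)] \<open>\<epsilon> > 0\<close> by (auto simp: near_def)
  ultimately show ?thesis
    using that by blast
qed

section \<open>The circulation of the cube\<close>

definition cube_step :: "nat \<Rightarrow> rpt set \<Rightarrow> rpt rel" where
  "cube_step n U = {(x, y). x \<in> cube n \<and> y \<in> cube n \<and> x \<le> y \<and> {x..y} \<subseteq> U}"

text \<open>A step demands the whole order interval inside \<open>U\<close>, and not only its ends,
  so that related points are never separated by a hole of \<open>U\<close>. The empty value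
  elsewhere is the convention of \<open>circulation\<close>.\<close>

definition cube_circ :: "nat \<Rightarrow> rpt set \<Rightarrow> rpt rel" where
  "cube_circ n U = (if openin (cube_top n) U then (cube_step n U)\<^sup>+ else {})"

lemma cube_step_mono: "U \<subseteq> V \<Longrightarrow> cube_step n U \<subseteq> cube_step n V"
  by (auto simp: cube_step_def)

lemma cube_step_near:
  assumes "x \<in> near n \<epsilon> z" "y \<in> near n \<epsilon> z" "x \<le> y"
  shows "(x, y) \<in> cube_step n (near n \<epsilon> z)"
  using near_interval[OF assms(1,2)] assms by (auto simp: cube_step_def near_def)

lemma cube_circ_le:
  assumes "(x, y) \<in> cube_circ n U"
  shows "x \<in> U" "y \<in> U" "x \<le> y"
proof -
  have "(x, y) \<in> (cube_step n U)\<^sup>+"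
    using assms by (auto simp: cube_circ_def split: if_splits)
  then have "x \<in> U \<and> y \<in> U \<and> x \<le> y"
    by induction (auto simp: cube_step_def)
  then show "x \<in> U" "y \<in> U" "x \<le> y" by auto
qed

lemma cube_circ_whole: "cube_circ n (cube n) = {(x, y). x \<in> cube n \<and> y \<in> cube n \<and> x \<le> y}"
proof -
  have "cube_step n (cube n) = {(x, y). x \<in> cube n \<and> y \<in> cube n \<and> x \<le> y}"
    using cube_interval by (auto simp: cube_step_def)
  moreover have "trans {(x, y). x \<in> cube n \<and> y \<in> cube n \<and> x \<le> y}"
    by (auto intro: transI order_trans)
  ultimately show ?thesis
    by (simp add: cube_circ_def)
qed

text \<open>A step in a union of open sets is cut along the segment joining its ends, which is compact.\<close>

lemma cube_step_Union:
  assumes O: "\<forall>U\<in>\<O>. openin (cube_top n) U" and xy: "(x, y) \<in> cube_step n (\<Union>\<O>)"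
  shows "(x, y) \<in> (\<Union>U\<in>\<O>. cube_circ n U)\<^sup>+"
proof -
  define z where "z s = (\<lambda>i\<in>{..<n}. (1 - s) * x i + s * y i)" for s :: real
  have x: "x \<in> cube n" and y: "y \<in> cube n" and le: "x \<le> y" and sub: "{x..y} \<subseteq> \<Union>\<O>"
    using xy by (auto simp: cube_step_def)
  have xy_i: "0 \<le> x i" "x i \<le> y i" "y i \<le> 1" if "i < n" for i
    using x y le that unfolding cube_iff le_fun_def by metis+
  have zmono: "z a \<le> z b" if "a \<le> b" for a b
  proof (rule le_funI)
    fix i
    show "z a i \<le> z b i"
    proof (cases "i < n")
      case True
      have "(b - a) * (y i - x i) \<ge> 0"
        using that xy_i[OF True] by simp
      then show ?thesis
        using True by (simp add: z_def algebra_simps)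
    qed (simp add: z_def)
  qed
  have z0: "z 0 = x" and z1: "z 1 = y"
    using x y unfolding cube_iff by (fastforce simp: z_def)+
  have zin: "z s \<in> {x..y}" if "0 \<le> s" "s \<le> 1" for s
    using zmono[OF that(1)] zmono[OF that(2)] by (simp add: z0 z1)
  have zc: "z s \<in> cube n" if "0 \<le> s" "s \<le> 1" for s
    using zin[OF that] cube_interval[OF x y] by blast
  have "0 \<le> (0::real) \<longrightarrow> (1::real) \<le> 1 \<longrightarrow> (z 0, z 1) \<in> (\<Union>U\<in>\<O>. cube_circ n U)\<^sup>+"
  \<comment> \<open>Bisection stands in for a finite subdivision: the property is additive over
    adjacent parameter intervals, and it remains to prove it for short intervals around each
    \<open>s\<close>.\<close>
  proof (rule Bolzano[where P = "\<lambda>a b. 0 \<le> a \<longrightarrow> b \<le> 1 \<longrightarrow> (z a, z b) \<in> (\<Union>U\<in>\<O>. cube_circ n U)\<^sup>+"])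
    fix s :: real assume s: "0 \<le> s" "s \<le> 1"
    obtain U where U: "U \<in> \<O>" "z s \<in> U"
      using zin[OF s] sub by blast
    then obtain \<epsilon> where \<epsilon>: "\<epsilon> > 0" "near n \<epsilon> (z s) \<subseteq> U"
      using O openin_cube_iff by metis
    \<comment> \<open>Each coordinate of the segment has slope \<open>y i - x i\<close>, at most 1,
      so the radius of the ball also serves as a bound on the parameter.\<close>
    have near: "z r \<in> near n \<epsilon> (z s)" if r: "0 \<le> r" "r \<le> 1" "\<bar>r - s\<bar> < \<epsilon>" for r
    proof -
      have "\<bar>z r i - z s i\<bar> < \<epsilon>" if i: "i < n" for i
      proof -
        have "z r i - z s i = (r - s) * (y i - x i)"
          using i by (simp add: z_def algebra_simps)
        moreover have "\<bar>(r - s) * (y i - x i)\<bar> \<le> \<bar>r - s\<bar> * 1"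
          unfolding abs_mult using xy_i[OF i] by (intro mult_left_mono) auto
        ultimately show ?thesis
          using r(3) by simp
      qed
      then show ?thesis
        using zc[OF r(1,2)] by (simp add: near_def)
    qed
    have "(z a, z b) \<in> (\<Union>U\<in>\<O>. cube_circ n U)\<^sup>+"
      if "0 \<le> a" "b \<le> 1" "a \<le> s" "s \<le> b" "b - a < \<epsilon>" for a b
    proof -
      have "(z a, z b) \<in> cube_step n U"
        using cube_step_near[OF near near zmono] cube_step_mono[OF \<epsilon>(2)] that by fastforce
      then have "(z a, z b) \<in> cube_circ n U"
        using O U by (auto simp: cube_circ_def)
      then show ?thesis
        using U by blast
    qed
    then show "\<exists>d>0. \<forall>a b. a \<le> s \<and> s \<le> b \<and> b - a < d \<longrightarrow>
        0 \<le> a \<longrightarrow> b \<le> 1 \<longrightarrow> (z a, z b) \<in> (\<Union>U\<in>\<O>. cube_circ n U)\<^sup>+"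
      using \<epsilon>(1) by blast
  qed (auto intro: trancl_trans)
  then show ?thesis
    by (simp add: z0 z1)
qed

lemma circulation_cube_circ: "circulation (cube_top n) (cube_circ n)"
  unfolding circulation_def
proof (intro conjI allI impI)
  fix U assume U: "openin (cube_top n) U"
  have "U \<subseteq> cube n"
    using U by (rule openin_subset)
  then have "refl_on U (cube_circ n U)"
    using U by (fastforce simp: refl_on_def cube_circ_def cube_step_def)
  moreover have "cube_circ n U \<subseteq> U \<times> U"
    using cube_circ_le by fast
  moreover have "trans (cube_circ n U)"
    by (simp add: cube_circ_def)
  ultimately show "preorder_on U (cube_circ n U)"
    by (simp add: preorder_on_def)
next
  fix \<O> assume O: "\<forall>U\<in>\<O>. openin (cube_top n) U"
  have op: "openin (cube_top n) (\<Union>\<O>)"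
    using O by (intro openin_Union) auto
  \<comment> \<open>The right side is transitive, so it is enough to cut single steps.\<close>
  have "cube_step n (\<Union>\<O>) \<subseteq> (\<Union>U\<in>\<O>. cube_circ n U)\<^sup>+"
    using cube_step_Union[OF O] by auto
  then have "cube_circ n (\<Union>\<O>) \<subseteq> (\<Union>U\<in>\<O>. cube_circ n U)\<^sup>+"
    using op by (simp add: cube_circ_def) (metis trancl_id trancl_mono_subset trans_trancl)
  moreover have "cube_circ n U \<subseteq> cube_circ n (\<Union>\<O>)" if "U \<in> \<O>" for U
    using O op that by (auto simp: cube_circ_def intro: trancl_mono[OF _ cube_step_mono])
  then have "(\<Union>U\<in>\<O>. cube_circ n U)\<^sup>+ \<subseteq> (cube_circ n (\<Union>\<O>))\<^sup>+"
    by (intro trancl_mono_subset) auto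
  then have "(\<Union>U\<in>\<O>. cube_circ n U)\<^sup>+ \<subseteq> cube_circ n (\<Union>\<O>)"
    using op by (simp add: cube_circ_def)
  ultimately show "cube_circ n (\<Union>\<O>) = (\<Union>U\<in>\<O>. cube_circ n U)\<^sup>+" by blast
qed (simp add: cube_circ_def)

lemma circulation_in:
  assumes "circulation T c" "(x, y) \<in> c U"
  shows "openin T U" "x \<in> U" "y \<in> U"
  using assms unfolding circulation_def preorder_on_def by blast+

text \<open>This is the cosheaf condition for the cover of \<open>V\<close> by \<open>U\<close> and
  \<open>V\<close> itself; a non-open \<open>U\<close> carries the empty relation.\<close>

lemma circulation_mono:
  assumes "circulation T c" "openin T V" "U \<subseteq> V"
  shows "c U \<subseteq> c V"
proof (cases "openin T U")
  case True
  have "\<forall>W\<in>{U, V}. openin T W"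
    using True assms by auto
  then have "c (\<Union>{U, V}) = (\<Union>W\<in>{U, V}. c W)\<^sup>+"
    using assms(1) unfolding circulation_def by blast
  moreover have "\<Union>{U, V} = V"
    using assms by auto
  ultimately have "c V = (c U \<union> c V)\<^sup>+"
    by (simp add: Un_commute)
  then show ?thesis
    by (metis Un_upper1 r_into_trancl' subrelI subsetD)
next
  case False
  then show ?thesis
    using assms circulation_in(1) by fastforce
qed

lemma circulation_cover:
  assumes "circulation T c" "(x, y) \<in> c (\<Union>\<O>)" "\<forall>U\<in>\<O>. openin T U"
  shows "(x, y) \<in> (\<Union>U\<in>\<O>. c U)\<^sup>+"
  using assms unfolding circulation_def by blast

lemma cube_circ_unique:
  assumes c: "circulation (cube_top n) c"
    and whole: "c (cube n) = {(x, y). x \<in> cube n \<and> y \<in> cube n \<and> (\<forall>i<n. x i \<le> y i)}"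
  shows "c = cube_circ n"
proof (intro ext equalityI)
  fix U
  have le: "x \<le> y" "x \<in> V" "y \<in> V" "x \<in> cube n" "y \<in> cube n" if "(x, y) \<in> c V" for x y V
  proof -
    have V: "openin (cube_top n) V"
      using circulation_in[OF c that] by blast
    have "(x, y) \<in> c (cube n)"
      using circulation_mono[OF c _ openin_subset[OF V]] that by auto
    then show "x \<le> y" "x \<in> V" "y \<in> V" "x \<in> cube n" "y \<in> cube n"
      using circulation_in[OF c that] by (auto simp: whole cube_le_iff)
  qed
  have trans: "trans (c V)" if "openin (cube_top n) V" for V
    using c that by (auto simp: circulation_def preorder_on_def)
  show "c U \<subseteq> cube_circ n U"
  proof safe
    fix x y assume xy: "(x, y) \<in> c U"
    have U: "openin (cube_top n) U"
      using circulation_in[OF c xy] by blast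
    \<comment> \<open>On a ball, \<open>c\<close> is contained in \<open>cube_step\<close>, because
      it is contained in the order and balls are convex. A cover of \<open>U\<close> by balls
      therefore breaks a related pair into steps.\<close>
    define \<O> where "\<O> = {near n \<epsilon> z | \<epsilon> z. near n \<epsilon> z \<subseteq> U}"
    have "U \<subseteq> \<Union>\<O>"
    proof
      fix z assume "z \<in> U"
      then obtain \<epsilon> where "z \<in> near n \<epsilon> z" "near n \<epsilon> z \<subseteq> U"
        using openin_near_cover[OF U] by auto
      then show "z \<in> \<Union>\<O>"
        unfolding \<O>_def by auto
    qed
    then have "\<Union>\<O> = U"
      by (auto simp: \<O>_def)
    then have "(x, y) \<in> (\<Union>V\<in>\<O>. c V)\<^sup>+"
      using xy by (intro circulation_cover[OF c]) (auto simp: \<O>_def openin_near)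
    moreover have "c V \<subseteq> cube_step n U" if "V \<in> \<O>" for V
    proof safe
      fix s t assume st: "(s, t) \<in> c V"
      obtain \<epsilon> z where V: "V = near n \<epsilon> z" "near n \<epsilon> z \<subseteq> U"
        using \<open>V \<in> \<O>\<close> unfolding \<O>_def by blast
      show "(s, t) \<in> cube_step n U"
        using le[OF st] cube_step_near cube_step_mono[OF V(2)] V(1) by blast
    qed
    ultimately have "(x, y) \<in> (cube_step n U)\<^sup>+"
      by (meson UN_least trancl_mono)
    then show "(x, y) \<in> cube_circ n U"
      using U by (simp add: cube_circ_def)
  qed
  show "cube_circ n U \<subseteq> c U"
  proof (cases "openin (cube_top n) U")
    case U: True
    have "cube_step n U \<subseteq> c U"
    proof safe
      fix x y assume xy: "(x, y) \<in> cube_step n U"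
      define W where "W = cube n - {x..y}"
      have xyc: "x \<in> cube n" "y \<in> cube n" "x \<le> y" "{x..y} \<subseteq> U"
        using xy by (auto simp: cube_step_def)
      have "openin (cube_top n) W"
        unfolding openin_cube_iff
      proof (intro conjI ballI)
        fix z assume z: "z \<in> W"
        then have "\<not> (x \<le> z \<and> z \<le> y)" "z \<in> cube n"
          by (auto simp: W_def)
        then obtain i where i: "i < n" "z i < x i \<or> y i < z i"
          using xyc by (auto simp: cube_le_iff not_le)
        \<comment> \<open>The distance by which coordinate \<open>i\<close> leaves the interval from
          \<open>x i\<close> to \<open>y i\<close>: exactly one of the two differences is positive,
          since \<open>x i \<le> y i\<close>.\<close>
        define \<epsilon> where "\<epsilon> = max (x i - z i) (z i - y i)"
        have "w \<in> W" if "w \<in> near n \<epsilon> z" for w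
        proof -
          have "w \<in> cube n" "\<bar>w i - z i\<bar> < \<epsilon>"
            using that i by (auto simp: near_def)
          moreover have "\<not> (x i \<le> w i \<and> w i \<le> y i)"
            using \<open>\<bar>w i - z i\<bar> < \<epsilon>\<close> i(2) xyc(3)[THEN le_funD, of i] unfolding \<epsilon>_def max_def
            by (auto split: if_splits)
          ultimately show ?thesis
            by (auto simp: W_def le_fun_def)
        qed
        moreover have "\<epsilon> > 0"
          using i by (auto simp: \<epsilon>_def)
        ultimately show "\<exists>\<epsilon>>0. near n \<epsilon> z \<subseteq> W" by blast
      qed (auto simp: W_def)
      moreover have "\<Union>{U, W} = cube n"
        using openin_subset[OF U] xyc by (auto simp: W_def)
      moreover have "(x, y) \<in> c (cube n)"
        using xyc by (auto simp: whole cube_le_iff)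
      ultimately have "(x, y) \<in> (\<Union>V\<in>{U, W}. c V)\<^sup>+"
        using U circulation_cover[OF c, of x y "{U, W}"] by auto
      then have chain: "(x, y) \<in> (c U \<union> c W)\<^sup>+" by simp
      \<comment> \<open>The bound \<open>z \<le> y\<close> is inherited backwards, since every link
        increases, whereas \<open>x \<le> z\<close> is propagated forwards. Together they keep the
        points off \<open>W\<close>, so no link can come from \<open>c W\<close>.\<close>
      have "z \<le> y \<longrightarrow> (x, z) \<in> c U \<and> x \<le> z" if "(x, z) \<in> (c U \<union> c W)\<^sup>+" for z
        using that
      proof induction
        case (base z)
        then show ?case
          using le(2)[of x z W] le(1) xyc by (auto simp: W_def)
      next
        case (step w z)
        show ?case
        proof
          assume "z \<le> y"
          moreover have "w \<le> z"
            using step.hyps(2) le by auto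
          ultimately have "(x, w) \<in> c U" "x \<le> w" "w \<le> y"
            using step.IH by auto
          moreover from this have "(w, z) \<in> c U"
            using step.hyps(2) le(2)[of w z W] by (auto simp: W_def)
          ultimately show "(x, z) \<in> c U \<and> x \<le> z"
            using trans[OF U] \<open>w \<le> z\<close> by (meson order_trans transD)
        qed
      qed
      then show "(x, y) \<in> c U"
        using chain by blast
    qed
    then show ?thesis
      using trancl_mono_subset[of "cube_step n U" "c U"] trans[OF U] U by (simp add: cube_circ_def)
  qed (simp add: cube_circ_def)
qed

text \<open>Existence and uniqueness together evaluate the definite description in
  \<open>cube_stream\<close>.\<close>

lemma circ_cube_stream: "circ (cube_stream n) = cube_circ n"
proof -
  have "cube_circ n (cube n) = {(x, y). x \<in> cube n \<and> y \<in> cube n \<and> (\<forall>i<n. x i \<le> y i)}"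
    by (auto simp: cube_circ_whole cube_le_iff)
  then have "(THE c. circulation (cube_top n) c \<and>
      c (cube n) = {(x, y). x \<in> cube n \<and> y \<in> cube n \<and> (\<forall>i<n. x i \<le> y i)}) = cube_circ n"
    by (intro the_equality) (auto simp: circulation_cube_circ intro!: cube_circ_unique)
  then show ?thesis
    by (simp add: cube_stream_def)
qed

lemma top_of_cube_stream: "top_of (cube_stream n) = cube_top n"
  by (simp add: cube_stream_def)

text \<open>In one direction the whole cube is a sufficient test set. In the other, the condition is
  checked over small balls of the target, where the order alone gives a step.\<close>

lemma stream_maps_cube_iff:
  "\<theta> \<in> stream_maps (cube_stream m) (cube_stream n) \<longleftrightarrow>
     \<theta> \<in> extensional (cube m) \<and> continuous_map (cube_top m) (cube_top n) \<theta> \<and>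
     (\<forall>x\<in>cube m. \<forall>y\<in>cube m. x \<le> y \<longrightarrow> \<theta> x \<le> \<theta> y)"
proof -
  have "(\<forall>U. openin (cube_top n) U \<longrightarrow>
           (\<forall>(x, y) \<in> cube_circ m {z \<in> cube m. \<theta> z \<in> U}. (\<theta> x, \<theta> y) \<in> cube_circ n U)) \<longleftrightarrow>
        (\<forall>x\<in>cube m. \<forall>y\<in>cube m. x \<le> y \<longrightarrow> \<theta> x \<le> \<theta> y)" (is "?S \<longleftrightarrow> ?M")
    if cont: "continuous_map (cube_top m) (cube_top n) \<theta>"
  proof
    assume S: ?S
    have "{z \<in> cube m. \<theta> z \<in> cube n} = cube m"
      using continuous_map_funspace[OF cont] by auto
    then have "\<forall>(x, y) \<in> cube_circ m (cube m). (\<theta> x, \<theta> y) \<in> cube_circ n (cube n)"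
      using S[rule_format, of "cube n"] by auto
    then show ?M
      by (auto simp: cube_circ_whole)
  next
    assume M: ?M
    show ?S
    proof (intro allI impI ballI, clarify)
      fix U x y assume U: "openin (cube_top n) U"
        and xy: "(x, y) \<in> cube_circ m {z \<in> cube m. \<theta> z \<in> U}"
      \<comment> \<open>A pair related in the preimage of a ball has its images in that ball, in the
        right order.\<close>
      define \<O> where "\<O> = {{z \<in> cube m. \<theta> z \<in> near n \<epsilon> w} | \<epsilon> w. near n \<epsilon> w \<subseteq> U}"
      have "{z \<in> cube m. \<theta> z \<in> U} = \<Union>\<O>"
      proof (intro equalityI subsetI)
        fix z assume z: "z \<in> {z \<in> cube m. \<theta> z \<in> U}"
        then obtain \<epsilon> where "\<theta> z \<in> near n \<epsilon> (\<theta> z)" "near n \<epsilon> (\<theta> z) \<subseteq> U"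
          using openin_near_cover[OF U] by auto
        then show "z \<in> \<Union>\<O>"
          unfolding \<O>_def using z by auto
      qed (auto simp: \<O>_def)
      then have "(x, y) \<in> (\<Union>V\<in>\<O>. cube_circ m V)\<^sup>+"
        using xy cont openin_near unfolding \<O>_def
        by (intro circulation_cover[OF circulation_cube_circ]) (auto intro: openin_continuous_map_preimage)
      moreover have step: "(\<theta> s, \<theta> t) \<in> cube_step n U"
        if "(s, t) \<in> (\<Union>V\<in>\<O>. cube_circ m V)" for s t
      proof -
        from that obtain V where V: "V \<in> \<O>" "(s, t) \<in> cube_circ m V"
          by blast
        then obtain \<epsilon> w where w: "V = {z \<in> cube m. \<theta> z \<in> near n \<epsilon> w}" "near n \<epsilon> w \<subseteq> U"
          unfolding \<O>_def by blast
        then have "(\<theta> s, \<theta> t) \<in> cube_step n (near n \<epsilon> w)"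
          using M cube_circ_le[OF V(2)] by (intro cube_step_near) auto
        then show "(\<theta> s, \<theta> t) \<in> cube_step n U"
          using cube_step_mono[OF w(2)] by blast
      qed
      ultimately have "(\<theta> x, \<theta> y) \<in> (cube_step n U)\<^sup>+"
        by induction (auto intro: trancl_into_trancl step)
      then show "(\<theta> x, \<theta> y) \<in> cube_circ n U"
        using U by (simp add: cube_circ_def)
    qed
  qed
  then show ?thesis
    unfolding stream_maps_def circ_cube_stream top_of_cube_stream by blast
qed

section \<open>Cubes of grids\<close>

declare One_nat_def [simp del]

section \<open>Order and lattice operations on grids\<close>

lemma grid_eqI: "x \<in> grid k n \<Longrightarrow> y \<in> grid k n \<Longrightarrow> (\<And>i. i < n \<Longrightarrow> x i = y i) \<Longrightarrow> x = y"
  unfolding grid_def by (rule PiE_ext) auto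

lemma grid_le_iff: "x \<in> grid k n \<Longrightarrow> y \<in> grid k n \<Longrightarrow> x \<le> y \<longleftrightarrow> (\<forall>i<n. x i \<le> y i)"
  unfolding grid_iff le_fun_def by (metis order_refl)

lemma grid_leD: "x \<in> grid k n \<Longrightarrow> i < n \<Longrightarrow> x i \<le> k"
  unfolding grid_iff by metis

lemma restrict_in_grid: "(\<And>i. i < n \<Longrightarrow> f i \<le> k) \<Longrightarrow> (\<lambda>i\<in>{..<n}. f i) \<in> grid k n"
  by (auto simp: grid_def)

lemma grid_interval:
  assumes "x \<in> grid k n" "y \<in> grid k n"
  shows "{x..y} \<subseteq> grid k n"
proof
  fix z assume z: "z \<in> {x..y}"
  show "z \<in> grid k n"
    unfolding grid_iff
  proof
    fix i
    have "x i \<le> z i" "z i \<le> y i"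
      using z by (auto simp: le_fun_def)
    then show "if i < n then z i \<le> k else z i = undefined"
      using assms[unfolded grid_iff, THEN spec[of _ i]] by (auto split: if_splits)
  qed
qed

lemma inf_sup_grid:
  assumes "x \<in> grid k n" "y \<in> grid k n"
  shows "inf x y \<in> grid k n" "sup x y \<in> grid k n"
  using assms by (auto simp: grid_iff inf_min sup_max min_le_iff_disj)

section \<open>Extreme vertices, and affine maps of grids\<close>

definition top_pt :: "nat \<Rightarrow> pt" where
  "top_pt n = (\<lambda>i\<in>{..<n}. 1)"

lemma top_pt_in_grid: "top_pt n \<in> grid 1 n"
  by (simp add: top_pt_def restrict_in_grid)

lemma origin_le: "x \<in> grid k n \<Longrightarrow> origin n \<le> x"
  by (subst grid_le_iff[where k = k and n = n]) (auto simp: origin_in_grid, simp add: origin_def)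

lemma le_top_pt: "x \<in> grid 1 n \<Longrightarrow> x \<le> top_pt n"
  by (subst grid_le_iff[where k = 1 and n = n])
    (auto simp: top_pt_in_grid, simp add: top_pt_def grid_leD[of _ 1])

text \<open>The common normal form of morphisms of the cube category (\<open>K = 1\<close>) and
  cubes of the subdivision (\<open>K = 2\<close>). An index \<open>\<pi> j\<close> that is not below
  \<open>k\<close> marks a constant coordinate, and injectivity on the other coordinates excludes
  diagonals.\<close>

definition cube_affine :: "nat \<Rightarrow> nat \<Rightarrow> nat \<Rightarrow> (pt \<Rightarrow> pt) \<Rightarrow> bool" where
  "cube_affine k K n \<tau> \<longleftrightarrow> \<tau> \<in> grid 1 k \<rightarrow>\<^sub>E grid K n \<and>
     (\<exists>\<pi> e. inj_on \<pi> {j. j < n \<and> \<pi> j < k} \<and>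
        (\<forall>x\<in>grid 1 k. \<forall>j<n. \<tau> x j = e j + (if \<pi> j < k then x (\<pi> j) else 0)))"

lemma cube_affineI:
  assumes "\<tau> \<in> grid 1 k \<rightarrow>\<^sub>E grid K n"
    and "\<And>i j. i < n \<Longrightarrow> j < n \<Longrightarrow> \<pi> i < k \<Longrightarrow> \<pi> i = \<pi> j \<Longrightarrow> i = j"
    and "\<And>x j. x \<in> grid 1 k \<Longrightarrow> j < n \<Longrightarrow> \<tau> x j = e j + (if \<pi> j < k then x (\<pi> j) else 0)"
  shows "cube_affine k K n \<tau>"
proof -
  have "inj_on \<pi> {j. j < n \<and> \<pi> j < k}"
    using assms(2) by (auto simp: inj_on_def)
  with assms(1,3) show ?thesis
    unfolding cube_affine_def by blast
qed

lemma cube_affine_in: "cube_affine k K n \<tau> \<Longrightarrow> x \<in> grid 1 k \<Longrightarrow> \<tau> x \<in> grid K n"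
  by (auto simp: cube_affine_def)

text \<open>\<open>lin\<close> reads a map at the origin and the unit vectors alone, and there an
  affine coordinate reveals its constant and the input that it follows.\<close>

lemma lin_affine:
  assumes \<tau>: "\<And>x. x \<in> grid 1 k \<Longrightarrow> \<tau> x j = e + (if i < k then x i else 0)"
    and t: "t \<in> cube k" and j: "j < n"
  shows "lin k n \<tau> t j = real e + (if i < k then t i else 0)"
proof -
  have u: "\<tau> (unit_vec k l) j = e + (if i < k \<and> l = i then 1 else 0)" if "l < k" for l
    using \<tau>[of "unit_vec k l"] unit_vec_in_grid[of k l] that by (auto simp: unit_vec_def)
  have o: "\<tau> (origin k) j = e"
    using \<tau>[of "origin k"] origin_in_grid[of k 1] by (auto simp: origin_def)
  have "lin k n \<tau> t j = real e + (\<Sum>l<k. t l * (if l = i then 1 else 0))"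
    using t j by (auto simp: lin_def o u intro!: sum.cong)
  also have "\<dots> = real e + (\<Sum>l<k. if l = i then t l else 0)"
    by (simp add: if_distrib cong: if_cong)
  also have "\<dots> = real e + (if i < k then t i else 0)"
    by (subst sum.delta) auto
  finally show ?thesis .
qed

lemma cube_affineE:
  assumes "cube_affine k K n \<tau>"
  obtains \<pi> e where "\<And>i j. i < n \<Longrightarrow> j < n \<Longrightarrow> \<pi> i < k \<Longrightarrow> \<pi> i = \<pi> j \<Longrightarrow> i = j"
    and "\<And>x j. x \<in> grid 1 k \<Longrightarrow> j < n \<Longrightarrow> \<tau> x j = e j + (if \<pi> j < k then x (\<pi> j) else 0)"
    and "\<And>t j. t \<in> cube k \<Longrightarrow> j < n \<Longrightarrow> lin k n \<tau> t j = real (e j) + (if \<pi> j < k then t (\<pi> j) else 0)"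
    and "\<And>j. j < n \<Longrightarrow> e j + (if \<pi> j < k then 1 else 0) \<le> K"
proof -
  obtain \<pi> e where inj: "inj_on \<pi> {j. j < n \<and> \<pi> j < k}"
    and \<tau>: "\<And>x j. x \<in> grid 1 k \<Longrightarrow> j < n \<Longrightarrow> \<tau> x j = e j + (if \<pi> j < k then x (\<pi> j) else 0)"
    using assms unfolding cube_affine_def by blast
  \<comment> \<open>Every coordinate is largest at the top vertex, so the bound is read off
    there.\<close>
  have "e j + (if \<pi> j < k then 1 else 0) \<le> K" if "j < n" for j
    using \<tau>[OF top_pt_in_grid that] grid_leD[OF cube_affine_in[OF assms top_pt_in_grid] that]
    by (auto simp: top_pt_def split: if_splits)
  with inj \<tau> show ?thesis
    by (intro that[of \<pi> e] lin_affine) (auto simp: inj_on_def)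
qed

lemma cube_affine_comp:
  assumes f: "cube_affine l 1 m f" and g: "cube_affine m K n g"
  shows "cube_affine l K n (restrict (g \<circ> f) (grid 1 l))"
proof -
  obtain \<pi> e where injf: "\<And>i j. i < m \<Longrightarrow> j < m \<Longrightarrow> \<pi> i < l \<Longrightarrow> \<pi> i = \<pi> j \<Longrightarrow> i = j"
    and fe: "\<And>x j. x \<in> grid 1 l \<Longrightarrow> j < m \<Longrightarrow> f x j = e j + (if \<pi> j < l then x (\<pi> j) else 0)"
    using f by (rule cube_affineE) blast
  obtain \<rho> d where injg: "\<And>i j. i < n \<Longrightarrow> j < n \<Longrightarrow> \<rho> i < m \<Longrightarrow> \<rho> i = \<rho> j \<Longrightarrow> i = j"
    and gd: "\<And>x j. x \<in> grid 1 m \<Longrightarrow> j < n \<Longrightarrow> g x j = d j + (if \<rho> j < m then x (\<rho> j) else 0)"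
    using g by (rule cube_affineE) blast
  show ?thesis
  \<comment> \<open>If the outer coordinate is constant, so is the composite one: the index
    \<open>l\<close> is out of range.\<close>
  proof (rule cube_affineI[where \<pi> = "\<lambda>j. if \<rho> j < m then \<pi> (\<rho> j) else l"
        and e = "\<lambda>j. d j + (if \<rho> j < m then e (\<rho> j) else 0)"])
    show "restrict (g \<circ> f) (grid 1 l) \<in> grid 1 l \<rightarrow>\<^sub>E grid K n"
      using cube_affine_in[OF f] cube_affine_in[OF g] by auto
    show "i = j" if "i < n" "j < n" "(if \<rho> i < m then \<pi> (\<rho> i) else l) < l"
      "(if \<rho> i < m then \<pi> (\<rho> i) else l) = (if \<rho> j < m then \<pi> (\<rho> j) else l)" for i j
      using that injf[of "\<rho> i" "\<rho> j"] injg[of i j] by (auto split: if_splits)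
    show "restrict (g \<circ> f) (grid 1 l) x j = d j + (if \<rho> j < m then e (\<rho> j) else 0) +
        (if (if \<rho> j < m then \<pi> (\<rho> j) else l) < l then x (if \<rho> j < m then \<pi> (\<rho> j) else l) else 0)"
      if "x \<in> grid 1 l" "j < n" for x j
      using that fe[of x "\<rho> j"] gd[of "f x" j] cube_affine_in[OF f] by auto
  qed
qed

lemma box_affine: "box m n f \<Longrightarrow> cube_affine m 1 n f"
proof (induction rule: box.induct)
  case (box_id n)
  show ?case
    by (rule cube_affineI[where \<pi> = id and e = "\<lambda>_. 0"]) auto
next
  case (box_coface i n e)
  show ?case
  \<comment> \<open>The inserted coordinate is constant, hence the out-of-range index
    \<open>n\<close>; the later coordinates are shifted by one.\<close>
  proof (rule cube_affineI[where \<pi> = "\<lambda>j. if j < i then j else if j = i then n else j - 1"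
        and e = "\<lambda>j. if j = i then e else 0"])
    show "coface n i e \<in> grid 1 n \<rightarrow>\<^sub>E grid 1 (Suc n)"
      using box_coface unfolding coface_def by (intro restrict_PiE_iff[THEN iffD2] ballI restrict_in_grid) (use box_coface in \<open>auto simp: grid_leD[of _ 1 n]\<close>)
  qed (use box_coface in \<open>auto simp: coface_def split: if_splits\<close>)
next
  case (box_codegeneracy i n)
  show ?case
  proof (rule cube_affineI[where \<pi> = "\<lambda>j. if j < i then j else Suc j" and e = "\<lambda>j. 0"])
    show "codegeneracy n i \<in> grid 1 (Suc n) \<rightarrow>\<^sub>E grid 1 n"
      using box_codegeneracy unfolding codegeneracy_def
      by (intro restrict_PiE_iff[THEN iffD2] ballI restrict_in_grid) (auto simp: grid_leD[of _ 1 "Suc n"])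
  qed (use box_codegeneracy in \<open>auto simp: codegeneracy_def split: if_splits\<close>)
next
  case (box_perm \<pi> n)
  have lt: "\<pi> j < n" if "j < n" for j
    using permutes_in_image[OF box_perm, of j] that by simp
  show ?case
  proof (rule cube_affineI[where \<pi> = \<pi> and e = "\<lambda>j. 0"])
    show "coord_perm n \<pi> \<in> grid 1 n \<rightarrow>\<^sub>E grid 1 n"
      unfolding coord_perm_def using lt
      by (intro restrict_PiE_iff[THEN iffD2] ballI restrict_in_grid) (auto simp: grid_leD[of _ 1 n])
  qed (use lt permutes_inj[OF box_perm] in \<open>auto simp: coord_perm_def inj_eq\<close>)
next
  case (box_comp l m f n g)
  show ?case
    using cube_affine_comp box_comp.IH by blast
qed

lemma cube_affine_mono:
  assumes \<tau>: "cube_affine k K n \<tau>" and x: "x \<in> grid 1 k" "y \<in> grid 1 k" "x \<le> y"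
  shows "\<tau> x \<le> \<tau> y" and "j < n \<Longrightarrow> \<tau> y j \<le> \<tau> x j + 1"
proof -
  obtain \<pi> e where eq: "\<And>x j. x \<in> grid 1 k \<Longrightarrow> j < n \<Longrightarrow> \<tau> x j = e j + (if \<pi> j < k then x (\<pi> j) else 0)"
    using \<tau> by (rule cube_affineE) blast
  show "\<tau> x \<le> \<tau> y"
    using x by (subst grid_le_iff[OF cube_affine_in[OF \<tau>] cube_affine_in[OF \<tau>]]) (auto simp: eq le_fun_def)
  show "\<tau> y j \<le> \<tau> x j + 1" if "j < n"
    using that x grid_leD[OF x(2), of "\<pi> j"] by (auto simp: eq)
qed

section \<open>Boolean intervals and the cubes of the subdivision\<close>

lemma boolean_interval_grid:
  assumes a: "a \<in> grid K n" and b: "b \<in> grid K n" and ab: "a \<le> b" and le: "\<And>j. j < n \<Longrightarrow> b j \<le> a j + 1"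
  shows "boolean_interval (grid K n) {a..b}"
proof -
  \<comment> \<open>The interval is a cube on the coordinates where its ends differ;
    \<open>h\<close> enumerates them, and \<open>g\<close> moves each of them by 0 or 1.\<close>
  define D where "D = {j. j < n \<and> a j < b j}"
  define m where "m = card D"
  have "finite D"
    by (simp add: D_def)
  then obtain h where h: "bij_betw h {..<m} D"
    using ex_bij_betw_nat_finite[of D] by (auto simp: m_def lessThan_atLeast0)
  define h' where "h' = inv_into {..<m} h"
  have hD: "h i \<in> D" and h'h: "h' (h i) = i" if "i < m" for i
    using h that by (auto simp: h'_def bij_betw_def inv_into_f_f)
  have h'm: "h' j < m" and hh': "h (h' j) = j" if "j \<in> D" for j
    using h that inv_into_into[of j h "{..<m}"] by (auto simp: h'_def bij_betw_def f_inv_into_f)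
  have notD: "a j = b j" if "j < n" "j \<notin> D" for j
    using that le_funD[OF ab, of j] by (auto simp: D_def)
  have Db: "b j = a j + 1" if "j \<in> D" for j
    using that le[of j] by (auto simp: D_def)
  define g where "g x = (\<lambda>j\<in>{..<n}. a j + (if j \<in> D then x (h' j) else 0))" for x :: pt
  define g' where "g' z = (\<lambda>i\<in>{..<m}. z (h i) - a (h i))" for z :: pt
  have gin: "g x \<in> {a..b}" if x: "x \<in> grid 1 m" for x
  proof -
    have "a j \<le> g x j \<and> g x j \<le> b j" for j
    proof (cases "j < n")
      case True
      then show ?thesis
        using grid_leD[OF x h'm, of j] notD[of j] Db[of j] by (auto simp: g_def)
    next
      case False
      then show ?thesis
        using a b by (simp add: g_def grid_iff)
    qed
    then show ?thesis
      by (simp add: le_fun_def)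
  qed
  have zab: "a j \<le> z j" "z j \<le> b j" if "z \<in> {a..b}" for z j
    using that by (auto simp: le_fun_def)
  have "bij_betw g (grid 1 m) {a..b}"
  proof (rule bij_betwI[where g = g'])
    show "g \<in> grid 1 m \<rightarrow> {a..b}"
      using gin by blast
    show "g' \<in> {a..b} \<rightarrow> grid 1 m"
    proof
      fix z assume z: "z \<in> {a..b}"
      show "g' z \<in> grid 1 m"
        unfolding g'_def
      proof (rule restrict_in_grid)
        fix i assume "i < m"
        then show "z (h i) - a (h i) \<le> 1"
          using zab[OF z, of "h i"] Db[OF hD, of i] by simp
      qed
    qed
    show "g' (g x) = x" if "x \<in> grid 1 m" for x
    proof
      fix i
      show "g' (g x) i = x i"
        using that hD[of i] h'h[of i] by (auto simp: g_def g'_def D_def grid_iff)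
    qed
    show "g (g' z) = z" if z: "z \<in> {a..b}" for z
    proof (rule grid_eqI)
      show "g (g' z) \<in> grid K n" "z \<in> grid K n"
        using gin z \<open>g' \<in> _\<close> grid_interval[OF a b] by blast+
      fix j assume "j < n"
      then show "g (g' z) j = z j"
        using zab[OF z, of j] h'm[of j] hh'[of j] notD[of j] by (auto simp: g_def g'_def)
    qed
  qed
  moreover have "x \<le> y \<longleftrightarrow> g x \<le> g y" if x: "x \<in> grid 1 m" and y: "y \<in> grid 1 m" for x y
  proof
    assume "x \<le> y"
    then show "g x \<le> g y"
      by (auto simp: g_def le_fun_def)
  next
    assume gle: "g x \<le> g y"
    have "x i \<le> y i" if "i < m" for i
      using le_funD[OF gle, of "h i"] hD[OF that] h'h[OF that] by (auto simp: g_def D_def)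
    then show "x \<le> y"
      by (simp add: grid_le_iff[OF x y])
  qed
  ultimately have "\<exists>m g. bij_betw g (grid 1 m) {a..b} \<and>
        (\<forall>x\<in>grid 1 m. \<forall>y\<in>grid 1 m. x \<le> y \<longleftrightarrow> g x \<le> g y)"
    by blast
  moreover have "\<exists>c\<in>{a..b}. \<forall>x\<in>{a..b}. c \<le> x"
    using ab by (intro bexI[of _ a]) auto
  moreover have "\<exists>c\<in>{a..b}. \<forall>x\<in>{a..b}. x \<le> c"
    using ab by (intro bexI[of _ b]) auto
  moreover have "\<forall>x\<in>{a..b}. \<forall>z\<in>{a..b}. \<forall>y\<in>grid K n. x \<le> y \<longrightarrow> y \<le> z \<longrightarrow> y \<in> {a..b}"
    by (meson atLeastAtMost_iff order_trans)
  ultimately show ?thesis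
    unfolding boolean_interval_def using grid_interval[OF a b] by blast
qed

lemma boolean_interval_eq:
  assumes "boolean_interval (grid K n) I"
  obtains a b where "a \<in> grid K n" "b \<in> grid K n" "a \<le> b" "I = {a..b}"
proof -
  note bool = assms[unfolded boolean_interval_def]
  have "I \<subseteq> grid K n"
    using bool by (rule conjunct1)
  have conv: "\<forall>x\<in>I. \<forall>z\<in>I. \<forall>y\<in>grid K n. x \<le> y \<longrightarrow> y \<le> z \<longrightarrow> y \<in> I"
    using bool[THEN conjunct2] by (rule conjunct1)
  have "\<exists>a\<in>I. \<forall>x\<in>I. a \<le> x" "\<exists>b\<in>I. \<forall>x\<in>I. x \<le> b"
    using bool[THEN conjunct2, THEN conjunct2, THEN conjunct1]
      bool[THEN conjunct2, THEN conjunct2, THEN conjunct2, THEN conjunct1] .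
  then obtain a b where ab: "a \<in> I" "\<forall>x\<in>I. a \<le> x" "b \<in> I" "\<forall>x\<in>I. x \<le> b"
    by blast
  have g: "a \<in> grid K n" "b \<in> grid K n"
    using ab \<open>I \<subseteq> grid K n\<close> by auto
  have "I = {a..b}"
  proof (intro equalityI subsetI)
    fix y assume "y \<in> {a..b}"
    moreover then have "y \<in> grid K n"
      using grid_interval[OF g] by blast
    ultimately show "y \<in> I"
      using conv[rule_format, OF ab(1) ab(3), of y] by simp
  qed (use ab in simp)
  then show ?thesis
    by (rule that[OF g ab(2)[rule_format, OF ab(3)]])
qed

text \<open>Each coordinate is a monotone function of a single bit and so preserves minima and
  maxima. Injectivity of \<open>\<pi>\<close> lets the coordinates of an image point be chosen
  independently, so intervals go onto intervals.\<close>

lemma affine_in_sd2: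
  assumes \<sigma>: "cube_affine k 2 n \<sigma>"
  shows "\<sigma> \<in> cells (sd2_cube n) k"
proof -
  obtain \<pi> e where inj: "\<And>i j. i < n \<Longrightarrow> j < n \<Longrightarrow> \<pi> i < k \<Longrightarrow> \<pi> i = \<pi> j \<Longrightarrow> i = j"
    and eq: "\<And>x j. x \<in> grid 1 k \<Longrightarrow> j < n \<Longrightarrow> \<sigma> x j = e j + (if \<pi> j < k then x (\<pi> j) else 0)"
    using \<sigma> by (rule cube_affineE) blast
  note in2 = cube_affine_in[OF \<sigma>]
  have lat: "\<sigma> (inf x y) = inf (\<sigma> x) (\<sigma> y)" "\<sigma> (sup x y) = sup (\<sigma> x) (\<sigma> y)"
    if "x \<in> grid 1 k" "y \<in> grid 1 k" for x y
    using that inf_sup_grid[OF that] inf_sup_grid[OF in2 in2, of x y] in2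
    by (auto simp: eq inf_min sup_max intro!: grid_eqI[of _ 2 n])
  have bool: "boolean_interval (grid 2 n) (\<sigma> ` I)" if "boolean_interval (grid 1 k) I" for I
  proof -
    obtain a b where a: "a \<in> grid 1 k" and b: "b \<in> grid 1 k" and ab: "a \<le> b" and I: "I = {a..b}"
      using \<open>boolean_interval (grid 1 k) I\<close> by (rule boolean_interval_eq)
    have "\<sigma> ` I = {\<sigma> a..\<sigma> b}"
    proof (intro equalityI subsetI)
      fix z assume "z \<in> \<sigma> ` I"
      then obtain x where "x \<in> {a..b}" "z = \<sigma> x"
        using I by auto
      moreover then have "x \<in> grid 1 k"
        using grid_interval[OF a b] by blast
      ultimately show "z \<in> {\<sigma> a..\<sigma> b}"
        using a b cube_affine_mono(1)[OF \<sigma>] by auto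
    next
      fix z assume z: "z \<in> {\<sigma> a..\<sigma> b}"
      then have zab: "\<sigma> a j \<le> z j" "z j \<le> \<sigma> b j" for j
        by (auto simp: le_fun_def)
      \<comment> \<open>An input read by some output \<open>j\<close> is recovered from
        \<open>z j\<close>, unambiguously by injectivity. An input read by none may lie anywhere
        from \<open>a i\<close> to \<open>b i\<close>, and \<open>a i\<close> is taken.\<close>
      define x where "x = (\<lambda>i\<in>{..<k}. if \<exists>j<n. \<pi> j = i then z (SOME j. j < n \<and> \<pi> j = i) - e (SOME j. j < n \<and> \<pi> j = i) else a i)"
      have x1: "x (\<pi> j) = z j - e j" if "j < n" "\<pi> j < k" for j
      proof -
        have "(SOME l. l < n \<and> \<pi> l = \<pi> j) = j"
          using that inj by (intro some_equality) auto
        then show ?thesis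
          using that by (auto simp: x_def)
      qed
      have x2: "x i = a i" if "i < k" "\<not> (\<exists>j<n. \<pi> j = i)" for i
        using that by (auto simp: x_def)
      have ax: "a i \<le> x i \<and> x i \<le> b i" for i
      proof (cases "i < k")
        case True
        show ?thesis
        proof (cases "\<exists>j<n. \<pi> j = i")
          case True
          then obtain j where "j < n" "\<pi> j = i"
            by blast
          then show ?thesis
            using zab[of j] x1[of j] \<open>i < k\<close> by (auto simp: eq[OF a] eq[OF b])
        next
          case False
          then show ?thesis
            using x2 \<open>i < k\<close> le_funD[OF ab, of i] by auto
        qed
      next
        case False
        then show ?thesis
          using a b by (simp add: x_def grid_iff)
      qed
      then have xI: "x \<in> {a..b}"
        by (simp add: le_fun_def)
      then have xg: "x \<in> grid 1 k"
        using grid_interval[OF a b] by blast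
      have "\<sigma> x = z"
      proof (rule grid_eqI[of _ 2 n])
        show "\<sigma> x \<in> grid 2 n" "z \<in> grid 2 n"
          using in2 xg z grid_interval[OF in2[OF a] in2[OF b]] by auto
        fix j assume j: "j < n"
        show "\<sigma> x j = z j"
          using zab[of j] x1[of j] j by (auto simp: eq[OF xg] eq[OF a] eq[OF b] split: if_splits)
      qed
      then show "z \<in> \<sigma> ` I"
        using xI I by blast
    qed
    then show ?thesis
      using boolean_interval_grid[OF in2[OF a] in2[OF b] cube_affine_mono(1)[OF \<sigma> a b ab]]
        cube_affine_mono(2)[OF \<sigma> a b ab] by simp
  qed
  have "\<sigma> \<in> grid 1 k \<rightarrow>\<^sub>E grid 2 n"
    using \<sigma> by (simp add: cube_affine_def)
  then show ?thesis
    unfolding sd2_cube_def lattice_cset_def using lat bool by simp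
qed

lemma sd2_in: "\<sigma> \<in> cells (sd2_cube n) k \<Longrightarrow> \<sigma> \<in> grid 1 k \<rightarrow>\<^sub>E grid 2 n"
  by (simp add: sd2_cube_def lattice_cset_def)

lemma sd2_lattice:
  assumes "\<sigma> \<in> cells (sd2_cube n) k" "x \<in> grid 1 k" "y \<in> grid 1 k" "j < n"
  shows "\<sigma> (inf x y) j = min (\<sigma> x j) (\<sigma> y j)" "\<sigma> (sup x y) j = max (\<sigma> x j) (\<sigma> y j)"
  using assms by (auto simp: sd2_cube_def lattice_cset_def inf_min sup_max)

lemma sd2_mono:
  assumes "\<sigma> \<in> cells (sd2_cube n) k" "x \<in> grid 1 k" "y \<in> grid 1 k" "x \<le> y" "j < n"
  shows "\<sigma> x j \<le> \<sigma> y j"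
  using sd2_lattice(1)[OF assms(1-3,5)] assms(4) by (simp add: inf_absorb1)

lemma boolean_interval_whole: "boolean_interval (grid 1 n) (grid 1 n)"
proof -
  have "grid 1 n = {origin n..top_pt n}"
    using origin_le le_top_pt grid_interval[OF origin_in_grid top_pt_in_grid, of n]
    by (intro equalityI subsetI) auto
  moreover have "boolean_interval (grid 1 n) {origin n..top_pt n}"
    by (rule boolean_interval_grid[OF origin_in_grid top_pt_in_grid])
      (rule origin_le[OF top_pt_in_grid], simp add: top_pt_def)
  ultimately show ?thesis by simp
qed

text \<open>Applied to the whole cube, the condition on Boolean intervals makes the image of
  \<open>\<sigma>\<close> order convex.\<close>

lemma sd2_convex:
  assumes \<sigma>: "\<sigma> \<in> cells (sd2_cube n) k" and z: "z \<in> grid 2 n" "\<sigma> (origin k) \<le> z" "z \<le> \<sigma> (top_pt k)"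
  obtains x where "x \<in> grid 1 k" "\<sigma> x = z"
proof -
  have "boolean_interval (grid 2 n) (\<sigma> ` grid 1 k)"
    using \<sigma> boolean_interval_whole[of k] by (simp add: sd2_cube_def lattice_cset_def)
  then have "z \<in> \<sigma> ` grid 1 k"
    using z origin_in_grid[of k 1] top_pt_in_grid[of k] unfolding boolean_interval_def by blast
  then show ?thesis
    using that by blast
qed

text \<open>A coordinate of a lattice homomorphism out of $[1]^k$ takes values in a chain, so at most one
  unit vector can be mapped above the image of the origin.\<close>

lemma sd2_coordinate:
  assumes \<sigma>: "\<sigma> \<in> cells (sd2_cube n) k" and j: "j < n"
  obtains i where "\<And>x. x \<in> grid 1 k \<Longrightarrow> \<sigma> x j = (if i < k \<and> x i = 1 then \<sigma> (top_pt k) j else \<sigma> (origin k) j)"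
    and "i < k \<Longrightarrow> \<sigma> (origin k) j < \<sigma> (top_pt k) j"
proof -
  let ?u = "unit_vec k" and ?o = "origin k"
  note o = origin_in_grid[of k 1] and u = unit_vec_in_grid[of k]
  have trunc_in: "(\<lambda>i\<in>{..<k}. if i < p then x i else 0) \<in> grid 1 k" if "x \<in> grid 1 k" for p x
    using grid_leD[OF that] by (intro restrict_in_grid) auto
  \<comment> \<open>The point \<open>x\<close> is built from the origin by joining one unit vector
    at a time, and a join cannot move a coordinate that no unit vector moves.\<close>
  have const: "\<sigma> (\<lambda>i\<in>{..<k}. if i < p then x i else 0) j = \<sigma> ?o j"
    if none: "\<And>i. i < k \<Longrightarrow> \<sigma> (?u i) j = \<sigma> ?o j" and "p \<le> k" and x: "x \<in> grid 1 k" for p x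
    using \<open>p \<le> k\<close>
  proof (induction p)
    case 0
    then show ?case
      by (simp add: origin_def)
  next
    case (Suc p)
    let ?t = "\<lambda>p. \<lambda>i\<in>{..<k}. if i < p then x i else 0"
    consider "x p = 0" | "x p = 1"
      using grid_leD[OF x, of p] Suc.prems by linarith
    then show ?case
    proof cases
      case 1
      then have "?t (Suc p) = ?t p"
        by (intro restrict_ext) (auto simp: less_Suc_eq)
      then show ?thesis
        using Suc by simp
    next
      case 2
      then have "?t (Suc p) = sup (?t p) (?u p)"
        by (intro ext) (auto simp: sup_max unit_vec_def less_Suc_eq)
      then have "\<sigma> (?t (Suc p)) j = max (\<sigma> (?t p) j) (\<sigma> (?u p) j)"
        using sd2_lattice(2)[OF \<sigma> trunc_in[OF x] u j, of p p] by (simp only:)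
      then show ?thesis
        by (simp only: Suc.IH[OF Suc_leD[OF Suc.prems]] none[OF Suc_le_lessD[OF Suc.prems]] max.idem)
    qed
  qed
  show ?thesis
  proof (cases "\<exists>i<k. \<sigma> (?u i) j \<noteq> \<sigma> ?o j")
    case False
    have "\<sigma> x j = \<sigma> ?o j" if x: "x \<in> grid 1 k" for x
    proof -
      have "(\<lambda>i\<in>{..<k}. if i < k then x i else 0) = x"
        using x by (intro grid_eqI[OF trunc_in]) auto
      then show ?thesis
        using const[OF _ _ x, of k] False by auto
    qed
    \<comment> \<open>The out-of-range index \<open>k\<close> declares the coordinate
      constant.\<close>
    then show ?thesis
      by (intro that[of k]) auto
  next
    case True
    then obtain i where i: "i < k" "\<sigma> (?u i) j \<noteq> \<sigma> ?o j"
      by blast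
    then have gt: "\<sigma> ?o j < \<sigma> (?u i) j"
      using sd2_mono[OF \<sigma> o u origin_le[OF u] j, of i] by simp
    \<comment> \<open>A minimum of two numbers is one of them. As \<open>x\<close> and the unit
      vector meet in the origin and the value at the unit vector is too large, \<open>x\<close>
      takes the value of the origin.\<close>
    have low: "\<sigma> x j = \<sigma> ?o j" if x: "x \<in> grid 1 k" "x i = 0" for x
    proof -
      have "inf x (?u i) = ?o"
        using x by (intro grid_eqI[OF inf_sup_grid(1)[OF x(1) u] o]) (auto simp: inf_min unit_vec_def origin_def)
      then show ?thesis
        using sd2_lattice(1)[OF \<sigma> x(1) u j, of i] gt sd2_mono[OF \<sigma> o x(1) origin_le[OF x(1)] j] by simp
    qed
    \<comment> \<open>Here \<open>x\<close> is the join of the unit vector with a point whose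
      coordinate \<open>i\<close> is 0, where the value is already known to be the low one.\<close>
    have high: "\<sigma> x j = \<sigma> (?u i) j" if x: "x \<in> grid 1 k" "x i = 1" for x
    proof -
      let ?y = "\<lambda>l\<in>{..<k}. if l = i then 0 else x l"
      have y: "?y \<in> grid 1 k"
        using grid_leD[OF x(1)] by (intro restrict_in_grid) auto
      have "x = sup ?y (?u i)"
        using x by (intro grid_eqI[OF x(1) inf_sup_grid(2)[OF y u]]) (auto simp: sup_max unit_vec_def)
      then have "\<sigma> x j = max (\<sigma> ?y j) (\<sigma> (?u i) j)"
        using sd2_lattice(2)[OF \<sigma> y u j, of i] by simp
      then show ?thesis
        using low[OF y] i(1) gt by simp
    qed
    have top: "\<sigma> (top_pt k) j = \<sigma> (?u i) j"
      using high[OF top_pt_in_grid] i(1) by (simp add: top_pt_def)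
    show ?thesis
    proof (rule that[of i])
      fix x assume x: "x \<in> grid 1 k"
      show "\<sigma> x j = (if i < k \<and> x i = 1 then \<sigma> (top_pt k) j else \<sigma> ?o j)"
        using low[OF x] high[OF x] grid_leD[OF x i(1)] i(1) top by (auto simp: le_Suc_eq One_nat_def)
    qed (simp add: top gt)
  qed
qed

text \<open>What \<open>sd2_coordinate\<close> leaves open, slope 1 and injectivity of
  \<open>\<pi>\<close>, follows from convexity of the image: raising a non-constant coordinate of
  the lowest image point by 1 must give another image point.\<close>

lemma sd2_affine:
  assumes \<sigma>: "\<sigma> \<in> cells (sd2_cube n) k"
  shows "cube_affine k 2 n \<sigma>"
proof -
  let ?o = "origin k" and ?t = "top_pt k"
  note o = origin_in_grid[of k 1] and t = top_pt_in_grid[of k]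
  have \<sigma>o: "\<sigma> ?o \<in> grid 2 n" and \<sigma>t: "\<sigma> ?t \<in> grid 2 n"
    using sd2_in[OF \<sigma>] o t by auto
  have "\<exists>i. (\<forall>x\<in>grid 1 k. \<sigma> x j = (if i < k \<and> x i = 1 then \<sigma> ?t j else \<sigma> ?o j)) \<and>
      (i < k \<longrightarrow> \<sigma> ?o j < \<sigma> ?t j)" if "j < n" for j
    using sd2_coordinate[OF \<sigma> that] by metis
  then obtain \<pi> where \<pi>: "\<And>j x. j < n \<Longrightarrow> x \<in> grid 1 k \<Longrightarrow>
      \<sigma> x j = (if \<pi> j < k \<and> x (\<pi> j) = 1 then \<sigma> ?t j else \<sigma> ?o j)"
    and lt: "\<And>j. j < n \<Longrightarrow> \<pi> j < k \<Longrightarrow> \<sigma> ?o j < \<sigma> ?t j"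
    by (metis (no_types, lifting))
  have bump: "\<exists>x\<in>grid 1 k. \<sigma> x = (\<sigma> ?o)(j := \<sigma> ?o j + 1)" if j: "j < n" "\<pi> j < k" for j
  proof -
    have "(\<sigma> ?o)(j := \<sigma> ?o j + 1) \<in> grid 2 n"
      using lt[OF j] grid_leD[OF \<sigma>t j(1)] \<sigma>o j(1) by (auto simp: grid_iff)
    moreover have "\<sigma> ?o \<le> (\<sigma> ?o)(j := \<sigma> ?o j + 1)"
      by (simp add: le_fun_def)
    moreover have "\<sigma> ?o l \<le> \<sigma> ?t l" for l
      using sd2_mono[OF \<sigma> o t origin_le[OF t], of l] \<sigma>o \<sigma>t by (cases "l < n") (auto simp: grid_iff)
    then have "(\<sigma> ?o)(j := \<sigma> ?o j + 1) \<le> \<sigma> ?t"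
      using lt[OF j] by (simp add: le_fun_def)
    ultimately show ?thesis
      using sd2_convex[OF \<sigma>] by metis
  qed
  have step: "\<sigma> ?t j = \<sigma> ?o j + 1" if j: "j < n" "\<pi> j < k" for j
  proof -
    obtain x where "x \<in> grid 1 k" "\<sigma> x = (\<sigma> ?o)(j := \<sigma> ?o j + 1)"
      using bump[OF j] by blast
    then show ?thesis
      using \<pi>[OF j(1), of x] by (auto split: if_splits)
  qed
  show ?thesis
  proof (rule cube_affineI[where \<pi> = \<pi> and e = "\<sigma> ?o"])
    show "\<sigma> \<in> grid 1 k \<rightarrow>\<^sub>E grid 2 n"
      by (rule sd2_in[OF \<sigma>])
    \<comment> \<open>If outputs \<open>i\<close> and \<open>j\<close> read the same input, the
      point that raises output \<open>i\<close> alone has this input equal to 1, which raises output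
      \<open>j\<close> as well.\<close>
    fix i j assume ij: "i < n" "j < n" "\<pi> i < k" "\<pi> i = \<pi> j"
    then obtain x where x: "x \<in> grid 1 k" "\<sigma> x = (\<sigma> ?o)(i := \<sigma> ?o i + 1)"
      using bump by blast
    have "x (\<pi> j) = 1"
      using \<pi>[OF ij(1) x(1)] x(2) by (simp add: ij(4) split: if_splits)
    then have "\<sigma> x j = \<sigma> ?t j"
      using \<pi>[OF ij(2) x(1)] ij(3) by (simp add: ij(4))
    moreover have "\<sigma> ?o j < \<sigma> ?t j"
      using lt[OF ij(2)] ij(3) by (simp add: ij(4))
    ultimately show "i = j"
      using x(2) by (metis fun_upd_other nat_neq_iff)
  next
    fix x j assume x: "x \<in> grid 1 k" and j: "j < n"
    show "\<sigma> x j = \<sigma> ?o j + (if \<pi> j < k then x (\<pi> j) else 0)"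
      using \<pi>[OF j x] step[OF j] grid_leD[OF x, of "\<pi> j"] by (auto simp: le_Suc_eq One_nat_def)
  qed
qed

lemma sd2_cells_iff: "\<sigma> \<in> cells (sd2_cube n) k \<longleftrightarrow> cube_affine k 2 n \<sigma>"
  using sd2_affine affine_in_sd2 by blast

section \<open>Clamps, and canonical cubes of the subdivision\<close>

definition cube_clamp :: "nat \<Rightarrow> pt \<Rightarrow> pt \<Rightarrow> pt \<Rightarrow> pt" where
  "cube_clamp n a b = (\<lambda>x\<in>grid 1 n. \<lambda>i\<in>{..<n}. if a i = b i then a i else x i)"

text \<open>For \<open>a \<le> b\<close> the clamp maps the cube onto its face from \<open>a\<close>
  to \<open>b\<close>. Being an endomorphism of [1]^n, it reaches faces of all dimensions without
  renumbering coordinates.\<close>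

lemma box_cube_clamp:
  assumes a: "a \<in> grid 1 n"
  shows "box n n (cube_clamp n a b)"
proof -
  define C where "C p = (\<lambda>x\<in>grid 1 n. \<lambda>i\<in>{..<n}. if i < p \<and> a i = b i then a i else x i)" for p
  have C_in: "C p x \<in> grid 1 n" if "x \<in> grid 1 n" for p x
    unfolding C_def restrict_apply'[OF that]
  proof (rule restrict_in_grid)
    fix i assume "i < n"
    then show "(if i < p \<and> a i = b i then a i else x i) \<le> 1"
      using grid_leD[OF a, of i] grid_leD[OF that, of i] by (cases "i < p \<and> a i = b i") auto
  qed
  have "p \<le> n \<Longrightarrow> box n n (C p)" for p
  proof (induction p)
    case 0
    have "C 0 = restrict id (grid 1 n)"
      unfolding C_def by (intro restrict_ext) (auto simp: grid_iff restrict_def fun_eq_iff)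
    then show ?case
      by (simp only: box_id)
  next
    case (Suc p)
    show ?case
    proof (cases "a p = b p")
      case False
      then have "C (Suc p) = C p"
        unfolding C_def by (intro restrict_ext) (auto simp: less_Suc_eq)
      then show ?thesis
        using Suc by simp
    next
      case True
      obtain m where m: "n = Suc m"
        using Suc.prems by (cases n) auto
      \<comment> \<open>Forgetting coordinate \<open>p\<close> and inserting it again as the
        constant \<open>a p\<close> clamps one more coordinate.\<close>
      define F where "F = restrict (coface m p (a p) \<circ> codegeneracy m p) (grid 1 n)"
      have "box n n F"
        unfolding F_def m using Suc.prems m grid_leD[OF a, of p]
        by (intro box_comp[OF box_codegeneracy box_coface]) auto
      then have "box n n (restrict (F \<circ> C p) (grid 1 n))"
        using Suc by (intro box_comp) auto
      moreover have "F x = (\<lambda>i\<in>{..<n}. if i = p then a p else x i)" if "x \<in> grid 1 n" for x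
      proof -
        have "(\<lambda>j\<in>{..<m}. if j < p then x j else x (Suc j)) \<in> grid 1 m"
          using that m by (intro restrict_in_grid) (auto simp: grid_leD[of _ 1 n])
        then show ?thesis
          unfolding F_def using that m Suc.prems
          by (auto simp: coface_def codegeneracy_def fun_eq_iff restrict_def)
      qed
      then have "F (C p x) = C (Suc p) x" if "x \<in> grid 1 n" for x
        using C_in[OF that, of p] that True by (auto simp: C_def less_Suc_eq)
      then have "restrict (F \<circ> C p) (grid 1 n) = C (Suc p)"
        by (auto simp: fun_eq_iff restrict_def C_def)
      ultimately show ?thesis
        by simp
    qed
  qed
  moreover have "C n = cube_clamp n a b"
    unfolding C_def cube_clamp_def by (intro restrict_ext) auto
  ultimately show ?thesis
    by (metis order_refl)
qed

lemma cube_clamp_origin: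
  assumes "a \<in> grid 1 n" "b \<in> grid 1 n" "a \<le> b"
  shows "cube_clamp n a b (origin n) = a"
proof (rule grid_eqI)
  show "cube_clamp n a b (origin n) \<in> grid 1 n"
    by (rule cube_affine_in[OF box_affine[OF box_cube_clamp[OF assms(1)]] origin_in_grid])
  fix i assume "i < n"
  then show "cube_clamp n a b (origin n) i = a i"
    using origin_in_grid[of n 1] le_funD[OF assms(3), of i] grid_leD[OF assms(2), of i]
    by (simp add: cube_clamp_def origin_def)
qed (use assms in auto)

lemma cube_clamp_top:
  assumes "a \<in> grid 1 n" "b \<in> grid 1 n" "a \<le> b"
  shows "cube_clamp n a b (top_pt n) = b"
proof (rule grid_eqI)
  show "cube_clamp n a b (top_pt n) \<in> grid 1 n"
    by (rule cube_affine_in[OF box_affine[OF box_cube_clamp[OF assms(1)]] top_pt_in_grid])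
  fix i assume "i < n"
  then show "cube_clamp n a b (top_pt n) i = b i"
    using top_pt_in_grid[of n] le_funD[OF assms(3), of i] grid_leD[OF assms(2), of i]
    by (simp add: cube_clamp_def top_pt_def)
qed (use assms in auto)

text \<open>Not the covering relation of the order: it holds exactly when \<open>v \<le> w\<close>
  bound a Boolean interval of [2]^n, so that one cube of the subdivision has them as its extreme
  vertices.\<close>

definition covers :: "nat \<Rightarrow> pt \<Rightarrow> pt \<Rightarrow> bool" where
  "covers n v w \<longleftrightarrow> v \<in> grid 2 n \<and> w \<in> grid 2 n \<and> (\<forall>i<n. v i \<le> w i \<and> w i \<le> v i + 1)"

text \<open>The dimension is always \<open>n\<close>, with degenerate directions where the ends
  agree, so that the cube between two points is a function of these points.\<close>

definition diag_cube :: "nat \<Rightarrow> pt \<Rightarrow> pt \<Rightarrow> pt \<Rightarrow> pt" where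
  "diag_cube n v w = (\<lambda>x\<in>grid 1 n. \<lambda>i\<in>{..<n}. v i + (if v i = w i then 0 else x i))"

lemma diag_cube_affine:
  assumes "covers n v w"
  shows "cube_affine n 2 n (diag_cube n v w)"
proof (rule cube_affineI[where \<pi> = "\<lambda>i. if v i = w i then n else i" and e = v])
  show "diag_cube n v w \<in> grid 1 n \<rightarrow>\<^sub>E grid 2 n"
    unfolding diag_cube_def restrict_PiE_iff
  proof (intro ballI restrict_in_grid)
    fix x i assume "x \<in> grid 1 n" "i < n"
    then show "v i + (if v i = w i then 0 else x i) \<le> 2"
      using assms grid_leD[of x 1 n i] grid_leD[of w 2 n i] grid_leD[of v 2 n i]
      unfolding covers_def by (cases "v i = w i") (auto dest!: spec[of _ i])
  qed
qed (auto simp: diag_cube_def split: if_splits)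

lemma diag_cube_in_sd2: "covers n v w \<Longrightarrow> diag_cube n v w \<in> cells (sd2_cube n) n"
  by (simp add: sd2_cells_iff diag_cube_affine)

lemma diag_cube_in_grid: "covers n v w \<Longrightarrow> x \<in> grid 1 n \<Longrightarrow> diag_cube n v w x \<in> grid 2 n"
  by (rule cube_affine_in[OF diag_cube_affine])

lemma diag_cube_origin:
  assumes "covers n v w"
  shows "diag_cube n v w (origin n) = v"
proof (rule grid_eqI[OF diag_cube_in_grid[OF assms origin_in_grid]])
  show "v \<in> grid 2 n"
    using assms by (simp add: covers_def)
qed (use origin_in_grid[of n 1] in \<open>simp add: diag_cube_def, simp add: origin_def\<close>)

lemma diag_cube_top:
  assumes "covers n v w"
  shows "diag_cube n v w (top_pt n) = w"
proof (rule grid_eqI[OF diag_cube_in_grid[OF assms top_pt_in_grid]])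
  show "w \<in> grid 2 n"
    using assms by (simp add: covers_def)
  fix i assume "i < n"
  then have "v i \<le> w i" "w i \<le> v i + 1"
    using assms by (auto simp: covers_def)
  then show "diag_cube n v w (top_pt n) i = w i"
    using top_pt_in_grid[of n] \<open>i < n\<close> by (simp add: diag_cube_def) (simp add: top_pt_def)
qed

lemma diag_cube_covers:
  assumes "covers n v w" "a \<in> grid 1 n" "b \<in> grid 1 n" "a \<le> b"
  shows "covers n (diag_cube n v w a) (diag_cube n v w b)"
  unfolding covers_def
proof (intro conjI allI impI)
  fix i assume "i < n"
  then show "diag_cube n v w a i \<le> diag_cube n v w b i" "diag_cube n v w b i \<le> diag_cube n v w a i + 1"
    using assms le_funD[OF assms(4), of i] grid_leD[OF assms(3), of i] by (auto simp: diag_cube_def)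
qed (use assms diag_cube_in_grid in auto)

lemma diag_cube_clamp:
  assumes "covers n v w" "a \<in> grid 1 n" "b \<in> grid 1 n" "a \<le> b"
  shows "restrict (diag_cube n v w \<circ> cube_clamp n a b) (grid 1 n) = diag_cube n (diag_cube n v w a) (diag_cube n v w b)"
proof (rule extensionalityI[of _ "grid 1 n"])
  fix x assume x: "x \<in> grid 1 n"
  have c: "cube_clamp n a b x \<in> grid 1 n"
    by (rule cube_affine_in[OF box_affine[OF box_cube_clamp[OF assms(2)]] x])
  have "diag_cube n v w (cube_clamp n a b x) = diag_cube n (diag_cube n v w a) (diag_cube n v w b) x"
  proof (rule grid_eqI[OF diag_cube_in_grid[OF assms(1) c] diag_cube_in_grid[OF diag_cube_covers[OF assms] x]])
    fix i assume i: "i < n"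
    \<comment> \<open>Where \<open>a\<close> and \<open>b\<close> differ, both cubes start at
      \<open>v i\<close>, because \<open>a i\<close> is then 0; elsewhere both are constant.\<close>
    have "a i \<noteq> b i \<Longrightarrow> a i = 0"
      using le_funD[OF assms(4), of i] grid_leD[OF assms(3) i] by auto
    then show "diag_cube n v w (cube_clamp n a b x) i = diag_cube n (diag_cube n v w a) (diag_cube n v w b) x i"
      using x c assms(2,3) i by (simp add: diag_cube_def) (simp add: cube_clamp_def)
  qed
  then show "restrict (diag_cube n v w \<circ> cube_clamp n a b) (grid 1 n) x = diag_cube n (diag_cube n v w a) (diag_cube n v w b) x"
    using x by simp
qed (auto simp: diag_cube_def)

section \<open>The effect of morphisms on [2]^n\<close>

lemma sd2_pt_affine:
  assumes f: "cube_affine m 1 n f"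
  obtains \<pi> e where "\<And>i j. i < n \<Longrightarrow> j < n \<Longrightarrow> \<pi> i < m \<Longrightarrow> \<pi> i = \<pi> j \<Longrightarrow> i = j"
    and "\<And>x j. x \<in> grid 1 m \<Longrightarrow> j < n \<Longrightarrow> f x j = e j + (if \<pi> j < m then x (\<pi> j) else 0)"
    and "\<And>v j. v \<in> grid 2 m \<Longrightarrow> j < n \<Longrightarrow> sd2_pt m n f v j = 2 * e j + (if \<pi> j < m then v (\<pi> j) else 0)"
    and "\<And>j. j < n \<Longrightarrow> e j + (if \<pi> j < m then 1 else 0) \<le> 1"
proof -
  obtain \<pi> e where *: "\<And>i j. i < n \<Longrightarrow> j < n \<Longrightarrow> \<pi> i < m \<Longrightarrow> \<pi> i = \<pi> j \<Longrightarrow> i = j"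
    and eq: "\<And>x j. x \<in> grid 1 m \<Longrightarrow> j < n \<Longrightarrow> f x j = e j + (if \<pi> j < m then x (\<pi> j) else 0)"
    and le: "\<And>j. j < n \<Longrightarrow> e j + (if \<pi> j < m then 1 else 0) \<le> 1"
    using f by (rule cube_affineE) blast
  have "sd2_pt m n f v j = 2 * e j + (if \<pi> j < m then v (\<pi> j) else 0)"
    if v: "v \<in> grid 2 m" and j: "j < n" for v j
  proof -
    have "pt_chain m v p \<in> grid 1 m" if "p \<le> 1" for p
      using that by (auto simp: pt_chain_def intro!: restrict_in_grid)
    \<comment> \<open>The constant occurs at both ends of the chain, hence the factor 2; the two
      ends of the chain in coordinate \<open>\<pi> j\<close> add up to
      \<open>v (\<pi> j)\<close>.\<close>
    then have "sd2_pt m n f v j = 2 * e j + (if \<pi> j < m then pt_chain m v 0 (\<pi> j) + pt_chain m v 1 (\<pi> j) else 0)"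
      using j by (simp add: sd2_pt_def chain_pt_def eq)
    then show ?thesis
      using grid_leD[OF v, of "\<pi> j"] by (auto simp: pt_chain_def)
  qed
  with * eq le show ?thesis
    by (intro that[of \<pi> e]) auto
qed

lemma sd2_pt_in_grid:
  assumes f: "cube_affine m 1 n f" and v: "v \<in> grid 2 m"
  shows "sd2_pt m n f v \<in> grid 2 n"
proof -
  obtain \<pi> e where eq: "\<And>v j. v \<in> grid 2 m \<Longrightarrow> j < n \<Longrightarrow> sd2_pt m n f v j = 2 * e j + (if \<pi> j < m then v (\<pi> j) else 0)"
    and le: "\<And>j. j < n \<Longrightarrow> e j + (if \<pi> j < m then 1 else 0) \<le> 1"
    using f by (rule sd2_pt_affine) blast
  have "(\<lambda>j\<in>{..<n}. sd2_pt m n f v j) \<in> grid 2 n"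
  proof (rule restrict_in_grid)
    fix j assume "j < n"
    then show "sd2_pt m n f v j \<le> 2"
      using le[of j] grid_leD[OF v, of "\<pi> j"] by (auto simp: eq[OF v] split: if_splits)
  qed
  moreover have "(\<lambda>j\<in>{..<n}. sd2_pt m n f v j) = sd2_pt m n f v"
    by (auto simp: sd2_pt_def chain_pt_def fun_eq_iff)
  ultimately show ?thesis by simp
qed

lemma sd2_pt_comp_affine:
  assumes f: "cube_affine m 1 n f" and \<sigma>: "cube_affine k 2 m \<sigma>"
  shows "cube_affine k 2 n (restrict (sd2_pt m n f \<circ> \<sigma>) (grid 1 k))"
proof -
  obtain \<pi> e where inj: "\<And>i j. i < n \<Longrightarrow> j < n \<Longrightarrow> \<pi> i < m \<Longrightarrow> \<pi> i = \<pi> j \<Longrightarrow> i = j"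
    and eq: "\<And>v j. v \<in> grid 2 m \<Longrightarrow> j < n \<Longrightarrow> sd2_pt m n f v j = 2 * e j + (if \<pi> j < m then v (\<pi> j) else 0)"
    using f by (rule sd2_pt_affine) blast
  obtain \<rho> d where inj': "\<And>i j. i < m \<Longrightarrow> j < m \<Longrightarrow> \<rho> i < k \<Longrightarrow> \<rho> i = \<rho> j \<Longrightarrow> i = j"
    and eq': "\<And>x j. x \<in> grid 1 k \<Longrightarrow> j < m \<Longrightarrow> \<sigma> x j = d j + (if \<rho> j < k then x (\<rho> j) else 0)"
    using \<sigma> by (rule cube_affineE) blast
  show ?thesis
  \<comment> \<open>As in \<open>cube_affine_comp\<close>, but with the constants of
    \<open>f\<close> doubled.\<close>
  proof (rule cube_affineI[where \<pi> = "\<lambda>j. if \<pi> j < m then \<rho> (\<pi> j) else k"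
        and e = "\<lambda>j. 2 * e j + (if \<pi> j < m then d (\<pi> j) else 0)"])
    show "restrict (sd2_pt m n f \<circ> \<sigma>) (grid 1 k) \<in> grid 1 k \<rightarrow>\<^sub>E grid 2 n"
      using cube_affine_in[OF \<sigma>] sd2_pt_in_grid[OF f] by auto
    show "i = j" if "i < n" "j < n" "(if \<pi> i < m then \<rho> (\<pi> i) else k) < k"
      "(if \<pi> i < m then \<rho> (\<pi> i) else k) = (if \<pi> j < m then \<rho> (\<pi> j) else k)" for i j
      using that inj[of i j] inj'[of "\<pi> i" "\<pi> j"] by (auto split: if_splits)
    show "restrict (sd2_pt m n f \<circ> \<sigma>) (grid 1 k) x j = 2 * e j + (if \<pi> j < m then d (\<pi> j) else 0) +
        (if (if \<pi> j < m then \<rho> (\<pi> j) else k) < k then x (if \<pi> j < m then \<rho> (\<pi> j) else k) else 0)"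
      if "x \<in> grid 1 k" "j < n" for x j
      using that eq[OF cube_affine_in[OF \<sigma>], of x j] eq'[of x "\<pi> j"] by auto
  qed
qed

lemma sd2_pt_covers:
  assumes f: "cube_affine m 1 n f" and vw: "covers m v w"
  shows "covers n (sd2_pt m n f v) (sd2_pt m n f w)"
proof -
  have v: "v \<in> grid 2 m" and w: "w \<in> grid 2 m"
    using vw by (auto simp: covers_def)
  obtain \<pi> e where eq: "\<And>v j. v \<in> grid 2 m \<Longrightarrow> j < n \<Longrightarrow> sd2_pt m n f v j = 2 * e j + (if \<pi> j < m then v (\<pi> j) else 0)"
    using f by (rule sd2_pt_affine) blast
  show ?thesis
    using vw sd2_pt_in_grid[OF f] by (auto simp: covers_def eq[OF v] eq[OF w])
qed

text \<open>This equation moves a morphism from the points of the subdivided cube to the parameters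
  of a canonical cube; \<open>sub_act_ex2\<close> rests on it.\<close>

lemma sd2_pt_diag_cube:
  assumes f: "cube_affine m 1 n f" and vw: "covers m v w"
  shows "restrict (sd2_pt m n f \<circ> diag_cube m v w) (grid 1 m) =
         restrict (diag_cube n (sd2_pt m n f v) (sd2_pt m n f w) \<circ> f) (grid 1 m)"
proof (rule restrict_ext)
  fix x assume x: "x \<in> grid 1 m"
  have v: "v \<in> grid 2 m" and w: "w \<in> grid 2 m"
    using vw by (auto simp: covers_def)
  obtain \<pi> e where eq: "\<And>v j. v \<in> grid 2 m \<Longrightarrow> j < n \<Longrightarrow> sd2_pt m n f v j = 2 * e j + (if \<pi> j < m then v (\<pi> j) else 0)"
    and eq': "\<And>x j. x \<in> grid 1 m \<Longrightarrow> j < n \<Longrightarrow> f x j = e j + (if \<pi> j < m then x (\<pi> j) else 0)"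
    and le: "\<And>j. j < n \<Longrightarrow> e j + (if \<pi> j < m then 1 else 0) \<le> 1"
    using f by (rule sd2_pt_affine) blast
  note s = diag_cube_in_grid[OF vw x] and fx = cube_affine_in[OF f x]
  have "sd2_pt m n f (diag_cube m v w x) = diag_cube n (sd2_pt m n f v) (sd2_pt m n f w) (f x)"
  proof (rule grid_eqI[OF sd2_pt_in_grid[OF f s] diag_cube_in_grid[OF sd2_pt_covers[OF f vw] fx]])
    fix j assume j: "j < n"
    \<comment> \<open>A coordinate that follows an input has constant 0. Otherwise the constant
      would be counted once more on the right, in \<open>f x\<close>.\<close>
    have "e j = 0" if "\<pi> j < m"
      using le[OF j] that by simp
    then show "sd2_pt m n f (diag_cube m v w x) j = diag_cube n (sd2_pt m n f v) (sd2_pt m n f w) (f x) j"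
      unfolding eq[OF s j] using j x fx by (auto simp: diag_cube_def eq[OF v] eq[OF w] eq'[OF x])
  qed
  then show "(sd2_pt m n f \<circ> diag_cube m v w) x = (diag_cube n (sd2_pt m n f v) (sd2_pt m n f w) \<circ> f) x"
    by simp
qed

lemma diag_cube_sd2_pt_ends:
  assumes f: "cube_affine m 1 n f" and vw: "covers m v w"
  shows "diag_cube n (sd2_pt m n f v) (sd2_pt m n f w) (f (origin m)) = sd2_pt m n f v"
    and "diag_cube n (sd2_pt m n f v) (sd2_pt m n f w) (f (top_pt m)) = sd2_pt m n f w"
proof -
  have "restrict (sd2_pt m n f \<circ> diag_cube m v w) (grid 1 m) x =
      restrict (diag_cube n (sd2_pt m n f v) (sd2_pt m n f w) \<circ> f) (grid 1 m) x" for x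
    using sd2_pt_diag_cube[OF assms] by simp
  from this[of "origin m"] this[of "top_pt m"]
  show "diag_cube n (sd2_pt m n f v) (sd2_pt m n f w) (f (origin m)) = sd2_pt m n f v"
    and "diag_cube n (sd2_pt m n f v) (sd2_pt m n f w) (f (top_pt m)) = sd2_pt m n f w"
    using diag_cube_origin[OF vw] diag_cube_top[OF vw] origin_in_grid[of m 1] top_pt_in_grid[of m] by simp_all
qed

text \<open>As a point of $[2]^n$ the sum stands for the midpoint, because \<open>phi2\<close> halves the coordinates.\<close>

definition midpt :: "nat \<Rightarrow> pt \<Rightarrow> pt \<Rightarrow> pt" where
  "midpt n x y = (\<lambda>i\<in>{..<n}. x i + y i)"

lemma midpt_covers:
  assumes "x \<in> grid 1 n" "y \<in> grid 1 n" "x' \<in> grid 1 n" "y' \<in> grid 1 n"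
    and "x \<le> x'" "y \<le> y'" "\<And>i. i < n \<Longrightarrow> x' i + y' i \<le> x i + y i + 1"
  shows "covers n (midpt n x y) (midpt n x' y')"
  unfolding covers_def midpt_def
proof (intro conjI allI impI restrict_in_grid)
  fix i assume i: "i < n"
  show "x i + y i \<le> 2" "x' i + y' i \<le> 2"
    using assms(1-4)[THEN grid_leD, OF i] by linarith+
qed (use assms in \<open>auto simp: le_fun_def intro: add_mono\<close>)

text \<open>The constant that \<open>sd2_pt\<close> doubles is the sum of the constants in
  \<open>f x\<close> and \<open>f y\<close>. Naturality of \<open>nerve_eval\<close> in the cube
  depends on this.\<close>

lemma sd2_pt_midpt:
  assumes f: "cube_affine m 1 n f" and x: "x \<in> grid 1 m" and y: "y \<in> grid 1 m"
  shows "sd2_pt m n f (midpt m x y) = midpt n (f x) (f y)"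
proof -
  obtain \<pi> e where eq: "\<And>v j. v \<in> grid 2 m \<Longrightarrow> j < n \<Longrightarrow> sd2_pt m n f v j = 2 * e j + (if \<pi> j < m then v (\<pi> j) else 0)"
    and eq': "\<And>x j. x \<in> grid 1 m \<Longrightarrow> j < n \<Longrightarrow> f x j = e j + (if \<pi> j < m then x (\<pi> j) else 0)"
    using f by (rule sd2_pt_affine) blast
  have m: "midpt m x y \<in> grid 2 m"
    unfolding midpt_def using grid_leD[OF x] grid_leD[OF y] by (intro restrict_in_grid) fastforce
  have "midpt n (f x) (f y) \<in> grid 2 n"
    unfolding midpt_def using grid_leD[OF cube_affine_in[OF f x]] grid_leD[OF cube_affine_in[OF f y]]
    by (intro restrict_in_grid) fastforce
  with sd2_pt_in_grid[OF f m] show ?thesis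
    by (rule grid_eqI) (unfold eq[OF m], auto simp: midpt_def eq'[OF x] eq'[OF y])
qed

text \<open>The denominator \<open>K\<close> is 1 for realizations of morphisms of the cube category and 2 for the cells
  of a subdivision.\<close>

lemma affine_stream_map:
  assumes \<tau>: "cube_affine k K n \<tau>" and K: "K > 0"
  shows "(\<lambda>t\<in>cube k. \<lambda>j\<in>{..<n}. lin k n \<tau> t j / real K) \<in> stream_maps (cube_stream k) (cube_stream n)"
    (is "?g \<in> _")
proof -
  obtain \<pi> e where lin: "\<And>t j. t \<in> cube k \<Longrightarrow> j < n \<Longrightarrow> lin k n \<tau> t j = real (e j) + (if \<pi> j < k then t (\<pi> j) else 0)"
    and le: "\<And>j. j < n \<Longrightarrow> e j + (if \<pi> j < k then 1 else 0) \<le> K"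
    using \<tau> by (rule cube_affineE) blast
  \<comment> \<open>A coordinate that follows an input satisfies \<open>e j + 1 \<le> K\<close>,
    which keeps the quotient at most 1.\<close>
  have bounds: "0 \<le> lin k n \<tau> t j / real K \<and> lin k n \<tau> t j / real K \<le> 1" if "t \<in> cube k" "j < n" for t j
  proof -
    have "real (e j) + (if \<pi> j < k then 1 else 0) \<le> real K"
      using le[OF that(2)] by (simp flip: of_nat_Suc split: if_splits)
    moreover have "0 \<le> t (\<pi> j) \<and> t (\<pi> j) \<le> 1" if "\<pi> j < k"
      using \<open>t \<in> cube k\<close> that by (simp add: cube_eq PiE_iff)
    ultimately have "0 \<le> lin k n \<tau> t j \<and> lin k n \<tau> t j \<le> real K"
      using that by (auto simp: lin split: if_splits)
    then show ?thesis
      using K by (simp add: divide_simps)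
  qed
  have g_in: "?g t \<in> cube n" if "t \<in> cube k" for t
    using bounds[OF that] that by (simp add: cube_iff)
  have coord: "continuous_map (cube_top k) euclideanreal (\<lambda>t. lin k n \<tau> t j / real K)" if j: "j < n" for j
  proof (rule continuous_map_eq)
    show "continuous_map (cube_top k) euclideanreal (\<lambda>t. (real (e j) + (if \<pi> j < k then t (\<pi> j) else 0)) / real K)"
    proof (cases "\<pi> j < k")
      case True
      have "continuous_map (cube_top k) (top_of_set {0..1}) (\<lambda>t. t (\<pi> j))"
        unfolding cube_top_def using True by (intro continuous_map_product_projection) simp
      moreover have "continuous_map (top_of_set {0..1}) euclideanreal (\<lambda>s. (real (e j) + s) / real K)"
        using K by (intro continuous_intros | simp)+
      ultimately have "continuous_map (cube_top k) euclideanreal ((\<lambda>s. (real (e j) + s) / real K) \<circ> (\<lambda>t. t (\<pi> j)))"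
        by (rule continuous_map_compose)
      then show ?thesis
        using True by (simp add: o_def)
    qed simp
  qed (simp add: lin j)
  have "continuous_map (cube_top k) (cube_top n) ?g"
    unfolding cube_top_def[of n] continuous_map_componentwise
  proof (intro conjI ballI)
    show "?g ` cube k \<subseteq> extensional {..<n}"
      by auto
    fix j assume j: "j \<in> {..<n}"
    show "continuous_map (cube_top k) (top_of_set {0..1}) (\<lambda>t. ?g t j)"
    proof (rule continuous_map_into_subtopology)
      show "continuous_map (cube_top k) euclideanreal (\<lambda>t. ?g t j)"
        by (rule continuous_map_eq[OF coord]) (use j in auto)
    qed (use j bounds in auto)
  qed
  moreover have "?g x \<le> ?g y" if xy: "x \<in> cube k" "y \<in> cube k" "x \<le> y" for x y
  proof -
    have "lin k n \<tau> x j / real K \<le> lin k n \<tau> y j / real K" if "j < n" for j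
      using that xy le_funD[OF xy(3), of "\<pi> j"] by (simp add: lin divide_right_mono)
    then show ?thesis
      using cube_le_iff[OF g_in[OF xy(1)] g_in[OF xy(2)]] xy by simp
  qed
  ultimately show ?thesis
    by (simp add: stream_maps_cube_iff)
qed

lemma lin_stream_map:
  assumes "box m n f"
  shows "lin m n f \<in> stream_maps (cube_stream m) (cube_stream n)"
proof -
  have "lin m n f = (\<lambda>t\<in>cube m. \<lambda>j\<in>{..<n}. lin m n f t j / real 1)"
    by (auto simp: lin_def fun_eq_iff)
  then show ?thesis
    using affine_stream_map[OF box_affine[OF assms]] by simp
qed

lemma stream_map_in:
  "\<theta> \<in> stream_maps (cube_stream m) (cube_stream n) \<Longrightarrow> t \<in> cube m \<Longrightarrow> \<theta> t \<in> cube n"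
  unfolding stream_maps_cube_iff using continuous_map_funspace by blast

lemma stream_map_mono:
  "\<theta> \<in> stream_maps (cube_stream m) (cube_stream n) \<Longrightarrow> x \<in> cube m \<Longrightarrow> y \<in> cube m \<Longrightarrow> x \<le> y \<Longrightarrow> \<theta> x \<le> \<theta> y"
  unfolding stream_maps_cube_iff by blast

lemma stream_map_comp:
  assumes "\<theta> \<in> stream_maps (cube_stream l) (cube_stream m)"
    and "\<eta> \<in> stream_maps (cube_stream m) (cube_stream n)"
  shows "restrict (\<eta> \<circ> \<theta>) (cube l) \<in> stream_maps (cube_stream l) (cube_stream n)"
proof -
  have "continuous_map (cube_top l) (cube_top n) (\<eta> \<circ> \<theta>)"
    by (rule continuous_map_compose[of _ "cube_top m"]) (use assms in \<open>simp_all add: stream_maps_cube_iff\<close>)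
  then have "continuous_map (cube_top l) (cube_top n) (restrict (\<eta> \<circ> \<theta>) (cube l))"
    by (rule continuous_map_eq) simp
  moreover have "\<eta> (\<theta> x) \<le> \<eta> (\<theta> y)" if "x \<in> cube l" "y \<in> cube l" "x \<le> y" for x y
    by (intro stream_map_mono[OF assms(2)] stream_map_in[OF assms(1)] stream_map_mono[OF assms(1)] that)
  ultimately show ?thesis
    by (simp add: stream_maps_cube_iff)
qed

lemma lin_in_cube: "box m n f \<Longrightarrow> t \<in> cube m \<Longrightarrow> lin m n f t \<in> cube n"
  using lin_stream_map stream_map_in by blast

text \<open>As \<open>lin\<close> depends on a map through the origin and the unit vectors alone,
  compatibility with composition rests on the affine form of both maps. That \<open>f\<close> is a
  morphism of the cube category keeps the intermediate point inside the cube.\<close>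

lemma lin_comp:
  assumes f: "box l m f" and g: "cube_affine m K n g" and t: "t \<in> cube l"
  shows "lin l n (restrict (g \<circ> f) (grid 1 l)) t = lin m n g (lin l m f t)"
proof
  obtain \<pi> e where fe: "\<And>x j. x \<in> grid 1 l \<Longrightarrow> j < m \<Longrightarrow> f x j = e j + (if \<pi> j < l then x (\<pi> j) else 0)"
    and lf: "\<And>t j. t \<in> cube l \<Longrightarrow> j < m \<Longrightarrow> lin l m f t j = real (e j) + (if \<pi> j < l then t (\<pi> j) else 0)"
    using box_affine[OF f] by (rule cube_affineE) blast
  obtain \<rho> d where gd: "\<And>x j. x \<in> grid 1 m \<Longrightarrow> j < n \<Longrightarrow> g x j = d j + (if \<rho> j < m then x (\<rho> j) else 0)"
    and lg: "\<And>t j. t \<in> cube m \<Longrightarrow> j < n \<Longrightarrow> lin m n g t j = real (d j) + (if \<rho> j < m then t (\<rho> j) else 0)"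
    using g by (rule cube_affineE) blast
  fix j
  show "lin l n (restrict (g \<circ> f) (grid 1 l)) t j = lin m n g (lin l m f t) j"
  proof (cases "j < n")
    case True
    have "lin l n (restrict (g \<circ> f) (grid 1 l)) t j =
        real (d j + (if \<rho> j < m then e (\<rho> j) else 0)) +
        (if (if \<rho> j < m then \<pi> (\<rho> j) else l) < l then t (if \<rho> j < m then \<pi> (\<rho> j) else l) else 0)"
    proof (rule lin_affine[OF _ t True])
      fix x assume "x \<in> grid 1 l"
      then show "restrict (g \<circ> f) (grid 1 l) x j = d j + (if \<rho> j < m then e (\<rho> j) else 0) +
          (if (if \<rho> j < m then \<pi> (\<rho> j) else l) < l then x (if \<rho> j < m then \<pi> (\<rho> j) else l) else 0)"
        using True cube_affine_in[OF box_affine[OF f]] by (simp add: gd fe)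
    qed
    also have "\<dots> = lin m n g (lin l m f t) j"
      using True lin_in_cube[OF f t] t by (simp add: lg lf)
    finally show ?thesis .
  next
    case False
    then show ?thesis
      using lin_in_cube[OF f t] t by (simp add: lin_def)
  qed
qed

section \<open>Vertices and rounding\<close>

definition vertex :: "nat \<Rightarrow> pt \<Rightarrow> rpt" where
  "vertex k x = (\<lambda>i\<in>{..<k}. real (x i))"

lemma vertex_in_cube: "x \<in> grid 1 k \<Longrightarrow> vertex k x \<in> cube k"
  using grid_leD[of x 1 k] by (force simp: vertex_def cube_iff)

lemma vertex_mono: "x \<le> y \<Longrightarrow> vertex k x \<le> vertex k y"
  by (auto simp: vertex_def le_fun_def)

lemma lin_vertex:
  assumes "cube_affine k K n \<tau>" "x \<in> grid 1 k"
  shows "lin k n \<tau> (vertex k x) = vertex n (\<tau> x)"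
proof
  obtain \<pi> e where "\<And>x j. x \<in> grid 1 k \<Longrightarrow> j < n \<Longrightarrow> \<tau> x j = e j + (if \<pi> j < k then x (\<pi> j) else 0)"
    and "\<And>t j. t \<in> cube k \<Longrightarrow> j < n \<Longrightarrow> lin k n \<tau> t j = real (e j) + (if \<pi> j < k then t (\<pi> j) else 0)"
    using assms(1) by (rule cube_affineE) blast
  note * = this(1)[OF assms(2)] this(2)[OF vertex_in_cube[OF assms(2)]]
  fix j
  show "lin k n \<tau> (vertex k x) j = vertex n (\<tau> x) j"
  proof (cases "j < n")
    case True
    then show ?thesis
      unfolding *(2)[OF True] by (simp add: vertex_def *(1))
  qed (simp add: lin_def vertex_in_cube[OF assms(2)] vertex_def[of n])
qed

text \<open>Any monotone retraction of $[0,1]$ onto $\{0,1\}$ would do in place of rounding.\<close>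

definition round_pt :: "nat \<Rightarrow> rpt \<Rightarrow> pt" where
  "round_pt n t = (\<lambda>i\<in>{..<n}. if 1 / 2 \<le> t i then 1 else 0)"

lemma round_pt_in_grid: "round_pt n t \<in> grid 1 n"
  by (simp add: round_pt_def restrict_in_grid)

lemma round_pt_mono: "s \<le> t \<Longrightarrow> round_pt n s \<le> round_pt n t"
  by (auto simp: round_pt_def le_fun_def intro: order_trans)

lemma round_vertex: "x \<in> grid 1 n \<Longrightarrow> round_pt n (vertex n x) = x"
  by (rule grid_eqI[OF round_pt_in_grid]) (auto simp: round_pt_def vertex_def dest: grid_leD)

text \<open>Each output coordinate is an input coordinate or a constant 0 or 1, and rounding fixes
  these constants. The identity makes the retraction well defined on the coend.\<close>

lemma round_lin:
  assumes f: "box m n f" and t: "t \<in> cube m"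
  shows "round_pt n (lin m n f t) = f (round_pt m t)"
proof (rule grid_eqI[OF round_pt_in_grid cube_affine_in[OF box_affine[OF f] round_pt_in_grid]])
  obtain \<pi> e where fe: "\<And>x j. x \<in> grid 1 m \<Longrightarrow> j < n \<Longrightarrow> f x j = e j + (if \<pi> j < m then x (\<pi> j) else 0)"
    and lf: "\<And>t j. t \<in> cube m \<Longrightarrow> j < n \<Longrightarrow> lin m n f t j = real (e j) + (if \<pi> j < m then t (\<pi> j) else 0)"
    and le: "\<And>j. j < n \<Longrightarrow> e j + (if \<pi> j < m then 1 else 0) \<le> 1"
    using box_affine[OF f] by (rule cube_affineE) blast
  fix j assume j: "j < n"
  have "e j = 0 \<or> e j = 1 \<and> \<not> \<pi> j < m"
    using le[OF j] by (cases "\<pi> j < m") (simp, linarith)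
  then consider "e j = 0" "\<pi> j < m" | "e j = 0" "\<not> \<pi> j < m" | "e j = 1" "\<not> \<pi> j < m"
    by (elim disjE conjE; cases "\<pi> j < m"; assumption?)
  then show "round_pt n (lin m n f t) j = f (round_pt m t) j"
    unfolding fe[OF round_pt_in_grid j] using j by cases (auto simp: lf[OF t] round_pt_def)
qed

section \<open>Coends\<close>

lemma coend_step_in:
  assumes "cubical_set C" and "\<And>m n f x. box m n f \<Longrightarrow> x \<in> F m \<Longrightarrow> A m n f x \<in> F n"
    and "(z, z') \<in> coend_step C F A"
  shows "z \<in> coend_pairs C F" "z' \<in> coend_pairs C F"
proof -
  obtain m n f c x where "z = (m, act C m n f c, x)" "z' = (n, c, A m n f x)"
    and "box m n f" "c \<in> cells C n" "x \<in> F m"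
    using assms(3) unfolding coend_step_def by blast
  moreover from this have "act C m n f c \<in> cells C m"
    using assms(1) unfolding cubical_set_def by blast
  ultimately show "z \<in> coend_pairs C F" "z' \<in> coend_pairs C F"
    using assms(2) by (auto simp: coend_pairs_def)
qed

lemma equiv_coend_rel: "equiv (coend_pairs C F) (coend_rel C F A)"
proof (rule equivI)
  let ?R = "coend_step C F A \<union> (coend_step C F A)\<inverse>"
  have "sym (?R\<^sup>*)"
    by (intro sym_rtrancl sym_Un_converse)
  then show "sym (coend_rel C F A)"
    unfolding coend_rel_def sym_def by blast
  have "trans (?R\<^sup>*)"
    by (rule trans_rtrancl)
  then show "trans (coend_rel C F A)"
    unfolding coend_rel_def trans_def by blast
qed (auto simp: coend_rel_def refl_on_def)

lemma coend_class_in: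
  "c \<in> cells C n \<Longrightarrow> x \<in> F n \<Longrightarrow> coend_class C F A (n, c, x) \<in> coend C F A"
  by (auto simp: coend_def coend_class_def coend_pairs_def intro!: quotientI)

lemma coend_cases:
  assumes "p \<in> coend C F A"
  obtains n c x where "c \<in> cells C n" "x \<in> F n" "p = coend_class C F A (n, c, x)"
  using assms unfolding coend_def by (auto elim!: quotientE simp: coend_class_def coend_pairs_def)

lemma coend_class_eq:
  assumes "cubical_set C" and "\<And>m n f x. box m n f \<Longrightarrow> x \<in> F m \<Longrightarrow> A m n f x \<in> F n"
    and "box m n f" "c \<in> cells C n" "x \<in> F m"
  shows "coend_class C F A (m, act C m n f c, x) = coend_class C F A (n, c, A m n f x)"
proof -
  have "((m, act C m n f c, x), (n, c, A m n f x)) \<in> coend_step C F A"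
    using assms(3-5) unfolding coend_step_def by blast
  moreover note coend_step_in[OF assms(1,2) this]
  ultimately have "((m, act C m n f c, x), (n, c, A m n f x)) \<in> coend_rel C F A"
    unfolding coend_rel_def by blast
  then show ?thesis
    unfolding coend_class_def by (rule equiv_class_eq[OF equiv_coend_rel])
qed

text \<open>A function that respects the generating steps is constant along zigzags, so the image of
  a class is a singleton, as \<open>the_elem\<close> requires.\<close>

lemma coend_lift_class:
  assumes inv: "\<And>m n f c x. box m n f \<Longrightarrow> c \<in> cells C n \<Longrightarrow> x \<in> F m \<Longrightarrow>
      g m (act C m n f c) x = g n c (A m n f x)"
    and "c \<in> cells C n" "x \<in> F n"
  shows "coend_lift g (coend_class C F A (n, c, x)) = g n c x"
proof -
  let ?g = "\<lambda>(n, c, x). g n c x"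
  have "?g z = ?g (n, c, x)"
    if "((n, c, x), z) \<in> (coend_step C F A \<union> (coend_step C F A)\<inverse>)\<^sup>*" for z
    using that
  proof induction
    case (step y z)
    have "?g y = ?g z"
      using step.hyps(2) inv by (auto simp: coend_step_def)
    with step.IH show ?case by simp
  qed simp
  then have "?g ` coend_class C F A (n, c, x) \<subseteq> {g n c x}"
    unfolding coend_class_def coend_rel_def by auto
  moreover have "(n, c, x) \<in> coend_class C F A (n, c, x)"
    using assms(2,3) equiv_class_self[OF equiv_coend_rel, of "(n, c, x)" C F A]
    by (simp add: coend_class_def coend_pairs_def)
  then have "g n c x \<in> ?g ` coend_class C F A (n, c, x)"
    by (force intro: image_eqI)
  ultimately have "?g ` coend_class C F A (n, c, x) = {g n c x}"
    by blast
  then show ?thesis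
    by (simp add: coend_lift_def)
qed

text \<open>The preimage of the whole coend in each cube is everything, so the whole coend is open
  in the final topology.\<close>

lemma points_realization: "points (realization C) = coend C cube lin"
proof -
  have op: "openin (top_of (realization C)) U \<longleftrightarrow> realization_open C U" for U
    by (simp add: realization_def topology_inverse'[OF istopology_realization_open])
  have "realization_open C (coend C cube lin)"
    unfolding realization_open_def
  proof (intro conjI allI ballI)
    fix n c assume "c \<in> cells C n"
    then have "{t \<in> cube n. realization_point C n c t \<in> coend C cube lin} = cube n"
      by (auto simp: realization_point_def coend_class_in top_of_cube_stream)
    then show "openin (top_of (cube_stream n)) {t \<in> points (cube_stream n). realization_point C n c t \<in> coend C cube lin}"
      by (simp add: top_of_cube_stream)
  qed (simp add: top_of_cube_stream)
  moreover have "U \<subseteq> coend C cube lin" if "realization_open C U" for U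
    using that by (simp add: realization_open_def top_of_cube_stream)
  ultimately show ?thesis
    unfolding topspace_def op by blast
qed

text \<open>The affine formulas on the cells fit together along faces and degeneracies by
  \<open>lin_comp\<close>, which is the invariance that \<open>coend_lift_class\<close> asks
  for.\<close>

lemma phi2_point:
  assumes \<sigma>: "\<sigma> \<in> cells (sd2_cube n) k" and t: "t \<in> cube k"
  shows "phi2 n (realization_point (sd2_cube n) k \<sigma> t) = (\<lambda>j\<in>{..<n}. lin k n \<sigma> t j / 2)"
proof -
  have "coend_lift (\<lambda>k \<sigma> t. \<lambda>j\<in>{..<n}. lin k n \<sigma> t j / 2) (coend_class (sd2_cube n) cube lin (k, \<sigma>, t)) =
      (\<lambda>j\<in>{..<n}. lin k n \<sigma> t j / 2)"
  proof (rule coend_lift_class)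
    fix l m f \<tau> s assume "box l m f" "\<tau> \<in> cells (sd2_cube n) m" "s \<in> cube l"
    moreover have "act (sd2_cube n) l m f \<tau> = restrict (\<tau> \<circ> f) (grid 1 l)"
      by (simp add: sd2_cube_def lattice_cset_def)
    ultimately show "(\<lambda>j\<in>{..<n}. lin l n (act (sd2_cube n) l m f \<tau>) s j / 2) = (\<lambda>j\<in>{..<n}. lin m n \<tau> (lin l m f s) j / 2)"
      using lin_comp[OF _ sd2_affine] by simp
  qed (use assms in auto)
  then show ?thesis
    using assms by (simp add: phi2_def points_realization realization_point_def top_of_cube_stream coend_class_in)
qed

section \<open>Cubical nerves\<close>

lemma poset_cat_simps [simp]:
  "Ob (poset_cat P) = P" "src (poset_cat P) = fst" "tgt (poset_cat P) = snd"
  "idn (poset_cat P) = (\<lambda>x. (x, x))" "cmp (poset_cat P) = (\<lambda>g f. (fst f, snd g))"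
  "(x, y) \<in> Ar (poset_cat P) \<longleftrightarrow> x \<in> P \<and> y \<in> P \<and> x \<le> y"
  by (simp_all add: poset_cat_def)

text \<open>Composable arrows of a poset are chains of three points, which turns functoriality into
  conditions on points.\<close>

lemma is_functor_poset_iff:
  "is_functor (poset_cat P) X F \<longleftrightarrow>
     fst F \<in> extensional P \<and> snd F \<in> extensional (Ar (poset_cat P)) \<and>
     (\<forall>x\<in>P. fst F x \<in> Ob X \<and> snd F (x, x) = idn X (fst F x)) \<and>
     (\<forall>x\<in>P. \<forall>y\<in>P. x \<le> y \<longrightarrow> snd F (x, y) \<in> Ar X \<and>
        src X (snd F (x, y)) = fst F x \<and> tgt X (snd F (x, y)) = fst F y) \<and>
     (\<forall>x\<in>P. \<forall>y\<in>P. \<forall>z\<in>P. x \<le> y \<longrightarrow> y \<le> z \<longrightarrow> snd F (x, z) = cmp X (snd F (y, z)) (snd F (x, y)))"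
  (is "?l \<longleftrightarrow> ?r")
proof
  assume F: ?l
  have F1: "fst F \<in> P \<rightarrow>\<^sub>E Ob X" and F2: "snd F \<in> Ar (poset_cat P) \<rightarrow>\<^sub>E Ar X"
    and F3: "\<forall>f\<in>Ar (poset_cat P). src X (snd F f) = fst F (fst f) \<and> tgt X (snd F f) = fst F (snd f)"
    and F4: "\<forall>a\<in>P. snd F (a, a) = idn X (fst F a)"
    using F unfolding is_functor_def poset_cat_simps by blast+
  show ?r
  proof (intro conjI ballI impI)
    fix x y z assume "x \<in> P" "y \<in> P" "z \<in> P" "x \<le> y" "y \<le> z"
    then show "snd F (x, z) = cmp X (snd F (y, z)) (snd F (x, y))"
      using F[unfolded is_functor_def, THEN conjunct2, THEN conjunct2, THEN conjunct2, THEN conjunct2,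
          rule_format, of "(x, y)" "(y, z)"] by simp
  next
    fix x y assume "x \<in> P" "y \<in> P" "x \<le> y"
    then have "(x, y) \<in> Ar (poset_cat P)"
      by simp
    then show "snd F (x, y) \<in> Ar X" "src X (snd F (x, y)) = fst F x" "tgt X (snd F (x, y)) = fst F y"
      using F2 F3 by auto
  qed (use F1 F2 F4 in \<open>auto simp: PiE_iff\<close>)
next
  assume r: ?r
  note ext = r[THEN conjunct1] r[THEN conjunct2, THEN conjunct1]
    and ob = r[THEN conjunct2, THEN conjunct2, THEN conjunct1, rule_format]
    and ar = r[THEN conjunct2, THEN conjunct2, THEN conjunct2, THEN conjunct1, rule_format]
    and comp = r[THEN conjunct2, THEN conjunct2, THEN conjunct2, THEN conjunct2, rule_format]
  show ?l
    unfolding is_functor_def PiE_iff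
  proof (intro conjI ballI impI)
    fix f g assume f: "f \<in> Ar (poset_cat P)" and g: "g \<in> Ar (poset_cat P)"
      and fg: "src (poset_cat P) g = tgt (poset_cat P) f"
    then obtain x y z where "f = (x, y)" "g = (y, z)" "x \<in> P" "y \<in> P" "z \<in> P" "x \<le> y" "y \<le> z"
      by (cases f; cases g) auto
    then show "snd F (cmp (poset_cat P) g f) = cmp X (snd F g) (snd F f)"
      using comp[of x y z] by simp
  next
    fix f assume "f \<in> Ar (poset_cat P)"
    then obtain x y where "f = (x, y)" "x \<in> P" "y \<in> P" "x \<le> y"
      by (cases f) auto
    then show "snd F f \<in> Ar X" "src X (snd F f) = fst F (src (poset_cat P) f)"
      "tgt X (snd F f) = fst F (tgt (poset_cat P) f)"
      using ar by simp_all
  qed (use ext ob in simp_all)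
qed

lemma poset_functorD:
  assumes "is_functor (poset_cat P) X F"
  shows "fst F \<in> extensional P" "snd F \<in> extensional (Ar (poset_cat P))"
    and "x \<in> P \<Longrightarrow> fst F x \<in> Ob X" "x \<in> P \<Longrightarrow> snd F (x, x) = idn X (fst F x)"
    and "x \<in> P \<Longrightarrow> y \<in> P \<Longrightarrow> x \<le> y \<Longrightarrow> snd F (x, y) \<in> Ar X"
    and "x \<in> P \<Longrightarrow> y \<in> P \<Longrightarrow> x \<le> y \<Longrightarrow> src X (snd F (x, y)) = fst F x"
    and "x \<in> P \<Longrightarrow> y \<in> P \<Longrightarrow> x \<le> y \<Longrightarrow> tgt X (snd F (x, y)) = fst F y"
    and "x \<in> P \<Longrightarrow> y \<in> P \<Longrightarrow> z \<in> P \<Longrightarrow> x \<le> y \<Longrightarrow> y \<le> z \<Longrightarrow>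
      snd F (x, z) = cmp X (snd F (y, z)) (snd F (x, y))"
proof -
  note r = assms[unfolded is_functor_poset_iff]
  note ob = r[THEN conjunct2, THEN conjunct2, THEN conjunct1, THEN bspec]
    and ar = r[THEN conjunct2, THEN conjunct2, THEN conjunct2, THEN conjunct1, THEN bspec, THEN bspec, THEN mp]
    and comp = r[THEN conjunct2, THEN conjunct2, THEN conjunct2, THEN conjunct2,
      THEN bspec, THEN bspec, THEN bspec, THEN mp, THEN mp]
  show "fst F \<in> extensional P" "snd F \<in> extensional (Ar (poset_cat P))"
    by (rule r[THEN conjunct1] r[THEN conjunct2, THEN conjunct1])+
  show "fst F x \<in> Ob X" "snd F (x, x) = idn X (fst F x)" if "x \<in> P"
    using ob[OF that] by (rule conjunct1 conjunct2)+
  show "snd F (x, y) \<in> Ar X" "src X (snd F (x, y)) = fst F x" "tgt X (snd F (x, y)) = fst F y"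
    if "x \<in> P" "y \<in> P" "x \<le> y"
    using ar[OF that] by blast+
  show "snd F (x, z) = cmp X (snd F (y, z)) (snd F (x, y))"
    if "x \<in> P" "y \<in> P" "z \<in> P" "x \<le> y" "y \<le> z"
    by (rule comp[OF that])
qed

lemma nerve_cells: "F \<in> cells (nerve X) n \<longleftrightarrow> is_functor (poset_cat (grid 1 n)) X F"
  by (simp add: nerve_def)

lemmas nerveD = poset_functorD[OF nerve_cells[THEN iffD1]]

lemma functor_eqI:
  assumes "is_functor (poset_cat P) X F" "is_functor (poset_cat P) Y G"
    and "\<And>x. x \<in> P \<Longrightarrow> fst F x = fst G x"
    and "\<And>x y. x \<in> P \<Longrightarrow> y \<in> P \<Longrightarrow> x \<le> y \<Longrightarrow> snd F (x, y) = snd G (x, y)"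
  shows "F = G"
proof (rule prod_eqI)
  show "fst F = fst G"
    by (rule extensionalityI[OF poset_functorD(1)[OF assms(1)] poset_functorD(1)[OF assms(2)] assms(3)])
  show "snd F = snd G"
  proof (rule extensionalityI)
    show "snd F \<in> extensional (Ar (poset_cat P))" "snd G \<in> extensional (Ar (poset_cat P))"
      using assms(1,2) by (simp_all only: poset_functorD(2))
    fix a assume "a \<in> Ar (poset_cat P)"
    then show "snd F a = snd G a"
      using assms(4) by (cases a) simp
  qed
qed

text \<open>Rounding a stream map may yield a diagonal, which is no morphism of the cube category,
  so a larger class of maps has to act on the nerve. Extensionality is not imposed, since
  \<open>pull\<close> reads a map on the grid only.\<close>

definition mono_map :: "nat \<Rightarrow> nat \<Rightarrow> (pt \<Rightarrow> pt) \<Rightarrow> bool" where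
  "mono_map m n f \<longleftrightarrow> f \<in> grid 1 m \<rightarrow> grid 1 n \<and> (\<forall>x\<in>grid 1 m. \<forall>y\<in>grid 1 m. x \<le> y \<longrightarrow> f x \<le> f y)"

lemma mono_mapD:
  assumes "mono_map m n f"
  shows "x \<in> grid 1 m \<Longrightarrow> f x \<in> grid 1 n"
    and "x \<in> grid 1 m \<Longrightarrow> y \<in> grid 1 m \<Longrightarrow> x \<le> y \<Longrightarrow> f x \<le> f y"
  using assms unfolding mono_map_def by blast+

lemma box_mono_map: "box m n f \<Longrightarrow> mono_map m n f"
  using box_affine cube_affine_in cube_affine_mono(1) unfolding mono_map_def by blast

text \<open>The action of the nerve, extended from the cube category to all monotone maps.\<close>

abbreviation pull :: "nat \<Rightarrow> (pt \<Rightarrow> pt) \<Rightarrow> (pt, pt \<times> pt, 'o, 'm) func \<Rightarrow> (pt, pt \<times> pt, 'o, 'm) func" where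
  "pull m f F \<equiv> functor_comp (poset_cat (grid 1 m)) F (poset_functor (grid 1 m) f)"

lemma act_nerve: "act (nerve X) m n f = pull m f"
  by (simp add: nerve_def fun_eq_iff)

lemma fst_pull: "x \<in> grid 1 m \<Longrightarrow> fst (pull m f F) x = fst F (f x)"
  by (simp add: functor_comp_def poset_functor_def)

lemma snd_pull: "x \<in> grid 1 m \<Longrightarrow> y \<in> grid 1 m \<Longrightarrow> x \<le> y \<Longrightarrow> snd (pull m f F) (x, y) = snd F (f x, f y)"
  by (simp add: functor_comp_def poset_functor_def)

lemma pull_cong:
  assumes "\<And>x. x \<in> grid 1 m \<Longrightarrow> f x = g x"
  shows "pull m f F = pull m g F"
  unfolding functor_comp_def poset_functor_def
  by (intro arg_cong2[where f = Pair] restrict_ext) (auto simp: assms poset_cat_def)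

lemma pull_in_nerve:
  assumes F: "F \<in> cells (nerve X) n" and f: "mono_map m n f"
  shows "pull m f F \<in> cells (nerve X) m"
proof -
  note f' = mono_mapD[OF f]
  have "fst (pull m f F) \<in> extensional (grid 1 m)"
    "snd (pull m f F) \<in> extensional (Ar (poset_cat (grid 1 m)))"
    by (simp_all add: functor_comp_def)
  then show ?thesis
    unfolding nerve_cells is_functor_poset_iff
  proof (intro conjI ballI impI)
    fix x y z assume xyz: "x \<in> grid 1 m" "y \<in> grid 1 m" "z \<in> grid 1 m" "x \<le> y" "y \<le> z"
    then have "snd F (f x, f z) = cmp X (snd F (f y, f z)) (snd F (f x, f y))"
      by (intro nerveD(8)[OF F] f')
    then show "snd (pull m f F) (x, z) = cmp X (snd (pull m f F) (y, z)) (snd (pull m f F) (x, y))"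
      using xyz order_trans[OF xyz(4,5)] by (simp only: snd_pull)
  qed (simp_all add: fst_pull snd_pull f' nerveD(3-7)[OF F])
qed

lemma pull_pull:
  assumes F: "F \<in> cells (nerve X) n" and f: "mono_map l m f" and g: "mono_map m n g"
  shows "pull l f (pull m g F) = pull l (g \<circ> f) F"
proof (rule functor_eqI)
  have "mono_map l n (g \<circ> f)"
    unfolding mono_map_def by (simp add: mono_mapD[OF f] mono_mapD[OF g])
  then show "is_functor (poset_cat (grid 1 l)) X (pull l f (pull m g F))"
    "is_functor (poset_cat (grid 1 l)) X (pull l (g \<circ> f) F)"
    using pull_in_nerve[OF pull_in_nerve[OF F g] f] pull_in_nerve[OF F] by (simp_all only: nerve_cells)
qed (simp_all add: fst_pull snd_pull mono_mapD[OF f])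

lemma pull_id:
  assumes F: "F \<in> cells (nerve X) n" and f: "\<And>x. x \<in> grid 1 n \<Longrightarrow> f x = x"
  shows "pull n f F = F"
proof (rule functor_eqI)
  have "mono_map n n f"
    using f by (simp add: mono_map_def)
  then show "is_functor (poset_cat (grid 1 n)) X (pull n f F)"
    using pull_in_nerve[OF F] by (simp only: nerve_cells)
  show "is_functor (poset_cat (grid 1 n)) X F"
    using F by (simp add: nerve_cells)
qed (use f in \<open>simp_all add: fst_pull snd_pull\<close>)

lemma cubical_set_nerve: "cubical_set (nerve X)"
  unfolding cubical_set_def act_nerve
proof (intro conjI allI impI ballI)
  show "pull m f \<in> cells (nerve X) n \<rightarrow> cells (nerve X) m" if "box m n f" for m n f
    using pull_in_nerve box_mono_map[OF that] by blast
  show "pull n (restrict id (grid 1 n)) F = F" if "F \<in> cells (nerve X) n" for n F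
    using that by (rule pull_id) simp
  fix l m n f g F assume fg: "box l m f" "box m n g" and F: "F \<in> cells (nerve X) n"
  show "pull l (restrict (g \<circ> f) (grid 1 l)) F = pull l f (pull m g F)"
    unfolding pull_pull[OF F fg[THEN box_mono_map]] by (rule pull_cong) simp
qed

section \<open>Functoriality of the nerve\<close>

lemma fst_functor_comp: "x \<in> Ob C \<Longrightarrow> fst (functor_comp C G F) x = fst G (fst F x)"
  and snd_functor_comp: "a \<in> Ar C \<Longrightarrow> snd (functor_comp C G F) a = snd G (snd F a)"
  by (simp_all add: functor_comp_def)

lemma nerve_map_cell:
  assumes K: "is_functor X Y K" and F: "F \<in> cells (nerve X) n"
  shows "nerve_map X K n F \<in> cells (nerve Y) n"
    and "x \<in> grid 1 n \<Longrightarrow> fst (nerve_map X K n F) x = fst K (fst F x)"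
    and "x \<in> grid 1 n \<Longrightarrow> y \<in> grid 1 n \<Longrightarrow> x \<le> y \<Longrightarrow> snd (nerve_map X K n F) (x, y) = snd K (snd F (x, y))"
proof -
  have eq: "nerve_map X K n F = functor_comp (poset_cat (grid 1 n)) K F"
    using F by (simp add: nerve_map_def)
  show fst: "fst (nerve_map X K n F) x = fst K (fst F x)" if "x \<in> grid 1 n" for x
    using that by (simp add: eq fst_functor_comp)
  show snd: "snd (nerve_map X K n F) (x, y) = snd K (snd F (x, y))"
    if "x \<in> grid 1 n" "y \<in> grid 1 n" "x \<le> y" for x y
    using that by (simp add: eq snd_functor_comp)
  have K': "fst K a \<in> Ob Y" "snd K (idn X a) = idn Y (fst K a)" if "a \<in> Ob X" for a
    using K that by (auto simp: is_functor_def)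
  have K'': "snd K f \<in> Ar Y" "src Y (snd K f) = fst K (src X f)" "tgt Y (snd K f) = fst K (tgt X f)" if "f \<in> Ar X" for f
    using K that by (auto simp: is_functor_def)
  have Kc: "snd K (cmp X g f) = cmp Y (snd K g) (snd K f)" if "f \<in> Ar X" "g \<in> Ar X" "src X g = tgt X f" for f g
    using K that by (auto simp: is_functor_def)
  have "fst (nerve_map X K n F) \<in> extensional (grid 1 n)"
    "snd (nerve_map X K n F) \<in> extensional (Ar (poset_cat (grid 1 n)))"
    by (simp_all add: eq functor_comp_def)
  then show "nerve_map X K n F \<in> cells (nerve Y) n"
    unfolding nerve_cells is_functor_poset_iff
  proof (intro conjI ballI impI)
    fix x y z assume xyz: "x \<in> grid 1 n" "y \<in> grid 1 n" "z \<in> grid 1 n" "x \<le> y" "y \<le> z"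
    note nerveD(8)[OF F xyz]
    moreover have "snd F (x, y) \<in> Ar X" "snd F (y, z) \<in> Ar X" "src X (snd F (y, z)) = tgt X (snd F (x, y))"
      using xyz by (simp_all add: nerveD(5-7)[OF F])
    ultimately show "snd (nerve_map X K n F) (x, z) = cmp Y (snd (nerve_map X K n F) (y, z)) (snd (nerve_map X K n F) (x, y))"
      using xyz order_trans[OF xyz(4,5)] by (simp add: snd Kc)
  qed (simp_all add: fst snd K' K'' nerveD(3-7)[OF F])
qed

lemma nerve_map_pull:
  assumes K: "is_functor X Y K" and F: "F \<in> cells (nerve X) n" and f: "mono_map m n f"
  shows "nerve_map X K m (pull m f F) = pull m f (nerve_map X K n F)"
proof (rule functor_eqI)
  note P = pull_in_nerve[OF F f]
  show "is_functor (poset_cat (grid 1 m)) Y (nerve_map X K m (pull m f F))"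
    "is_functor (poset_cat (grid 1 m)) Y (pull m f (nerve_map X K n F))"
    using nerve_map_cell(1)[OF K P] pull_in_nerve[OF nerve_map_cell(1)[OF K F] f] by (simp_all only: nerve_cells)
  fix x assume x: "x \<in> grid 1 m"
  show "fst (nerve_map X K m (pull m f F)) x = fst (pull m f (nerve_map X K n F)) x"
    using x by (simp add: nerve_map_cell(2)[OF K P] nerve_map_cell(2)[OF K F] fst_pull mono_mapD[OF f])
  fix y assume y: "y \<in> grid 1 m" "x \<le> y"
  show "snd (nerve_map X K m (pull m f F)) (x, y) = snd (pull m f (nerve_map X K n F)) (x, y)"
    using x y by (simp add: nerve_map_cell(3)[OF K P] nerve_map_cell(3)[OF K F] snd_pull mono_mapD[OF f])
qed

lemma cubical_fun_nerve_map:
  assumes "is_functor X Y K"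
  shows "cubical_fun (nerve X) (nerve Y) (nerve_map X K)"
  unfolding cubical_fun_def act_nerve
proof (intro conjI allI impI ballI)
  show "nerve_map X K n \<in> cells (nerve X) n \<rightarrow>\<^sub>E cells (nerve Y) n" for n
    using nerve_map_cell(1)[OF assms] by (auto simp: PiE_iff) (simp add: nerve_map_def)
qed (rule nerve_map_pull[OF assms _ box_mono_map])

lemma gamma_cubical_set_nerve:
  assumes X: "gamma_category \<Gamma> X" and \<Gamma>: "category \<Gamma>"
  shows "gamma_cubical_set \<Gamma> (gamma_nerve \<Gamma> X)"
  unfolding gamma_cubical_set_def
proof (intro conjI ballI allI impI)
  fix h assume h: "h \<in> Ar \<Gamma>"
  then have H: "is_functor (at_ob X (src \<Gamma> h)) (at_ob X (tgt \<Gamma> h)) (at_ar X h)"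
    using X by (simp add: gamma_category_def)
  then show "cubical_fun (at_ob (gamma_nerve \<Gamma> X) (src \<Gamma> h)) (at_ob (gamma_nerve \<Gamma> X) (tgt \<Gamma> h)) (at_ar (gamma_nerve \<Gamma> X) h)"
    by (simp add: gamma_nerve_def cubical_fun_nerve_map)
  fix k n F assume k: "k \<in> Ar \<Gamma>" "src \<Gamma> k = tgt \<Gamma> h" and "F \<in> cells (at_ob (gamma_nerve \<Gamma> X) (src \<Gamma> h)) n"
  then have F: "F \<in> cells (nerve (at_ob X (src \<Gamma> h))) n"
    by (simp add: gamma_nerve_def)
  have K: "is_functor (at_ob X (tgt \<Gamma> h)) (at_ob X (tgt \<Gamma> k)) (at_ar X k)"
    using X k unfolding gamma_category_def by metis
  have "src \<Gamma> (cmp \<Gamma> k h) = src \<Gamma> h" "tgt \<Gamma> (cmp \<Gamma> k h) = tgt \<Gamma> k" "cmp \<Gamma> k h \<in> Ar \<Gamma>"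
    using \<Gamma> h k unfolding category_def by auto
  then have KH: "is_functor (at_ob X (src \<Gamma> h)) (at_ob X (tgt \<Gamma> k)) (at_ar X (cmp \<Gamma> k h))"
    using X unfolding gamma_category_def by metis
  have eq: "at_ar X (cmp \<Gamma> k h) = functor_comp (at_ob X (src \<Gamma> h)) (at_ar X k) (at_ar X h)"
    using X h k by (simp add: gamma_category_def)
  note HF = nerve_map_cell[OF H F] and KHF = nerve_map_cell[OF KH F]
  note KF = nerve_map_cell[OF K HF(1)]
  have "nerve_map (at_ob X (src \<Gamma> h)) (at_ar X (cmp \<Gamma> k h)) n F =
      nerve_map (at_ob X (tgt \<Gamma> h)) (at_ar X k) n (nerve_map (at_ob X (src \<Gamma> h)) (at_ar X h) n F)"
  proof (rule functor_eqI[OF KHF(1)[unfolded nerve_cells] KF(1)[unfolded nerve_cells]])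
    have *: "\<And>x. x \<in> grid 1 n \<Longrightarrow> fst F x \<in> Ob (at_ob X (src \<Gamma> h))"
      "\<And>x y. x \<in> grid 1 n \<Longrightarrow> y \<in> grid 1 n \<Longrightarrow> x \<le> y \<Longrightarrow> snd F (x, y) \<in> Ar (at_ob X (src \<Gamma> h))"
      using nerveD[OF F] by blast+
    fix x assume x: "x \<in> grid 1 n"
    show "fst (nerve_map (at_ob X (src \<Gamma> h)) (at_ar X (cmp \<Gamma> k h)) n F) x =
        fst (nerve_map (at_ob X (tgt \<Gamma> h)) (at_ar X k) n (nerve_map (at_ob X (src \<Gamma> h)) (at_ar X h) n F)) x"
      using x * by (simp add: HF KHF KF) (simp add: eq fst_functor_comp)
    fix y assume y: "y \<in> grid 1 n" "x \<le> y"
    show "snd (nerve_map (at_ob X (src \<Gamma> h)) (at_ar X (cmp \<Gamma> k h)) n F) (x, y) =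
        snd (nerve_map (at_ob X (tgt \<Gamma> h)) (at_ar X k) n (nerve_map (at_ob X (src \<Gamma> h)) (at_ar X h) n F)) (x, y)"
      using x y * by (simp add: HF KHF KF) (simp add: eq snd_functor_comp)
  qed
  then show "at_ar (gamma_nerve \<Gamma> X) (cmp \<Gamma> k h) n F = at_ar (gamma_nerve \<Gamma> X) k n (at_ar (gamma_nerve \<Gamma> X) h n F)"
    using \<open>src \<Gamma> (cmp \<Gamma> k h) = src \<Gamma> h\<close> k by (simp add: gamma_nerve_def)
next
  fix a n F assume a: "a \<in> Ob \<Gamma>" and "F \<in> cells (at_ob (gamma_nerve \<Gamma> X) a) n"
  then have F: "F \<in> cells (nerve (at_ob X a)) n"
    by (simp add: gamma_nerve_def)
  have id: "src \<Gamma> (idn \<Gamma> a) = a" "tgt \<Gamma> (idn \<Gamma> a) = a" "idn \<Gamma> a \<in> Ar \<Gamma>"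
    using \<Gamma> a by (auto simp: category_def)
  then have I: "is_functor (at_ob X a) (at_ob X a) (at_ar X (idn \<Gamma> a))"
    using X unfolding gamma_category_def by metis
  have eq: "at_ar X (idn \<Gamma> a) = functor_id (at_ob X a)"
    using X a by (simp add: gamma_category_def)
  note IF = nerve_map_cell[OF I F]
  have "nerve_map (at_ob X a) (at_ar X (idn \<Gamma> a)) n F = F"
  proof (rule functor_eqI[OF IF(1)[unfolded nerve_cells] F[unfolded nerve_cells]])
    have *: "\<And>x. x \<in> grid 1 n \<Longrightarrow> fst F x \<in> Ob (at_ob X a)"
      "\<And>x y. x \<in> grid 1 n \<Longrightarrow> y \<in> grid 1 n \<Longrightarrow> x \<le> y \<Longrightarrow> snd F (x, y) \<in> Ar (at_ob X a)"
      using nerveD[OF F] by blast+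
    show "fst (nerve_map (at_ob X a) (at_ar X (idn \<Gamma> a)) n F) x = fst F x" if "x \<in> grid 1 n" for x
      using that * by (simp add: IF) (simp add: eq functor_id_def)
    show "snd (nerve_map (at_ob X a) (at_ar X (idn \<Gamma> a)) n F) (x, y) = snd F (x, y)"
      if "x \<in> grid 1 n" "y \<in> grid 1 n" "x \<le> y" for x y
      using that * by (simp add: IF) (simp add: eq functor_id_def)
  qed
  then show "at_ar (gamma_nerve \<Gamma> X) (idn \<Gamma> a) n F = F"
    using id by (simp add: gamma_nerve_def)
qed (simp add: gamma_nerve_def cubical_set_nerve)

section \<open>The retraction onto a nerve\<close>

abbreviation dimaps :: "nat \<Rightarrow> nat \<Rightarrow> (rpt \<Rightarrow> rpt) set" where
  "dimaps k n \<equiv> stream_maps (cube_stream k) (cube_stream n)"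

lemma cells_sing_cube: "cells (sing (cube_stream n)) = (\<lambda>k. dimaps k n)"
  by (simp add: sing_def)

lemma act_sing: "act (sing X) k l f \<theta> = restrict (\<theta> \<circ> lin k l f) (cube k)"
  by (simp add: sing_def top_of_cube_stream)

lemma S_rep_map_eq: "S_rep_map k m n f \<theta> = restrict (lin m n f \<circ> \<theta>) (cube k)"
  by (simp add: S_rep_map_def top_of_cube_stream)

lemma S_rep_map_in: "box m n f \<Longrightarrow> \<theta> \<in> dimaps k m \<Longrightarrow> S_rep_map k m n f \<theta> \<in> dimaps k n"
  unfolding S_rep_map_eq by (rule stream_map_comp[OF _ lin_stream_map])

lemma act_sing_in: "box k l f \<Longrightarrow> \<theta> \<in> dimaps l n \<Longrightarrow> restrict (\<theta> \<circ> lin k l f) (cube k) \<in> dimaps k n"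
  by (rule stream_map_comp[OF lin_stream_map])

lemma sharp_class_eq:
  assumes "cubical_set C" "box m n f" "c \<in> cells C n" "\<theta> \<in> dimaps k m"
  shows "sharp_class C k m (act C m n f c) \<theta> = sharp_class C k n c (S_rep_map k m n f \<theta>)"
  unfolding sharp_class_def
  by (rule coend_class_eq) (use assms in \<open>simp_all add: cells_sing_cube S_rep_map_in\<close>)

lemma cells_sharp: "cells (sharp C) k = coend C (dimaps k) (S_rep_map k)"
  by (simp add: sharp_def cells_sing_cube)

lemma sharp_class_in: "c \<in> cells C n \<Longrightarrow> \<theta> \<in> dimaps k n \<Longrightarrow> sharp_class C k n c \<theta> \<in> cells (sharp C) k"
  by (simp add: sharp_class_def cells_sharp cells_sing_cube coend_class_in)

lemma sharp_cases:
  assumes "p \<in> cells (sharp C) k"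
  obtains n c \<theta> where "c \<in> cells C n" "\<theta> \<in> dimaps k n" "p = sharp_class C k n c \<theta>"
  using assms unfolding cells_sharp by (rule coend_cases) (simp add: sharp_class_def cells_sing_cube)

lemma sharp_lift:
  assumes "\<And>m n f c \<theta>. box m n f \<Longrightarrow> c \<in> cells C n \<Longrightarrow> \<theta> \<in> dimaps k m \<Longrightarrow>
      g m (act C m n f c) \<theta> = g n c (S_rep_map k m n f \<theta>)"
    and "c \<in> cells C n" "\<theta> \<in> dimaps k n"
  shows "coend_lift g (sharp_class C k n c \<theta>) = g n c \<theta>"
  unfolding sharp_class_def
  by (rule coend_lift_class) (use assms in \<open>simp_all add: cells_sing_cube\<close>)

lemma act_sharp:
  assumes C: "cubical_set C" and f: "box k l f" and "c \<in> cells C n" "\<theta> \<in> dimaps l n"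
  shows "act (sharp C) k l f (sharp_class C l n c \<theta>) =
    sharp_class C k n c (restrict (\<theta> \<circ> lin k l f) (cube k))"
proof -
  have "coend_lift (\<lambda>n c \<theta>. sharp_class C k n c (act (sing (cube_stream n)) k l f \<theta>)) (sharp_class C l n c \<theta>) =
      sharp_class C k n c (act (sing (cube_stream n)) k l f \<theta>)"
  proof (rule sharp_lift)
    fix m n g c \<theta> assume g: "box m n g" and c: "c \<in> cells C n" and \<theta>: "\<theta> \<in> dimaps l m"
    \<comment> \<open>Precomposition with \<open>lin k l f\<close> and postcomposition with
      \<open>lin m n g\<close> commute, so the action respects the relation of the coend.\<close>
    have "S_rep_map k m n g (restrict (\<theta> \<circ> lin k l f) (cube k)) =
        restrict (S_rep_map l m n g \<theta> \<circ> lin k l f) (cube k)"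
      unfolding S_rep_map_eq by (rule restrict_ext) (simp add: lin_in_cube[OF f])
    then show "sharp_class C k m (act C m n g c) (act (sing (cube_stream m)) k l f \<theta>) =
        sharp_class C k n c (act (sing (cube_stream n)) k l f (S_rep_map l m n g \<theta>))"
      by (simp add: act_sing sharp_class_eq[OF C g c act_sing_in[OF f \<theta>]])
  qed (use assms in auto)
  then show ?thesis
    by (simp add: sharp_def act_sing)
qed

lemma cubical_funD:
  assumes "cubical_fun C D \<alpha>"
  shows "x \<in> cells C n \<Longrightarrow> \<alpha> n x \<in> cells D n"
    and "box m n f \<Longrightarrow> x \<in> cells C n \<Longrightarrow> \<alpha> m (act C m n f x) = act D m n f (\<alpha> n x)"
  using assms unfolding cubical_fun_def by blast+

lemma cubical_funI:
  assumes "\<And>n. \<alpha> n \<in> extensional (cells C n)"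
    and "\<And>n x. x \<in> cells C n \<Longrightarrow> \<alpha> n x \<in> cells D n"
    and "\<And>m n f x. box m n f \<Longrightarrow> x \<in> cells C n \<Longrightarrow> \<alpha> m (act C m n f x) = act D m n f (\<alpha> n x)"
  shows "cubical_fun C D \<alpha>"
  using assms by (auto simp: cubical_fun_def PiE_iff)

lemma sharp_map_class:
  assumes \<alpha>: "cubical_fun C D \<alpha>" and D: "cubical_set D" and "c \<in> cells C n" "\<theta> \<in> dimaps k n"
  shows "sharp_map C D \<alpha> k (sharp_class C k n c \<theta>) = sharp_class D k n (\<alpha> n c) \<theta>"
proof -
  have "coend_lift (\<lambda>n c \<theta>. sharp_class D k n (\<alpha> n c) \<theta>) (sharp_class C k n c \<theta>) = sharp_class D k n (\<alpha> n c) \<theta>"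
  proof (rule sharp_lift)
    fix m n g c \<theta> assume "box m n g" "c \<in> cells C n" "\<theta> \<in> dimaps k m"
    then show "sharp_class D k m (\<alpha> m (act C m n g c)) \<theta> = sharp_class D k n (\<alpha> n c) (S_rep_map k m n g \<theta>)"
      by (simp add: cubical_funD[OF \<alpha>] sharp_class_eq[OF D])
  qed (use assms in auto)
  then show ?thesis
    using sharp_class_in[OF assms(3,4)] by (simp add: sharp_map_def)
qed

section \<open>Rounded vertices and the retraction\<close>

definition corner :: "nat \<Rightarrow> nat \<Rightarrow> (rpt \<Rightarrow> rpt) \<Rightarrow> pt \<Rightarrow> pt" where
  "corner k n \<theta> x = round_pt n (\<theta> (vertex k x))"

lemma corner_mono_map:
  assumes "\<theta> \<in> dimaps k n"
  shows "mono_map k n (corner k n \<theta>)"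
  unfolding mono_map_def
proof (intro conjI funcsetI ballI impI)
  fix x y assume "x \<in> grid 1 k" "y \<in> grid 1 k" "x \<le> y"
  then show "corner k n \<theta> x \<le> corner k n \<theta> y"
    unfolding corner_def by (intro round_pt_mono stream_map_mono[OF assms] vertex_in_cube vertex_mono)
qed (simp add: corner_def round_pt_in_grid)

definition nerve_retract :: "('o, 'm) cat \<Rightarrow> nat \<Rightarrow>
    (nat \<times> (pt, pt \<times> pt, 'o, 'm) func \<times> (rpt \<Rightarrow> rpt)) set \<Rightarrow> (pt, pt \<times> pt, 'o, 'm) func" where
  "nerve_retract X k = (\<lambda>p\<in>cells (sharp (nerve X)) k. coend_lift (\<lambda>n c \<theta>. pull k (corner k n \<theta>) c) p)"

text \<open>A morphism \<open>f\<close> may be moved from the stream map to the functor, because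
  rounding commutes with its realization.\<close>

lemma nerve_retract_class:
  assumes "c \<in> cells (nerve X) n" "\<theta> \<in> dimaps k n"
  shows "nerve_retract X k (sharp_class (nerve X) k n c \<theta>) = pull k (corner k n \<theta>) c"
proof -
  have "coend_lift (\<lambda>n c \<theta>. pull k (corner k n \<theta>) c) (sharp_class (nerve X) k n c \<theta>) = pull k (corner k n \<theta>) c"
  proof (rule sharp_lift)
    fix m n f c \<theta> assume f: "box m n f" and c: "c \<in> cells (nerve X) n" and \<theta>: "\<theta> \<in> dimaps k m"
    have "pull k (corner k m \<theta>) (pull m f c) = pull k (f \<circ> corner k m \<theta>) c"
      by (rule pull_pull[OF c corner_mono_map[OF \<theta>] box_mono_map[OF f]])
    also have "\<dots> = pull k (corner k n (S_rep_map k m n f \<theta>)) c"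
      by (rule pull_cong)
        (simp add: corner_def S_rep_map_eq vertex_in_cube round_lin[OF f] stream_map_in[OF \<theta>])
    finally show "pull k (corner k m \<theta>) (act (nerve X) m n f c) = pull k (corner k n (S_rep_map k m n f \<theta>)) c"
      by (simp add: act_nerve)
  qed (use assms in auto)
  then show ?thesis
    using assms by (simp add: nerve_retract_def sharp_class_in)
qed

text \<open>A morphism of the cube category sends vertices to vertices, so pulling back along it
  before or after rounding reads the same values of \<open>\<theta>\<close>.\<close>

lemma cubical_fun_nerve_retract: "cubical_fun (sharp (nerve X)) (nerve X) (nerve_retract X)"
proof (rule cubical_funI)
  show "nerve_retract X n \<in> extensional (cells (sharp (nerve X)) n)" for n
    by (simp add: nerve_retract_def)
  show "nerve_retract X n p \<in> cells (nerve X) n" if "p \<in> cells (sharp (nerve X)) n" for n p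
    using that by (rule sharp_cases) (simp add: nerve_retract_class pull_in_nerve corner_mono_map)
  show "nerve_retract X k (act (sharp (nerve X)) k l f p) = act (nerve X) k l f (nerve_retract X l p)"
    if f: "box k l f" and p: "p \<in> cells (sharp (nerve X)) l" for k l f p
    using p
  proof (rule sharp_cases)
    fix n c \<theta> assume c: "c \<in> cells (nerve X) n" and \<theta>: "\<theta> \<in> dimaps l n" and p: "p = sharp_class (nerve X) l n c \<theta>"
    let ?\<theta> = "restrict (\<theta> \<circ> lin k l f) (cube k)"
    have "nerve_retract X k (act (sharp (nerve X)) k l f p) = pull k (corner k n ?\<theta>) c"
      by (simp add: p act_sharp[OF cubical_set_nerve f c \<theta>] nerve_retract_class[OF c act_sing_in[OF f \<theta>]])
    also have "\<dots> = pull k (corner l n \<theta> \<circ> f) c"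
      by (rule pull_cong) (simp add: corner_def vertex_in_cube lin_vertex[OF box_affine[OF f]])
    also have "\<dots> = pull k f (pull l (corner l n \<theta>) c)"
      by (rule pull_pull[OF c box_mono_map[OF f] corner_mono_map[OF \<theta>], symmetric])
    finally show ?thesis
      by (simp add: p act_nerve nerve_retract_class[OF c \<theta>])
  qed
qed

lemma nerve_retract_unit:
  assumes c: "c \<in> cells (nerve X) n"
  shows "nerve_retract X n (sharp_unit (nerve X) n c) = c"
proof -
  have \<theta>: "lin n n (restrict id (grid 1 n)) \<in> dimaps n n"
    by (rule lin_stream_map[OF box_id])
  have "pull n (corner n n (lin n n (restrict id (grid 1 n)))) c = c"
    using c by (rule pull_id) (simp add: corner_def lin_vertex[OF box_affine[OF box_id]] round_vertex)
  then show ?thesis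
    using c by (simp add: sharp_unit_def S_unit_rep_def nerve_retract_class[OF c \<theta>])
qed

text \<open>The rounded map depends on \<open>\<theta>\<close> alone, and composition with
  \<open>K\<close> commutes with pulling back.\<close>

lemma nerve_retract_natural:
  assumes K: "is_functor X Y K" and p: "p \<in> cells (sharp (nerve X)) k"
  shows "nerve_retract Y k (sharp_map (nerve X) (nerve Y) (nerve_map X K) k p) = nerve_map X K k (nerve_retract X k p)"
  using p
proof (rule sharp_cases)
  fix n c \<theta> assume c: "c \<in> cells (nerve X) n" and \<theta>: "\<theta> \<in> dimaps k n" and p: "p = sharp_class (nerve X) k n c \<theta>"
  show ?thesis
    by (simp add: p sharp_map_class[OF cubical_fun_nerve_map[OF K] cubical_set_nerve c \<theta>]
        nerve_retract_class[OF nerve_map_cell(1)[OF K c] \<theta>] nerve_retract_class[OF c \<theta>]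
        nerve_map_pull[OF K c corner_mono_map[OF \<theta>]])
qed

section \<open>Subdivided cubes in a nerve\<close>

lemma act_sd2: "act (sd2_cube n) l k f \<sigma> = restrict (\<sigma> \<circ> f) (grid 1 l)"
  by (simp add: sd2_cube_def lattice_cset_def)

lemma act_sd2_in: "box l k f \<Longrightarrow> \<sigma> \<in> cells (sd2_cube n) k \<Longrightarrow> restrict (\<sigma> \<circ> f) (grid 1 l) \<in> cells (sd2_cube n) l"
  unfolding sd2_cells_iff by (rule cube_affine_comp[OF box_affine])

lemma cubical_fun_sd2_comp:
  assumes \<psi>: "cubical_fun (sd2_cube n) C \<psi>" and \<alpha>: "cubical_fun C D \<alpha>"
  shows "cubical_fun (sd2_cube n) D (\<lambda>k. restrict (\<alpha> k \<circ> \<psi> k) (cells (sd2_cube n) k))"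
  by (rule cubical_funI)
    (auto simp: act_sd2 act_sd2_in cubical_funD[OF \<alpha>] cubical_funD[OF \<psi>] simp flip: cubical_funD(2)[OF \<alpha>] cubical_funD(2)[OF \<psi>, unfolded act_sd2])

text \<open>By \<open>phi2_point\<close> this is the cell of \<open>\<sigma>\<close> in the realized
  subdivision, followed by \<open>phi2\<close>.\<close>

definition half_lin :: "nat \<Rightarrow> nat \<Rightarrow> (pt \<Rightarrow> pt) \<Rightarrow> rpt \<Rightarrow> rpt" where
  "half_lin k n \<sigma> = (\<lambda>t\<in>cube k. \<lambda>j\<in>{..<n}. lin k n \<sigma> t j / 2)"

lemma half_lin_dimap: "\<sigma> \<in> cells (sd2_cube n) k \<Longrightarrow> half_lin k n \<sigma> \<in> dimaps k n"
  using affine_stream_map[of k 2 n \<sigma>] by (simp add: half_lin_def sd2_cells_iff)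

lemma phi_sharp_rep_eq:
  assumes "\<sigma> \<in> cells (sd2_cube m) k"
  shows "phi_sharp_rep m \<theta> k \<sigma> = restrict (\<theta> \<circ> half_lin k m \<sigma>) (cube k)"
  unfolding phi_sharp_rep_def adjunct_def restrict_apply'[OF assms] top_of_cube_stream
  by (rule restrict_ext) (simp add: phi2_point[OF assms] half_lin_def)

lemma cubical_fun_phi_sharp_rep:
  assumes \<theta>: "\<theta> \<in> dimaps m n"
  shows "cubical_fun (sd2_cube m) (sing (cube_stream n)) (phi_sharp_rep m \<theta>)"
proof (rule cubical_funI)
  show "phi_sharp_rep m \<theta> k \<in> extensional (cells (sd2_cube m) k)" for k
    by (simp add: phi_sharp_rep_def adjunct_def)
  show "phi_sharp_rep m \<theta> k \<sigma> \<in> cells (sing (cube_stream n)) k" if "\<sigma> \<in> cells (sd2_cube m) k" for k \<sigma>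
    using stream_map_comp[OF half_lin_dimap[OF that] \<theta>] by (simp add: phi_sharp_rep_eq[OF that] cells_sing_cube)
  fix l k f \<sigma> assume f: "box l k f" and \<sigma>: "\<sigma> \<in> cells (sd2_cube m) k"
  show "phi_sharp_rep m \<theta> l (act (sd2_cube m) l k f \<sigma>) = act (sing (cube_stream n)) l k f (phi_sharp_rep m \<theta> k \<sigma>)"
    unfolding act_sd2 phi_sharp_rep_eq[OF \<sigma>] phi_sharp_rep_eq[OF act_sd2_in[OF f \<sigma>]] act_sing
    by (rule restrict_ext) (simp add: half_lin_def lin_comp[OF f sd2_affine[OF \<sigma>]] lin_in_cube[OF f])
qed

text \<open>Precomposition with a cell commutes with postcomposition by a realized morphism, so the
  formula respects the relation of the coend.\<close>

lemma phi_sharp_class: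
  assumes C: "cubical_set C" and c: "c \<in> cells C n" and \<theta>: "\<theta> \<in> dimaps m n"
  shows "phi_sharp C m (sharp_class C m n c \<theta>) =
    (\<lambda>k. \<lambda>\<sigma>\<in>cells (sd2_cube m) k. sharp_class C k n c (restrict (\<theta> \<circ> half_lin k m \<sigma>) (cube k)))"
proof -
  define g where "g n c \<theta> = ex2_map (sing (cube_stream n)) (\<lambda>k. sharp_class C k n c) m (phi_sharp_rep m \<theta>)" for n c \<theta>
  have g: "g n c \<theta> = (\<lambda>k. \<lambda>\<sigma>\<in>cells (sd2_cube m) k. sharp_class C k n c (restrict (\<theta> \<circ> half_lin k m \<sigma>) (cube k)))"
    if "\<theta> \<in> dimaps m n" for n c \<theta>
  proof -
    have "phi_sharp_rep m \<theta> \<in> cells (ex2 (sing (cube_stream n))) m"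
      using cubical_fun_phi_sharp_rep[OF that] by (simp add: ex2_def)
    then show ?thesis
      unfolding g_def ex2_map_def by (auto simp: phi_sharp_rep_eq fun_eq_iff)
  qed
  have "coend_lift g (sharp_class C m n c \<theta>) = g n c \<theta>"
  proof (rule sharp_lift)
    fix l n f c \<theta> assume f: "box l n f" and c: "c \<in> cells C n" and \<theta>: "\<theta> \<in> dimaps m l"
    have "sharp_class C k l (act C l n f c) (restrict (\<theta> \<circ> half_lin k m \<sigma>) (cube k)) =
        sharp_class C k n c (restrict (S_rep_map m l n f \<theta> \<circ> half_lin k m \<sigma>) (cube k))"
      if \<sigma>: "\<sigma> \<in> cells (sd2_cube m) k" for k \<sigma>
    proof -
      have "S_rep_map k l n f (restrict (\<theta> \<circ> half_lin k m \<sigma>) (cube k)) =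
          restrict (S_rep_map m l n f \<theta> \<circ> half_lin k m \<sigma>) (cube k)"
        unfolding S_rep_map_eq by (rule restrict_ext) (simp add: stream_map_in[OF half_lin_dimap[OF \<sigma>]])
      then show ?thesis
        by (simp add: sharp_class_eq[OF C f c stream_map_comp[OF half_lin_dimap[OF \<sigma>] \<theta>]])
    qed
    then show "g l (act C l n f c) \<theta> = g n c (S_rep_map m l n f \<theta>)"
      unfolding g[OF \<theta>] g[OF S_rep_map_in[OF f \<theta>]] by (intro ext restrict_ext)
  qed (use c \<theta> in auto)
  moreover have "phi_sharp C m (sharp_class C m n c \<theta>) = coend_lift g (sharp_class C m n c \<theta>)"
    using sharp_class_in[OF c \<theta>] by (simp add: phi_sharp_def g_def[abs_def])
  ultimately show ?thesis
    using g[OF \<theta>] by simp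
qed

lemma phi_sharp_in:
  assumes C: "cubical_set C" and c: "c \<in> cells C n" and \<theta>: "\<theta> \<in> dimaps m n"
  shows "phi_sharp C m (sharp_class C m n c \<theta>) \<in> cells (ex2 (sharp C)) m"
proof -
  have "cubical_fun (sd2_cube m) (sharp C) (phi_sharp C m (sharp_class C m n c \<theta>))"
    unfolding phi_sharp_class[OF assms]
  proof (rule cubical_funI, goal_cases)
    case (2 k \<sigma>)
    then show ?case
      by (simp add: sharp_class_in[OF c] stream_map_comp[OF half_lin_dimap \<theta>])
  next
    case (3 l k f \<sigma>)
    note f = 3(1) and \<sigma> = 3(2)
    have "restrict (restrict (\<theta> \<circ> half_lin k m \<sigma>) (cube k) \<circ> lin l k f) (cube l) =
        restrict (\<theta> \<circ> half_lin l m (restrict (\<sigma> \<circ> f) (grid 1 l))) (cube l)"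
      by (rule restrict_ext) (simp add: half_lin_def lin_comp[OF f sd2_affine[OF \<sigma>]] lin_in_cube[OF f])
    then show ?case
      using \<sigma> act_sd2_in[OF f \<sigma>]
      by (simp add: act_sd2 act_sharp[OF C f c stream_map_comp[OF half_lin_dimap[OF \<sigma>] \<theta>]])
  qed simp
  then show ?thesis
    by (simp add: ex2_def)
qed

section \<open>The functor carried by a subdivided cube\<close>

definition sub_ob :: "nat \<Rightarrow> (nat \<Rightarrow> (pt \<Rightarrow> pt) \<Rightarrow> (pt, pt \<times> pt, 'o, 'm) func) \<Rightarrow> pt \<Rightarrow> 'o" where
  "sub_ob n \<psi> v = fst (\<psi> n (diag_cube n v v)) (origin n)"

text \<open>Meaningful for pairs with \<open>covers n v w\<close>, since other comparable pairs lie
  in no common cube of the subdivision.\<close>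

definition sub_ar :: "nat \<Rightarrow> (nat \<Rightarrow> (pt \<Rightarrow> pt) \<Rightarrow> (pt, pt \<times> pt, 'o, 'm) func) \<Rightarrow> pt \<Rightarrow> pt \<Rightarrow> 'm" where
  "sub_ar n \<psi> v w = snd (\<psi> n (diag_cube n v w)) (origin n, top_pt n)"

lemma origin_le_top: "origin n \<le> top_pt n"
  by (rule origin_le[OF top_pt_in_grid])

lemma covers_refl: "v \<in> grid 2 n \<Longrightarrow> covers n v v"
  by (simp add: covers_def)

lemma covers_in: "covers n v w \<Longrightarrow> v \<in> grid 2 n" "covers n v w \<Longrightarrow> w \<in> grid 2 n"
  by (simp_all add: covers_def)

context
  fixes X :: "('o, 'm) cat" and n :: nat and \<psi>
  assumes \<psi>: "cubical_fun (sd2_cube n) (nerve X) \<psi>"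
begin

lemma sub_cell: "covers n v w \<Longrightarrow> \<psi> n (diag_cube n v w) \<in> cells (nerve X) n"
  by (rule cubical_funD(1)[OF \<psi> diag_cube_in_sd2])

text \<open>All faces of a cube spanned by a Boolean interval are obtained by clamping, so the values of
  \<open>\<psi>\<close> on them only depend on their end points in $[2]^n$.\<close>

lemma sub_clamp:
  assumes "covers n v w" "a \<in> grid 1 n" "b \<in> grid 1 n" "a \<le> b"
  shows "\<psi> n (diag_cube n (diag_cube n v w a) (diag_cube n v w b)) = pull n (cube_clamp n a b) (\<psi> n (diag_cube n v w))"
  using cubical_funD(2)[OF \<psi> box_cube_clamp[OF assms(2)] diag_cube_in_sd2[OF assms(1)], of b]
  by (simp add: act_sd2 act_nerve diag_cube_clamp[OF assms])

lemma sub_diag: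
  assumes vw: "covers n v w"
  shows "a \<in> grid 1 n \<Longrightarrow> fst (\<psi> n (diag_cube n v w)) a = sub_ob n \<psi> (diag_cube n v w a)"
    and "a \<in> grid 1 n \<Longrightarrow> b \<in> grid 1 n \<Longrightarrow> a \<le> b \<Longrightarrow>
      snd (\<psi> n (diag_cube n v w)) (a, b) = sub_ar n \<psi> (diag_cube n v w a) (diag_cube n v w b)"
  using origin_in_grid[of n 1] top_pt_in_grid[of n] origin_le_top[of n]
  by (simp_all add: sub_ob_def sub_ar_def sub_clamp[OF vw] fst_pull snd_pull cube_clamp_origin cube_clamp_top)

lemma sub_ar_ends:
  assumes vw: "covers n v w"
  shows "sub_ar n \<psi> v w \<in> Ar X" "src X (sub_ar n \<psi> v w) = sub_ob n \<psi> v" "tgt X (sub_ar n \<psi> v w) = sub_ob n \<psi> w"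
  using nerveD(5-7)[OF sub_cell[OF vw] origin_in_grid top_pt_in_grid origin_le_top]
    sub_diag[OF vw origin_in_grid] sub_diag(1)[OF vw top_pt_in_grid]
  by (simp_all add: diag_cube_origin[OF vw] diag_cube_top[OF vw] flip: sub_ar_def)

lemma sub_ob_in: "v \<in> grid 2 n \<Longrightarrow> sub_ob n \<psi> v \<in> Ob X"
  unfolding sub_ob_def by (rule nerveD(3)[OF sub_cell[OF covers_refl] origin_in_grid])

lemma sub_ar_refl:
  assumes "v \<in> grid 2 n"
  shows "sub_ar n \<psi> v v = idn X (sub_ob n \<psi> v)"
proof -
  note vv = covers_refl[OF assms]
  have "snd (\<psi> n (diag_cube n v v)) (origin n, origin n) = idn X (sub_ob n \<psi> v)"
    unfolding sub_ob_def by (rule nerveD(4)[OF sub_cell[OF vv] origin_in_grid])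
  then show ?thesis
    using sub_diag(2)[OF vv origin_in_grid origin_in_grid order_refl] by (simp add: diag_cube_origin[OF vv])
qed

text \<open>All three points lie in the canonical cube from \<open>v\<close> to \<open>z\<close>,
  and the value of \<open>\<psi>\<close> on that cube is a functor.\<close>

lemma sub_ar_comp:
  assumes vw: "covers n v w" and wz: "covers n w z" and vz: "covers n v z"
  shows "sub_ar n \<psi> v z = cmp X (sub_ar n \<psi> w z) (sub_ar n \<psi> v w)"
proof -
  \<comment> \<open>The parameter of \<open>w\<close> in the cube from \<open>v\<close> to
    \<open>z\<close>; its entries are 0 and 1 because \<open>w\<close> exceeds \<open>v\<close> by
    at most 1.\<close>
  define a where "a = (\<lambda>i\<in>{..<n}. w i - v i)"
  have a: "a \<in> grid 1 n"
    unfolding a_def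
  proof (rule restrict_in_grid)
    fix i assume "i < n"
    then have "w i \<le> v i + 1"
      using vw by (simp add: covers_def)
    then show "w i - v i \<le> 1"
      by simp
  qed
  have w: "diag_cube n v z a = w"
  proof (rule grid_eqI[OF diag_cube_in_grid[OF vz a] covers_in(2)[OF vw]])
    fix i assume i: "i < n"
    then have "v i \<le> w i" "w i \<le> z i"
      using vw wz by (auto simp: covers_def)
    then show "diag_cube n v z a i = w i"
      using i by (simp add: diag_cube_def a) (simp add: a_def)
  qed
  note o = origin_in_grid[of n 1] and t = top_pt_in_grid[of n]
  show ?thesis
    using nerveD(8)[OF sub_cell[OF vz] o a t origin_le[OF a] le_top_pt[OF a]]
    by (simp add: sub_diag[OF vz] o a t origin_le[OF a] le_top_pt[OF a] origin_le_top w diag_cube_origin[OF vz] diag_cube_top[OF vz])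
qed

end

section \<open>Evaluation of subdivided cubes\<close>

definition nerve_eval :: "('o, 'm) cat \<Rightarrow> nat \<Rightarrow>
    (nat \<Rightarrow> (pt \<Rightarrow> pt) \<Rightarrow> (pt, pt \<times> pt, 'o, 'm) func) \<Rightarrow> (pt, pt \<times> pt, 'o, 'm) func" where
  "nerve_eval X n = (\<lambda>\<psi>\<in>cells (ex2 (nerve X)) n.
     (\<lambda>x\<in>grid 1 n. sub_ob n \<psi> (midpt n x x),
      \<lambda>(x, y)\<in>Ar (poset_cat (grid 1 n)).
        cmp X (sub_ar n \<psi> (midpt n x y) (midpt n y y)) (sub_ar n \<psi> (midpt n x x) (midpt n x y))))"

lemma cells_ex2: "\<psi> \<in> cells (ex2 C) n \<longleftrightarrow> cubical_fun (sd2_cube n) C \<psi>"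
  by (simp add: ex2_def)

lemma nerve_eval_simps:
  assumes "cubical_fun (sd2_cube n) (nerve X) \<psi>"
  shows "x \<in> grid 1 n \<Longrightarrow> fst (nerve_eval X n \<psi>) x = sub_ob n \<psi> (midpt n x x)"
    and "x \<in> grid 1 n \<Longrightarrow> y \<in> grid 1 n \<Longrightarrow> x \<le> y \<Longrightarrow> snd (nerve_eval X n \<psi>) (x, y) =
      cmp X (sub_ar n \<psi> (midpt n x y) (midpt n y y)) (sub_ar n \<psi> (midpt n x x) (midpt n x y))"
  using assms by (simp_all add: nerve_eval_def cells_ex2)

lemma categoryD:
  assumes "category X"
  shows "f \<in> Ar X \<Longrightarrow> g \<in> Ar X \<Longrightarrow> src X g = tgt X f \<Longrightarrow> cmp X g f \<in> Ar X"
    and "f \<in> Ar X \<Longrightarrow> g \<in> Ar X \<Longrightarrow> src X g = tgt X f \<Longrightarrow> src X (cmp X g f) = src X f"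
    and "f \<in> Ar X \<Longrightarrow> g \<in> Ar X \<Longrightarrow> src X g = tgt X f \<Longrightarrow> tgt X (cmp X g f) = tgt X g"
    and "f \<in> Ar X \<Longrightarrow> g \<in> Ar X \<Longrightarrow> h \<in> Ar X \<Longrightarrow> src X g = tgt X f \<Longrightarrow> src X h = tgt X g \<Longrightarrow>
      cmp X h (cmp X g f) = cmp X (cmp X h g) f"
    and "a \<in> Ob X \<Longrightarrow> cmp X (idn X a) (idn X a) = idn X a"
  using assms unfolding category_def by (blast, blast, blast, blast, metis)

lemma midpt_in_grid:
  assumes "x \<in> grid 1 n" "y \<in> grid 1 n"
  shows "midpt n x y \<in> grid 2 n"
  unfolding midpt_def
proof (rule restrict_in_grid)
  fix i assume "i < n"
  then show "x i + y i \<le> 2"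
    using assms[THEN grid_leD, of i] by simp
qed

text \<open>For x \<le> y \<le> z the long composite runs through x + y, 2y and y + z, the short one
  through x + z. They become comparable when the two steps of the short one are split at x + y and
  at y + z.\<close>

lemma nerve_eval_in:
  assumes X: "category X" and \<psi>: "cubical_fun (sd2_cube n) (nerve X) \<psi>"
  shows "nerve_eval X n \<psi> \<in> cells (nerve X) n"
  unfolding nerve_cells is_functor_poset_iff
proof (intro conjI ballI impI)
  let ?A = "sub_ar n \<psi>" and ?m = "midpt n"
  note ends = sub_ar_ends[OF \<psi>]
  \<comment> \<open>In the last alternative both arguments move, from \<open>x\<close>,
    \<open>y\<close> to \<open>y\<close>, \<open>y'\<close>, and the total increment
    \<open>y' i - x i\<close> is at most 1. In the others only one argument moves.\<close>
  have cov: "covers n (?m x y) (?m x' y')"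
    if "x \<in> grid 1 n" "y \<in> grid 1 n" "x' \<in> grid 1 n" "y' \<in> grid 1 n" "x \<le> x'" "y \<le> y'" "x = x' \<or> y = y' \<or> x' = y"
    for x y x' y'
    using that(1-6)
  proof (rule midpt_covers)
    fix i assume "i < n"
    then show "x' i + y' i \<le> x i + y i + 1"
      using that(7) that(3,4)[THEN grid_leD, of i] by auto
  qed
  show "fst (nerve_eval X n \<psi>) \<in> extensional (grid 1 n)" "snd (nerve_eval X n \<psi>) \<in> extensional (Ar (poset_cat (grid 1 n)))"
    using \<psi> by (simp_all add: nerve_eval_def cells_ex2)
  show "fst (nerve_eval X n \<psi>) x \<in> Ob X" if "x \<in> grid 1 n" for x
    using that by (simp add: nerve_eval_simps[OF \<psi>] sub_ob_in[OF \<psi>] midpt_in_grid)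
  show "snd (nerve_eval X n \<psi>) (x, x) = idn X (fst (nerve_eval X n \<psi>) x)" if "x \<in> grid 1 n" for x
    using that by (simp add: nerve_eval_simps[OF \<psi>] sub_ar_refl[OF \<psi>] sub_ob_in[OF \<psi>] midpt_in_grid categoryD(5)[OF X])
  show "snd (nerve_eval X n \<psi>) (x, y) \<in> Ar X"
    "src X (snd (nerve_eval X n \<psi>) (x, y)) = fst (nerve_eval X n \<psi>) x"
    "tgt X (snd (nerve_eval X n \<psi>) (x, y)) = fst (nerve_eval X n \<psi>) y"
    if "x \<in> grid 1 n" "y \<in> grid 1 n" "x \<le> y" for x y
    using that by (simp_all add: nerve_eval_simps[OF \<psi>] categoryD(1-3)[OF X] ends cov)
  fix x y z assume x: "x \<in> grid 1 n" and y: "y \<in> grid 1 n" and z: "z \<in> grid 1 n" and xy: "x \<le> y" and yz: "y \<le> z"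
  have xz: "x \<le> z"
    using xy yz by (rule order_trans)
  note g = x y z xy yz xz
  have c: "covers n (?m x x) (?m x y)" "covers n (?m x y) (?m y y)" "covers n (?m y y) (?m y z)" "covers n (?m y z) (?m z z)"
    "covers n (?m x y) (?m x z)" "covers n (?m x z) (?m y z)" "covers n (?m x y) (?m y z)"
    "covers n (?m x x) (?m x z)" "covers n (?m x z) (?m z z)"
    using g by (simp_all add: cov)
  \<comment> \<open>Both routes equal the single arrow from the midpoint of \<open>x\<close> and
    \<open>y\<close> to that of \<open>y\<close> and \<open>z\<close>, which lie in one Boolean
    interval.\<close>
  have mid: "cmp X (?A (?m x z) (?m y z)) (?A (?m x y) (?m x z)) = cmp X (?A (?m y y) (?m y z)) (?A (?m x y) (?m y y))"
    using sub_ar_comp[OF \<psi> c(5,6,7)] sub_ar_comp[OF \<psi> c(2,3,7)] by simp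
  \<comment> \<open>Four arrows are bracketed around the middle pair, which \<open>mid\<close>
    exchanges.\<close>
  have assoc: "cmp X (cmp X d c) (cmp X b a) = cmp X d (cmp X (cmp X c b) a)"
    if "a \<in> Ar X" "b \<in> Ar X" "c \<in> Ar X" "d \<in> Ar X" "src X b = tgt X a" "src X c = tgt X b" "src X d = tgt X c" for a b c d
    using that by (simp add: categoryD[OF X])
  show "snd (nerve_eval X n \<psi>) (x, z) = cmp X (snd (nerve_eval X n \<psi>) (y, z)) (snd (nerve_eval X n \<psi>) (x, y))"
    unfolding nerve_eval_simps(2)[OF \<psi> x z xz] nerve_eval_simps(2)[OF \<psi> y z yz] nerve_eval_simps(2)[OF \<psi> x y xy]
      sub_ar_comp[OF \<psi> c(1,5,8)] sub_ar_comp[OF \<psi> c(6,4,9)]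
    by (simp add: assoc ends c mid)
qed

lemma sd2_cube_map_in:
  "box m n f \<Longrightarrow> \<sigma> \<in> cells (sd2_cube m) k \<Longrightarrow> restrict (sd2_pt m n f \<circ> \<sigma>) (grid 1 k) \<in> cells (sd2_cube n) k"
  unfolding sd2_cells_iff by (rule sd2_pt_comp_affine[OF box_affine])

lemma act_ex2: "\<sigma> \<in> cells (sd2_cube m) k \<Longrightarrow> act (ex2 C) m n f \<psi> k \<sigma> = \<psi> k (restrict (sd2_pt m n f \<circ> \<sigma>) (grid 1 k))"
  by (simp add: ex2_def sd2_cube_map_def)

lemma act_ex2_in:
  assumes f: "box m n f" and \<psi>: "cubical_fun (sd2_cube n) C \<psi>"
  shows "cubical_fun (sd2_cube m) C (act (ex2 C) m n f \<psi>)"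
proof (rule cubical_funI)
  show "act (ex2 C) m n f \<psi> k \<in> extensional (cells (sd2_cube m) k)" for k
    by (simp add: ex2_def)
  show "act (ex2 C) m n f \<psi> k \<sigma> \<in> cells C k" if "\<sigma> \<in> cells (sd2_cube m) k" for k \<sigma>
    by (simp add: act_ex2 that cubical_funD(1)[OF \<psi>] sd2_cube_map_in[OF f])
  fix l k g \<sigma> assume g: "box l k g" and \<sigma>: "\<sigma> \<in> cells (sd2_cube m) k"
  have "restrict (sd2_pt m n f \<circ> restrict (\<sigma> \<circ> g) (grid 1 l)) (grid 1 l) =
      act (sd2_cube n) l k g (restrict (sd2_pt m n f \<circ> \<sigma>) (grid 1 k))"
    unfolding act_sd2 by (rule restrict_ext) (simp add: cube_affine_in[OF box_affine[OF g]])
  then show "act (ex2 C) m n f \<psi> l (act (sd2_cube m) l k g \<sigma>) = act C l k g (act (ex2 C) m n f \<psi> k \<sigma>)"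
    by (simp add: act_ex2 \<sigma> act_sd2_in[OF g] act_sd2[of m] cubical_funD(2)[OF \<psi> g] sd2_cube_map_in[OF f])
qed

text \<open>The action on \<open>ex2\<close> replaces a canonical cube by its image under
  \<open>sd2_pt\<close>, which is a canonical cube restricted along \<open>f\<close>. Its extreme
  vertices are still the ends wanted, by \<open>diag_cube_sd2_pt_ends\<close>.\<close>

lemma sub_act_ex2:
  assumes f: "box m n f" and \<psi>: "cubical_fun (sd2_cube n) (nerve X) \<psi>"
  shows "v \<in> grid 2 m \<Longrightarrow> sub_ob m (act (ex2 (nerve X)) m n f \<psi>) v = sub_ob n \<psi> (sd2_pt m n f v)"
    and "covers m v w \<Longrightarrow> sub_ar m (act (ex2 (nerve X)) m n f \<psi>) v w = sub_ar n \<psi> (sd2_pt m n f v) (sd2_pt m n f w)"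
proof -
  note o = origin_in_grid[of m 1] and t = top_pt_in_grid[of m]
  note fo = cube_affine_in[OF box_affine[OF f] o] and ft = cube_affine_in[OF box_affine[OF f] t]
  have cell: "act (ex2 (nerve X)) m n f \<psi> m (diag_cube m v w) = pull m f (\<psi> n (diag_cube n (sd2_pt m n f v) (sd2_pt m n f w)))"
    if vw: "covers m v w" for v w
    using cubical_funD(2)[OF \<psi> f diag_cube_in_sd2[OF sd2_pt_covers[OF box_affine[OF f] vw]]]
    by (simp add: act_ex2 diag_cube_in_sd2[OF vw] sd2_pt_diag_cube[OF box_affine[OF f] vw] act_sd2 act_nerve)
  show "sub_ob m (act (ex2 (nerve X)) m n f \<psi>) v = sub_ob n \<psi> (sd2_pt m n f v)" if "v \<in> grid 2 m"
  proof -
    note vv = covers_refl[OF that]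
    have "sub_ob m (act (ex2 (nerve X)) m n f \<psi>) v = fst (\<psi> n (diag_cube n (sd2_pt m n f v) (sd2_pt m n f v))) (f (origin m))"
      unfolding sub_ob_def cell[OF vv] by (rule fst_pull[OF o])
    then show ?thesis
      by (simp add: sub_diag(1)[OF \<psi> sd2_pt_covers[OF box_affine[OF f] vv] fo] diag_cube_sd2_pt_ends[OF box_affine[OF f] vv])
  qed
  show "sub_ar m (act (ex2 (nerve X)) m n f \<psi>) v w = sub_ar n \<psi> (sd2_pt m n f v) (sd2_pt m n f w)" if vw: "covers m v w"
  proof -
    have "sub_ar m (act (ex2 (nerve X)) m n f \<psi>) v w =
        snd (\<psi> n (diag_cube n (sd2_pt m n f v) (sd2_pt m n f w))) (f (origin m), f (top_pt m))"
      unfolding sub_ar_def cell[OF vw] by (rule snd_pull[OF o t origin_le_top])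
    then show ?thesis
      by (simp add: sub_diag(2)[OF \<psi> sd2_pt_covers[OF box_affine[OF f] vw] fo ft cube_affine_mono(1)[OF box_affine[OF f] o t origin_le_top]]
          diag_cube_sd2_pt_ends[OF box_affine[OF f] vw])
  qed
qed

lemma midpt_covers_mid:
  assumes "x \<in> grid 1 n" "y \<in> grid 1 n" "x \<le> y"
  shows "covers n (midpt n x x) (midpt n x y)" "covers n (midpt n x y) (midpt n y y)"
  using assms by (auto intro!: midpt_covers dest: grid_leD)

text \<open>Naturality reduces to \<open>sd2_pt_midpt\<close>: as midpoints go to midpoints, both
  steps of the composite are carried along.\<close>

lemma cubical_fun_nerve_eval:
  assumes X: "category X"
  shows "cubical_fun (ex2 (nerve X)) (nerve X) (nerve_eval X)"
proof (rule cubical_funI)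
  show "nerve_eval X n \<in> extensional (cells (ex2 (nerve X)) n)" for n
    by (simp add: nerve_eval_def)
  show "nerve_eval X n \<psi> \<in> cells (nerve X) n" if "\<psi> \<in> cells (ex2 (nerve X)) n" for n \<psi>
    using that nerve_eval_in[OF X] by (simp add: cells_ex2)
  fix m n f \<psi> assume f: "box m n f" and "\<psi> \<in> cells (ex2 (nerve X)) n"
  then have \<psi>: "cubical_fun (sd2_cube n) (nerve X) \<psi>"
    by (simp add: cells_ex2)
  note \<psi>f = act_ex2_in[OF f \<psi>]
  have "nerve_eval X m (act (ex2 (nerve X)) m n f \<psi>) = pull m f (nerve_eval X n \<psi>)"
  proof (rule functor_eqI)
    show "is_functor (poset_cat (grid 1 m)) X (nerve_eval X m (act (ex2 (nerve X)) m n f \<psi>))"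
      "is_functor (poset_cat (grid 1 m)) X (pull m f (nerve_eval X n \<psi>))"
      using nerve_eval_in[OF X \<psi>f] pull_in_nerve[OF nerve_eval_in[OF X \<psi>] box_mono_map[OF f]]
      by (simp_all only: nerve_cells)
    note F = box_affine[OF f]
    fix x assume x: "x \<in> grid 1 m"
    show "fst (nerve_eval X m (act (ex2 (nerve X)) m n f \<psi>)) x = fst (pull m f (nerve_eval X n \<psi>)) x"
      using x by (simp add: nerve_eval_simps[OF \<psi>f] nerve_eval_simps[OF \<psi>] fst_pull sub_act_ex2[OF f \<psi>]
          midpt_in_grid sd2_pt_midpt[OF F] cube_affine_in[OF F])
    fix y assume y: "y \<in> grid 1 m" and xy: "x \<le> y"
    show "snd (nerve_eval X m (act (ex2 (nerve X)) m n f \<psi>)) (x, y) = snd (pull m f (nerve_eval X n \<psi>)) (x, y)"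
      by (simp add: x y xy nerve_eval_simps(2)[OF \<psi>f] nerve_eval_simps(2)[OF \<psi>] snd_pull sub_act_ex2[OF f \<psi>]
          midpt_covers_mid sd2_pt_midpt[OF F] cube_affine_in[OF F] cube_affine_mono(1)[OF F])
  qed
  then show "nerve_eval X m (act (ex2 (nerve X)) m n f \<psi>) = act (nerve X) m n f (nerve_eval X n \<psi>)"
    by (simp add: act_nerve)
qed

lemma nerve_eval_natural:
  assumes X: "category X" and Y: "category Y" and K: "is_functor X Y K" and "\<psi> \<in> cells (ex2 (nerve X)) n"
  shows "nerve_eval Y n (ex2_map (nerve X) (nerve_map X K) n \<psi>) = nerve_map X K n (nerve_eval X n \<psi>)"
proof -
  have \<psi>: "cubical_fun (sd2_cube n) (nerve X) \<psi>"
    using assms(4) by (simp add: cells_ex2)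
  define \<psi>' where "\<psi>' = (\<lambda>k. restrict (nerve_map X K k \<circ> \<psi> k) (cells (sd2_cube n) k))"
  have \<psi>': "cubical_fun (sd2_cube n) (nerve Y) \<psi>'"
    unfolding \<psi>'_def by (rule cubical_fun_sd2_comp[OF \<psi> cubical_fun_nerve_map[OF K]])
  note o = origin_in_grid[of n 1] and t = top_pt_in_grid[of n]
  have ob: "sub_ob n \<psi>' v = fst K (sub_ob n \<psi> v)" if "v \<in> grid 2 n" for v
    using that by (simp add: sub_ob_def \<psi>'_def diag_cube_in_sd2 covers_refl nerve_map_cell(2)[OF K sub_cell[OF \<psi>] o])
  have ar: "sub_ar n \<psi>' v w = snd K (sub_ar n \<psi> v w)" if "covers n v w" for v w
    using that by (simp add: sub_ar_def \<psi>'_def diag_cube_in_sd2 nerve_map_cell(3)[OF K sub_cell[OF \<psi>] o t origin_le_top])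
  have comp: "snd K (cmp X g f) = cmp Y (snd K g) (snd K f)" if "f \<in> Ar X" "g \<in> Ar X" "src X g = tgt X f" for f g
    using K that by (simp add: is_functor_def)
  note E = nerve_eval_in[OF X \<psi>]
  have "nerve_eval Y n \<psi>' = nerve_map X K n (nerve_eval X n \<psi>)"
  proof (rule functor_eqI[OF nerve_eval_in[OF Y \<psi>', unfolded nerve_cells] nerve_map_cell(1)[OF K E, unfolded nerve_cells]])
    fix x assume x: "x \<in> grid 1 n"
    show "fst (nerve_eval Y n \<psi>') x = fst (nerve_map X K n (nerve_eval X n \<psi>)) x"
      using x by (simp add: nerve_eval_simps[OF \<psi>'] nerve_eval_simps[OF \<psi>] nerve_map_cell(2)[OF K E] ob midpt_in_grid)
    fix y assume y: "y \<in> grid 1 n" and xy: "x \<le> y"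
    show "snd (nerve_eval Y n \<psi>') (x, y) = snd (nerve_map X K n (nerve_eval X n \<psi>)) (x, y)"
      by (simp add: x y xy nerve_eval_simps(2)[OF \<psi>'] nerve_eval_simps(2)[OF \<psi>] nerve_map_cell(3)[OF K E] ar
          midpt_covers_mid comp sub_ar_ends[OF \<psi>])
  qed
  then show ?thesis
    using assms(4) by (simp add: ex2_map_def \<psi>'_def)
qed

section \<open>Factorization of the retraction through the evaluation\<close>

lemma nerve_retract_factor:
  assumes X: "category X" and p: "p \<in> cells (sharp (nerve X)) m"
  shows "nerve_retract X m p = nerve_eval X m (ex2_map (sharp (nerve X)) (nerve_retract X) m (phi_sharp (nerve X) m p))"
  using p
proof (rule sharp_cases)
  fix n c \<theta> assume c: "c \<in> cells (nerve X) n" and \<theta>: "\<theta> \<in> dimaps m n" and p: "p = sharp_class (nerve X) m n c \<theta>"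
  note C = cubical_set_nerve[of X]
  define \<psi> where "\<psi> = ex2_map (sharp (nerve X)) (nerve_retract X) m (phi_sharp (nerve X) m p)"
  have phi: "cubical_fun (sd2_cube m) (sharp (nerve X)) (phi_sharp (nerve X) m p)"
    using phi_sharp_in[OF C c \<theta>] by (simp add: p cells_ex2)
  have \<psi>_eq: "\<psi> = (\<lambda>k. restrict (nerve_retract X k \<circ> phi_sharp (nerve X) m p k) (cells (sd2_cube m) k))"
    using phi by (simp add: \<psi>_def ex2_map_def cells_ex2)
  have \<psi>: "cubical_fun (sd2_cube m) (nerve X) \<psi>"
    unfolding \<psi>_eq by (rule cubical_fun_sd2_comp[OF phi cubical_fun_nerve_retract])
  \<comment> \<open>\<open>phi2\<close> places the vertex \<open>v\<close> of the subdivision at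
    \<open>v / 2\<close>.\<close>
  define h where "h v = (\<lambda>j\<in>{..<m}. real (v j) / 2)" for v :: pt
  have h_in: "h v \<in> cube m" if "v \<in> grid 2 m" for v
    using grid_leD[OF that] by (force simp: h_def cube_iff)
  \<comment> \<open>The rounded \<open>\<theta>\<close>, extended from the vertices of the cube to
    those of its subdivision; \<open>\<psi>\<close> turns out to be \<open>c\<close> composed with
    it.\<close>
  define g where "g v = round_pt n (\<theta> (h v))" for v
  have g_in: "g v \<in> grid 1 n" for v
    by (simp add: g_def round_pt_in_grid)
  have g_mono: "g v \<le> g w" if "covers m v w" for v w
  proof -
    have "h v \<le> h w"
      using that by (auto simp: h_def le_fun_def covers_def)
    then show ?thesis
      unfolding g_def by (intro round_pt_mono stream_map_mono[OF \<theta>] h_in covers_in[OF that])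
  qed
  have cell: "\<psi> k \<sigma> = pull k (g \<circ> \<sigma>) c" if \<sigma>: "\<sigma> \<in> cells (sd2_cube m) k" for k \<sigma>
  proof -
    have "\<psi> k \<sigma> = pull k (corner k n (restrict (\<theta> \<circ> half_lin k m \<sigma>) (cube k))) c"
      using \<sigma> by (simp add: \<psi>_eq p phi_sharp_class[OF C c \<theta>] nerve_retract_class[OF c stream_map_comp[OF half_lin_dimap[OF \<sigma>] \<theta>]])
    also have "\<dots> = pull k (g \<circ> \<sigma>) c"
    proof (rule pull_cong)
      fix x assume x: "x \<in> grid 1 k"
      have "half_lin k m \<sigma> (vertex k x) = h (\<sigma> x)"
        unfolding h_def half_lin_def restrict_apply'[OF vertex_in_cube[OF x]] lin_vertex[OF sd2_affine[OF \<sigma>] x]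
        by (rule restrict_ext) (simp add: vertex_def)
      then show "corner k n (restrict (\<theta> \<circ> half_lin k m \<sigma>) (cube k)) x = (g \<circ> \<sigma>) x"
        by (simp add: corner_def vertex_in_cube[OF x] g_def)
    qed
    finally show ?thesis .
  qed
  note o = origin_in_grid[of m 1] and t = top_pt_in_grid[of m]
  have ob: "sub_ob m \<psi> v = fst c (g v)" if "v \<in> grid 2 m" for v
    using that by (simp add: sub_ob_def cell diag_cube_in_sd2 covers_refl fst_pull[OF o] diag_cube_origin)
  have ar: "sub_ar m \<psi> v w = snd c (g v, g w)" if "covers m v w" for v w
    using that by (simp add: sub_ar_def cell diag_cube_in_sd2 snd_pull[OF o t origin_le_top] diag_cube_origin diag_cube_top)
  \<comment> \<open>Halving takes a doubled point back to a vertex, where \<open>g\<close> is the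
    rounding used by the retraction.\<close>
  have g_double: "g (midpt m x x) = corner m n \<theta> x" for x
  proof -
    have "h (midpt m x x) = vertex m x"
      by (auto simp: h_def vertex_def midpt_def)
    then show ?thesis
      by (simp add: g_def corner_def)
  qed
  have "pull m (corner m n \<theta>) c = nerve_eval X m \<psi>"
  proof (rule functor_eqI[OF pull_in_nerve[OF c corner_mono_map[OF \<theta>], unfolded nerve_cells] nerve_eval_in[OF X \<psi>, unfolded nerve_cells]])
    fix x assume x: "x \<in> grid 1 m"
    show "fst (pull m (corner m n \<theta>) c) x = fst (nerve_eval X m \<psi>) x"
      using x by (simp add: fst_pull nerve_eval_simps[OF \<psi>] ob midpt_in_grid g_double)
    fix y assume y: "y \<in> grid 1 m" and xy: "x \<le> y"
    note cov = midpt_covers_mid[OF x y xy]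
    \<comment> \<open>The detour over the midpoint disappears by functoriality of \<open>c\<close>,
      since \<open>g\<close> is monotone along both steps.\<close>
    have "snd c (g (midpt m x x), g (midpt m y y)) =
        cmp X (snd c (g (midpt m x y), g (midpt m y y))) (snd c (g (midpt m x x), g (midpt m x y)))"
      by (rule nerveD(8)[OF c g_in g_in g_in cov[THEN g_mono]])
    then show "snd (pull m (corner m n \<theta>) c) (x, y) = snd (nerve_eval X m \<psi>) (x, y)"
      by (simp add: snd_pull[OF x y xy] nerve_eval_simps(2)[OF \<psi> x y xy] ar[OF cov(1)] ar[OF cov(2)] g_double)
  qed
  then show ?thesis
    by (simp add: p nerve_retract_class[OF c \<theta>] flip: \<psi>_def[unfolded p])
qed

theorem proposition5p6:
  fixes \<Gamma> :: "('g, 'h) cat"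
    and X :: "('g, 'h, ('o, 'm) cat, ('o, 'm, 'o, 'm) func) diagram"
  assumes "category \<Gamma>"
    and "gamma_category \<Gamma> X"
  shows "gamma_cubcat \<Gamma> (gamma_nerve \<Gamma> X)"
  unfolding gamma_cubcat_def
proof (intro conjI exI)
  have cat: "category (at_ob X a)" if "a \<in> Ob \<Gamma>" for a
    using assms(2) that by (simp add: gamma_category_def)
  have func: "is_functor (at_ob X (src \<Gamma> h)) (at_ob X (tgt \<Gamma> h)) (at_ar X h)" if "h \<in> Ar \<Gamma>" for h
    using assms(2) that by (simp add: gamma_category_def)
  \<comment> \<open>Naturality of the evaluation needs categories at both ends of
    \<open>h\<close>.\<close>
  have ends: "src \<Gamma> h \<in> Ob \<Gamma>" "tgt \<Gamma> h \<in> Ob \<Gamma>" if "h \<in> Ar \<Gamma>" for h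
    using assms(1) that by (auto simp: category_def)
  show "gamma_cubical_set \<Gamma> (gamma_nerve \<Gamma> X)"
    by (rule gamma_cubical_set_nerve[OF assms(2,1)])
  show "gamma_cubical_fun \<Gamma> (gamma_sharp \<Gamma> (gamma_nerve \<Gamma> X)) (gamma_nerve \<Gamma> X) (\<lambda>a. nerve_retract (at_ob X a))"
    by (simp add: gamma_cubical_fun_def gamma_sharp_def gamma_nerve_def cubical_fun_nerve_retract nerve_retract_natural func)
  show "gamma_cubical_fun \<Gamma> (gamma_ex2 \<Gamma> (gamma_nerve \<Gamma> X)) (gamma_nerve \<Gamma> X) (\<lambda>a. nerve_eval (at_ob X a))"
    by (simp add: gamma_cubical_fun_def gamma_ex2_def gamma_nerve_def cubical_fun_nerve_eval nerve_eval_natural func cat ends)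
  show "\<forall>a\<in>Ob \<Gamma>. \<forall>n. \<forall>c\<in>cells (at_ob (gamma_nerve \<Gamma> X) a) n.
      nerve_retract (at_ob X a) n (sharp_unit (at_ob (gamma_nerve \<Gamma> X) a) n c) = c"
    by (simp add: gamma_nerve_def nerve_retract_unit)
  show "\<forall>a\<in>Ob \<Gamma>. \<forall>n. \<forall>p\<in>cells (sharp (at_ob (gamma_nerve \<Gamma> X) a)) n.
      nerve_retract (at_ob X a) n p = nerve_eval (at_ob X a) n
        (ex2_map (sharp (at_ob (gamma_nerve \<Gamma> X) a)) (nerve_retract (at_ob X a)) n (phi_sharp (at_ob (gamma_nerve \<Gamma> X) a) n p))"
  proof (intro ballI allI)
    fix a n p assume "a \<in> Ob \<Gamma>" "p \<in> cells (sharp (at_ob (gamma_nerve \<Gamma> X) a)) n"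
    then show "nerve_retract (at_ob X a) n p = nerve_eval (at_ob X a) n
        (ex2_map (sharp (at_ob (gamma_nerve \<Gamma> X) a)) (nerve_retract (at_ob X a)) n (phi_sharp (at_ob (gamma_nerve \<Gamma> X) a) n p))"
      using nerve_retract_factor[OF cat] by (simp add: gamma_nerve_def)
  qed
qed

end
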